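(* Let $(p_j)_{j\ge 1}$ be pairwise distinct prime numbers and let $\boldsymbol{\gamma}=(\gamma_j)_{j\ge1}$ be positive real weights. For $s\in\mathbb{N}$ put $\boldsymbol{p}=(p_1,\ldots,p_s)$, and let $\widehat{e}_{N,s}(\mathcal{H}_{\boldsymbol{p}},K_{s,\boldsymbol{\gamma}})$ be the root mean square worst-case error, in the weighted anchored Sobolev space $\mathscr{H}(K_{s,\boldsymbol{\gamma}})$, of the QMC rule based on the first $N$ points of the randomly $\boldsymbol{p}$-adically shifted Halton sequence. Then for all $s,N\in\mathbb{N}$, $$[\widehat{e}_{N,s}(\mathcal{H}_{\boldsymbol{p}},K_{s,\boldsymbol{\gamma}})]^2 \le \frac{1}{N^2}\left[\prod_{j=1}^s \left(1+\gamma_j (\log N)\frac{p_j^2}{\log p_j}\right)+\prod_{j=1}^s\left(1+\frac{\gamma_j}{2}\right)\prod_{j=1}^s\left(1+\frac{\gamma_j p_j}{6}\right)\right].$$ In particular, if $\sum_{j=1}^\infty \gamma_j\frac{p_j^2}{\log p_j}<\infty$, then for every $\delta>0$ there is a constant $C>0$, depending only on $\delta$ and on the sequences $(\gamma_j)_{j\ge1}$ and $(p_j)_{j\ge 1}$ (and not on the dimension $s$ or on $N$), such that $$\widehat{e}_{N,s}(\mathcal{H}_{\boldsymbol{p}},K_{s,\boldsymbol{\gamma}})\le \frac{C}{N^{1-\delta}}\qquad\text{for all } s\in\mathbb{N} \text{ and all } N\ge 2.$$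
   Context: $\log$ is the natural logarithm. Function space: $\mathscr{H}(K_{s,\boldsymbol{\gamma}})$ is the reproducing kernel Hilbert space of functions on $[0,1]^s$ with kernel $K_{s,\boldsymbol{\gamma}}(\boldsymbol{x},\boldsymbol{y})=\prod_{j=1}^s(1+\gamma_j\min(1-x_j,1-y_j))$ (a Sobolev space anchored at $(1,\ldots,1)$). Worst-case error: for a sequence $\mathcal{S}=(\boldsymbol{x}_n)_{n\ge0}$ in $[0,1)^s$ and a reproducing kernel $K$, $e_{N,s}(\mathcal{S},K)=\sup_{\|f\|_K\le1}\left|\int_{[0,1]^s}f(\boldsymbol{x})\,\mathrm{d}\boldsymbol{x}-\frac1N\sum_{n=0}^{N-1}f(\boldsymbol{x}_n)\right|$, the supremum being over the unit ball of $\mathscr{H}(K)$. Halton sequence: for a prime $p$ and $n=n_0+n_1p+n_2p^2+\cdots\in\mathbb{N}_0$ (base $p$ expansion) let $\phi_p(n)=\sum_{k\ge1}n_{k-1}p^{-k}$. Then $\mathcal{H}_{\boldsymbol{p}}=(\boldsymbol{x}_n)_{n\ge0}$ with $\boldsymbol{x}_n=(\phi_{p_1}(n),\ldots,\phi_{p_s}(n))$. $\boldsymbol{p}$-adic shift: let $\mathbb{Z}_p$ be the $p$-adic integers $z=\sum_{r\ge0}z_rp^r$, $z_r\in\{0,\ldots,p-1\}$, with $p$-adic addition. Extend $\phi_p$ to $\phi_p:\mathbb{Z}_p\to[0,1)$, $\phi_p(z)=\sum_{r\ge0}z_rp^{-r-1}\pmod 1$, and let $\phi_p^+:[0,1)\to\mathbb{Z}_p$,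 $\phi_p^+(\sum_{r\ge0}x_rp^{-r-1})=\sum_{r\ge0}x_rp^r$, always using the finite base $p$ expansion when one exists. For $x,\sigma\in[0,1)$ put $x\oplus_p\sigma=\phi_p(\phi_p^+(x)+\phi_p^+(\sigma))$, and for $\boldsymbol{x},\boldsymbol{\sigma}\in[0,1)^s$ put $\boldsymbol{x}\oplus_{\boldsymbol{p}}\boldsymbol{\sigma}=(x_1\oplus_{p_1}\sigma_1,\ldots,x_s\oplus_{p_s}\sigma_s)$. Let $\mathcal{H}_{\boldsymbol{p},\boldsymbol{\sigma}}=(\boldsymbol{x}_n\oplus_{\boldsymbol{p}}\boldsymbol{\sigma})_{n\ge0}$, where $(\boldsymbol{x}_n)_{n\ge 0}=\mathcal{H}_{\boldsymbol{p}}$. RMS worst-case error: $\widehat{e}_{N,s}(\mathcal{H}_{\boldsymbol{p}},K_{s,\boldsymbol{\gamma}})=\sqrt{\mathbb{E}_{\boldsymbol{\sigma}}[e_{N,s}^2(\mathcal{H}_{\boldsymbol{p},\boldsymbol{\sigma}},K_{s,\boldsymbol{\gamma}})]}$, where $\boldsymbol{\sigma}$ is uniformly distributed on $[0,1)^s$. *)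

theory Defs
  imports "HOL-Probability.Probability"
begin

text \<open>
  The reproducing kernel Hilbert space on a set \<open>X\<close> with kernel \<open>K\<close>: a Hilbert space \<open>H\<close> of
  real functions on \<open>X\<close> (represented as elements of \<open>extensional X\<close>) with inner product \<open>ip\<close>
  that contains all sections \<open>K(\<cdot>, y)\<close> and has the reproducing property. By the
  Moore--Aronszajn theorem, \<open>H\<close> and the restriction of \<open>ip\<close> to \<open>H\<close> are determined by \<open>X\<close>
  and \<open>K\<close>.
\<close>

locale rkhs =
  fixes X :: "'a set"
    and K :: "'a \<Rightarrow> 'a \<Rightarrow> real"
    and H :: "('a \<Rightarrow> real) set"
    and ip :: "('a \<Rightarrow> real) \<Rightarrow> ('a \<Rightarrow> real) \<Rightarrow> real"
  assumes subset_extensional: "H \<subseteq> extensional X"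
    and zero_mem: "(\<lambda>x\<in>X. 0) \<in> H"
    and add_mem: "\<And>f g. f \<in> H \<Longrightarrow> g \<in> H \<Longrightarrow> (\<lambda>x\<in>X. f x + g x) \<in> H"
    and scale_mem: "\<And>c f. f \<in> H \<Longrightarrow> (\<lambda>x\<in>X. c * f x) \<in> H"
    and ip_sym: "\<And>f g. f \<in> H \<Longrightarrow> g \<in> H \<Longrightarrow> ip f g = ip g f"
    and ip_add: "\<And>f g h. f \<in> H \<Longrightarrow> g \<in> H \<Longrightarrow> h \<in> H \<Longrightarrow>
      ip (\<lambda>x\<in>X. f x + g x) h = ip f h + ip g h"
    and ip_scale: "\<And>c f g. f \<in> H \<Longrightarrow> g \<in> H \<Longrightarrow> ip (\<lambda>x\<in>X. c * f x) g = c * ip f g"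
    and ip_nonneg: "\<And>f. f \<in> H \<Longrightarrow> 0 \<le> ip f f"
    and ip_definite: "\<And>f. f \<in> H \<Longrightarrow> ip f f = 0 \<Longrightarrow> f = (\<lambda>x\<in>X. 0)"
    and complete: "Metric_space.mcomplete H
      (\<lambda>f g. sqrt (ip (\<lambda>x\<in>X. f x - g x) (\<lambda>x\<in>X. f x - g x)))"
    and kernel_mem: "\<And>y. y \<in> X \<Longrightarrow> (\<lambda>x\<in>X. K x y) \<in> H"
    and reproducing: "\<And>f y. f \<in> H \<Longrightarrow> y \<in> X \<Longrightarrow> ip f (\<lambda>x\<in>X. K x y) = f y"

text \<open>Points of \<open>\<real>\<^sup>s\<close> are elements of \<open>extensional {1..s}\<close>.\<close>

definition unit_cube :: "nat \<Rightarrow> (nat \<Rightarrow> real) set" where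
  "unit_cube s = {1..s} \<rightarrow>\<^sub>E {0..1}"

definition half_open_cube :: "nat \<Rightarrow> (nat \<Rightarrow> real) set" where
  "half_open_cube s = {1..s} \<rightarrow>\<^sub>E {0..<1}"

definition lborel_dim :: "nat \<Rightarrow> (nat \<Rightarrow> real) measure" where
  "lborel_dim s = (\<Pi>\<^sub>M j\<in>{1..s}. lborel)"

definition sobolev_kernel ::
  "nat \<Rightarrow> (nat \<Rightarrow> real) \<Rightarrow> (nat \<Rightarrow> real) \<Rightarrow> (nat \<Rightarrow> real) \<Rightarrow> real" where
  "sobolev_kernel s \<gamma> x y = (\<Prod>j=1..s. 1 + \<gamma> j * min (1 - x j) (1 - y j))"

definition worst_case_error ::
  "((nat \<Rightarrow> real) \<Rightarrow> real) set \<Rightarrow> (((nat \<Rightarrow> real) \<Rightarrow> real) \<Rightarrow> ((nat \<Rightarrow> real) \<Rightarrow> real) \<Rightarrow> real) \<Rightarrow>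
    nat \<Rightarrow> nat \<Rightarrow> (nat \<Rightarrow> nat \<Rightarrow> real) \<Rightarrow> real" where
  "worst_case_error H ip s N x =
    (SUP f\<in>{f \<in> H. sqrt (ip f f) \<le> 1}.
      \<bar>(LINT y:unit_cube s|lborel_dim s. f y) - 1 / real N * (\<Sum>n<N. f (x n))\<bar>)"

definition radical_inverse :: "nat \<Rightarrow> nat \<Rightarrow> real" where
  "radical_inverse p n = (\<Sum>r. real (n div p ^ r mod p) / real p ^ (r + 1))"

definition halton :: "nat \<Rightarrow> (nat \<Rightarrow> nat) \<Rightarrow> nat \<Rightarrow> nat \<Rightarrow> real" where
  "halton s p n = (\<lambda>j\<in>{1..s}. radical_inverse (p j) n)"

text \<open>
  The \<open>p\<close>-adic integer \<open>\<Sum>r. z r * p ^ r\<close> is represented by its digit sequence \<open>z\<close>, with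
  \<open>z r < p\<close> for all \<open>r\<close>. Addition is digitwise with carry.
\<close>

primrec padic_carry :: "nat \<Rightarrow> (nat \<Rightarrow> nat) \<Rightarrow> (nat \<Rightarrow> nat) \<Rightarrow> nat \<Rightarrow> nat" where
  "padic_carry p z w 0 = 0"
| "padic_carry p z w (Suc r) = (z r + w r + padic_carry p z w r) div p"

definition padic_add :: "nat \<Rightarrow> (nat \<Rightarrow> nat) \<Rightarrow> (nat \<Rightarrow> nat) \<Rightarrow> nat \<Rightarrow> nat" where
  "padic_add p z w r = (z r + w r + padic_carry p z w r) mod p"

definition padic_phi :: "nat \<Rightarrow> (nat \<Rightarrow> nat) \<Rightarrow> real" where
  "padic_phi p z = frac (\<Sum>r. real (z r) / real p ^ (r + 1))"

text \<open>
  For \<open>x \<in> [0,1)\<close> the floor formula gives the base \<open>p\<close> expansion that does not end in an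
  infinite run of digits \<open>p - 1\<close>, hence the finite expansion whenever there is one.
\<close>

definition padic_phi_plus :: "nat \<Rightarrow> real \<Rightarrow> nat \<Rightarrow> nat" where
  "padic_phi_plus p x r = nat \<lfloor>x * real p ^ (r + 1)\<rfloor> mod p"

definition padic_shift :: "nat \<Rightarrow> real \<Rightarrow> real \<Rightarrow> real" where
  "padic_shift p x \<sigma> = padic_phi p (padic_add p (padic_phi_plus p x) (padic_phi_plus p \<sigma>))"

definition shifted_halton :: "nat \<Rightarrow> (nat \<Rightarrow> nat) \<Rightarrow> (nat \<Rightarrow> real) \<Rightarrow> nat \<Rightarrow> nat \<Rightarrow> real" where
  "shifted_halton s p \<sigma> n = (\<lambda>j\<in>{1..s}. padic_shift (p j) (halton s p n j) (\<sigma> j))"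

definition rms_worst_case_error ::
  "((nat \<Rightarrow> real) \<Rightarrow> real) set \<Rightarrow> (((nat \<Rightarrow> real) \<Rightarrow> real) \<Rightarrow> ((nat \<Rightarrow> real) \<Rightarrow> real) \<Rightarrow> real) \<Rightarrow>
    nat \<Rightarrow> nat \<Rightarrow> (nat \<Rightarrow> nat) \<Rightarrow> real" where
  "rms_worst_case_error H ip s N p =
    sqrt (LINT \<sigma>|uniform_measure (lborel_dim s) (half_open_cube s).
      (worst_case_error H ip s N (shifted_halton s p \<sigma>))\<^sup>2)"

end

theory Submission
  imports Defs "HOL-Number_Theory.Cong"
begin

text \<open>
  For functions \<open>f\<close> in the unit ball, the reproducing property and the Cauchy--Schwarz inequality bound every finite
  combination of point evaluations by the corresponding quadratic form in the kernel
  (\<open>unit_ball_combination_le\<close>). As \<open>f\<close> inherits continuity from the kernel, its integral is a limit of grid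
  averages, and the squared worst-case error of points \<open>x\<^sub>n\<close> is at most
  \<open>\<Prod>\<^sub>j (1 + \<gamma>\<^sub>j/3) - 2/N \<Sum>\<^sub>n \<Prod>\<^sub>j (1 + \<gamma>\<^sub>j (1 - x\<^sub>n\<^sub>j\<^sup>2)/2) + 1/N\<^sup>2 \<Sum>\<^sub>n \<Sum>\<^sub>m K(x\<^sub>n, x\<^sub>m)\<close>
  (\<open>worst_case_error_square_le\<close>).

  Averaging over the shift works one coordinate at a time. The shifted coordinate of the \<open>n\<close>-th point is the limit of the
  digit reversals of \<open>n + \<beta>\<close>, where \<open>\<beta>\<close> is the integer formed by the first \<open>G\<close> digits of \<open>\<sigma>\<close> and is uniformly
  distributed modulo \<open>p\<^sup>G\<close>. Hence a shifted point is uniform in \<open>[0,1)\<close>, and the mean of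
  \<open>min (1 - x\<^sub>n) (1 - x\<^sub>m)\<close> equals \<open>1/2 - h(n - m)\<close> with \<open>h(0) = 0\<close> and \<open>h(p\<^sup>v u) = t (p - t)/p\<^bsup>v+2\<^esup>\<close> for \<open>t = u mod p \<noteq> 0\<close>
  (\<open>sum_abs_digit_reversal_diff\<close>). The mean square error is therefore at most
  \<open>1/N\<^sup>2 \<Sum>\<^sub>n \<Sum>\<^sub>m \<Prod>\<^sub>j (1 + \<gamma>\<^sub>j (1/2 - h\<^sub>j(n - m))) - \<Prod>\<^sub>j (1 + \<gamma>\<^sub>j/3)\<close>.

  The function \<open>1/2 - h\<close> has mean \<open>1/3\<close> over the \<open>p\<close>-adic integers. Its martingale differences \<open>D\<^sub>a\<close> along the residues
  modulo \<open>p\<^sup>a\<close> have period \<open>p\<^bsup>a+1\<^esup>\<close>, zero mean and absolute sum at most \<open>p\<^bsup>1-a\<^esup>/6\<close> over a period, and stopping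
  after \<open>G\<close> levels costs at most \<open>1/(6 p\<^sup>G)\<close>. In the expanded product the periods in distinct coordinates are
  coprime, so by the Chinese remainder theorem each term other than the constant one is a periodic
  function with zero mean. Its double sum over \<open>n, m < N\<close> depends only on the remainder of \<open>N\<close> modulo the period and is at
  most the product of \<open>\<gamma>\<^sub>j p\<^sub>j\<^sup>2/6\<close> over the coordinates with a level and of \<open>1 + \<gamma>\<^sub>j/3\<close> over the others, for every choice of levels
  (\<open>abs_sum_differences_prod_le\<close>, \<open>main_term_le\<close>). Taking \<open>G\<close> maximal with \<open>p\<^sup>G \<le> N\<^sup>2\<close>, there are at most \<open>2 ln N/ln p\<close> levels, which gives the first product of the
  bound; the truncation error gives the second.

  If \<open>\<Sum>\<^sub>j \<gamma>\<^sub>j p\<^sub>j\<^sup>2/ln p\<^sub>j\<close> converges, the first product grows more slowly than every power of \<open>N\<close>, uniformly in the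
  dimension (\<open>prod_one_plus_le_exp\<close>), and the second one stays bounded.
\<close>

section \<open>Sums of periodic functions\<close>

lemma sum_lessThan_mult_split:
  fixes f :: "nat \<Rightarrow> 'a::comm_monoid_add"
  shows "(\<Sum>d<a * b. f d) = (\<Sum>k<b. \<Sum>r<a. f (r + a * k))"
proof -
  have "sum f {m * a..<m * a + a} = (\<Sum>r<a. f (r + a * m))" for m
    by (rule sum.reindex_bij_witness[of _ "\<lambda>r. r + m * a" "\<lambda>d. d - m * a"])
      (auto simp: mult.commute)
  then show ?thesis
    using sum.nat_group[of f a b] by (simp add: mult.commute)
qed

lemma sum_lessThan_add:
  fixes f :: "nat \<Rightarrow> 'a::comm_monoid_add"
  shows "(\<Sum>d<a + b. f d) = (\<Sum>d<a. f d) + (\<Sum>d<b. f (a + d))"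
  by (induction b) (simp_all add: add.assoc)

definition periodic :: "nat \<Rightarrow> (int \<Rightarrow> 'a) \<Rightarrow> bool" where
  "periodic q f \<longleftrightarrow> (\<forall>d. f (d + int q) = f d)"

lemma periodic_add_mult:
  assumes "periodic q f"
  shows "f (d + int q * k) = f d"
proof (induction k rule: int_induct[where k = 0])
  case (step1 i)
  have "f (d + int q * (i + 1)) = f ((d + int q * i) + int q)"
    by (simp add: algebra_simps)
  then show ?case using assms step1 by (simp only: periodic_def)
next
  case (step2 i)
  have "f ((d + int q * (i - 1)) + int q) = f (d + int q * i)"
    by (simp add: algebra_simps)
  then show ?case using assms step2 by (simp add: periodic_def)
qed simp

lemma periodic_mod:
  assumes "periodic q f"
  shows "f (d mod int q) = f d"
  using periodic_add_mult[OF assms, of "d mod int q" "d div int q"] by (simp add: add.commute)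

lemma periodic_cong:
  assumes "periodic q f" "d mod int q = e mod int q"
  shows "f d = f e"
  using periodic_mod[OF assms(1)] assms(2) by metis

lemma periodic_compose: "periodic q f \<Longrightarrow> periodic q (\<lambda>d. F (f d))"
  by (simp add: periodic_def)

lemma periodic_shift:
  assumes "periodic q f"
  shows "periodic q (\<lambda>d. f (d + c))"
  unfolding periodic_def
proof
  fix d
  have "f (d + c + int q) = f (d + c)"
    using assms by (simp only: periodic_def)
  then show "f (d + int q + c) = f (d + c)"
    by (simp only: add.assoc add.commute[of "int q" c])
qed

lemma periodic_dvd:
  assumes "periodic q f" "q dvd q'"
  shows "periodic q' f"
proof -
  obtain k where "q' = q * k" using assms(2) by blast
  then show ?thesis
    using periodic_add_mult[OF assms(1), of _ "int k"] by (simp add: periodic_def)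
qed

text \<open>
  Multiplication by a unit of \<open>\<int>/q\<close> followed by a translation permutes the residues.
\<close>

lemma sum_affine_coprime:
  fixes f :: "int \<Rightarrow> 'a::comm_monoid_add"
  assumes f: "periodic q f" and q: "q > 0" and cop: "coprime c q"
  shows "(\<Sum>k<q. f (r + int c * int k)) = (\<Sum>k<q. f (int k))"
proof -
  let ?g = "\<lambda>k. nat ((r + int c * int k) mod int q)"
  have im: "?g ` {..<q} \<subseteq> {..<q}"
    using q by (auto simp: nat_less_iff)
  have inj: "inj_on ?g {..<q}"
  proof (rule inj_onI)
    fix k l assume kl: "k \<in> {..<q}" "l \<in> {..<q}" "?g k = ?g l"
    then have "(r + int c * int k) mod int q = (r + int c * int l) mod int q"
      using q by (simp add: eq_nat_nat_iff)
    then have "[r + int c * int k = r + int c * int l] (mod int q)"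
      by (simp add: cong_def)
    then have "[int c * int k = int c * int l] (mod int q)"
      using cong_add_lcancel by blast
    then have "[int k = int l] (mod int q)"
      using cop cong_mult_lcancel[of "int c" "int q"] by (simp add: coprime_int_iff)
    then show "k = l" using kl by (simp add: cong_def zmod_int[symmetric])
  qed
  have bij: "bij_betw ?g {..<q} {..<q}"
    using inj im by (simp add: bij_betw_def endo_inj_surj)
  have "(\<Sum>k<q. f (r + int c * int k)) = (\<Sum>k<q. f (int (?g k)))"
  proof (rule sum.cong[OF refl])
    fix k
    have "int (?g k) = (r + int c * int k) mod int q"
      using q by simp
    then show "f (r + int c * int k) = f (int (?g k))"
      using periodic_mod[OF f, of "r + int c * int k"] by simp
  qed
  also have "\<dots> = (\<Sum>k<q. f (int k))"
    using sum.reindex_bij_betw[OF bij, of "\<lambda>k. f (int k)"] .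
  finally show ?thesis .
qed

lemma sum_periodic_shift:
  fixes f :: "int \<Rightarrow> 'a::comm_monoid_add"
  assumes "periodic q f" "q > 0"
  shows "(\<Sum>k<q. f (int k + r)) = (\<Sum>k<q. f (int k))"
  using sum_affine_coprime[OF assms, of 1 r] by (simp add: add.commute)

text \<open>
  The Chinese remainder theorem: writing \<open>d = r + a k\<close>, the first factor sees only \<open>r\<close>, while for fixed
  \<open>r\<close> the residues of \<open>d\<close> modulo \<open>b\<close> are permuted as \<open>k\<close> runs through a full period.
\<close>

lemma sum_mult_coprime_periods:
  fixes f g :: "int \<Rightarrow> real"
  assumes f: "periodic a f" and g: "periodic b g" and pos: "a > 0" "b > 0" and cop: "coprime a b"
  shows "(\<Sum>d<a * b. f (int d) * g (int d)) = (\<Sum>d<a. f (int d)) * (\<Sum>d<b. g (int d))"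
proof -
  have "(\<Sum>d<a * b. f (int d) * g (int d))
      = (\<Sum>r<a. \<Sum>k<b. f (int r + int a * int k) * g (int r + int a * int k))"
    unfolding sum_lessThan_mult_split by (subst sum.swap) simp
  also have "\<dots> = (\<Sum>r<a. f (int r) * (\<Sum>k<b. g (int r + int a * int k)))"
    by (simp add: periodic_add_mult[OF f] sum_distrib_left)
  also have "\<dots> = (\<Sum>r<a. f (int r) * (\<Sum>k<b. g (int k)))"
    using sum_affine_coprime[OF g pos(2) cop] by simp
  finally show ?thesis by (simp add: sum_distrib_right)
qed

lemma periodic_prod:
  fixes f :: "'i \<Rightarrow> int \<Rightarrow> real"
  assumes "finite I" "\<And>i. i \<in> I \<Longrightarrow> periodic (q i) (f i)"
  shows "periodic (\<Prod>i\<in>I. q i) (\<lambda>d. \<Prod>i\<in>I. f i d)"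
  unfolding periodic_def
proof (intro allI prod.cong refl)
  fix d i assume i: "i \<in> I"
  have "periodic (\<Prod>i\<in>I. q i) (f i)"
    using periodic_dvd[OF assms(2)[OF i]] assms(1) i by (simp add: dvd_prodI)
  then show "f i (d + int (\<Prod>i\<in>I. q i)) = f i d"
    by (simp only: periodic_def)
qed

lemma sum_prod_coprime_periods:
  fixes f :: "'i \<Rightarrow> int \<Rightarrow> real"
  assumes "finite I" "\<And>i. i \<in> I \<Longrightarrow> periodic (q i) (f i)" "\<And>i. i \<in> I \<Longrightarrow> q i > 0"
    "\<And>i j. i \<in> I \<Longrightarrow> j \<in> I \<Longrightarrow> i \<noteq> j \<Longrightarrow> coprime (q i) (q j)"
  shows "(\<Sum>d<(\<Prod>i\<in>I. q i). \<Prod>i\<in>I. f i (int d)) = (\<Prod>i\<in>I. \<Sum>d<q i. f i (int d))"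
  using assms
proof (induction I rule: finite_induct)
  case (insert i I)
  have "coprime (q i) (\<Prod>i\<in>I. q i)"
    using insert by (intro prod_coprime_right) auto
  then show ?case
    using insert sum_mult_coprime_periods[of "q i" "f i" "\<Prod>i\<in>I. q i" "\<lambda>d. \<Prod>i\<in>I. f i d"]
    by (simp add: periodic_prod prod_pos)
qed simp

lemma sum_zero_mean_remainder:
  fixes f :: "int \<Rightarrow> real"
  assumes f: "periodic q f" and q: "q > 0" and zero: "(\<Sum>d<q. f (int d)) = 0"
  shows "(\<Sum>n<N. f (int n + c)) = (\<Sum>n<N mod q. f (int n + c))"
proof -
  have full: "(\<Sum>n<q * k. f (int n + c)) = 0" for k
  proof -
    have "(\<Sum>n<q * k. f (int n + c)) = (\<Sum>l<k. \<Sum>r<q. f (int r + (int q * int l + c)))"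
      unfolding sum_lessThan_mult_split by (simp add: add.assoc)
    then show ?thesis
      using sum_periodic_shift[OF f q] zero by simp
  qed
  have "(\<Sum>n<N. f (int n + c)) = (\<Sum>n<q * (N div q) + N mod q. f (int n + c))"
    by simp
  also have "\<dots> = (\<Sum>n<N mod q. f (int (q * (N div q) + n) + c))"
    unfolding sum_lessThan_add using full by simp
  also have "\<dots> = (\<Sum>n<N mod q. f (int n + c))"
  proof (rule sum.cong[OF refl])
    fix n
    have "int (q * (N div q) + n) + c = (int n + c) + int q * int (N div q)"
      by (simp add: algebra_simps)
    then show "f (int (q * (N div q) + n) + c) = f (int n + c)"
      by (simp only: periodic_add_mult[OF f])
  qed
  finally show ?thesis .
qed

text \<open>
  Complete periods contribute nothing, in \<open>n\<close> as well as in \<open>m\<close>, so that only the remainder \<open>N mod q\<close> is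
  left in both sums. The bound is therefore independent of \<open>N\<close>.
\<close>

lemma abs_sum_differences_le:
  fixes f :: "int \<Rightarrow> real"
  assumes f: "periodic q f" and q: "q > 0" and zero: "(\<Sum>d<q. f (int d)) = 0"
  shows "\<bar>\<Sum>m<N. \<Sum>n<N. f (int n - int m)\<bar> \<le> real q * (\<Sum>d<q. \<bar>f (int d)\<bar>)"
proof -
  let ?R = "N mod q"
  have per_m: "periodic q (\<lambda>m. f (int n - m))" for n
    unfolding periodic_def
  proof
    fix d
    have "int n - (d + int q) = (int n - d) + int q * (-1)" by simp
    then show "f (int n - (d + int q)) = f (int n - d)"
      by (simp only: periodic_add_mult[OF f])
  qed
  have zero_m: "(\<Sum>m<q. f (int n - int m)) = 0" for n
  proof -
    have "(\<Sum>m<q. f (int n - int m)) = (\<Sum>m<q. f (int n - int (q - Suc m)))"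
      by (rule sum.nat_diff_reindex[symmetric])
    also have "\<dots> = (\<Sum>m<q. f (int m + (int n + 1)))"
    proof (rule sum.cong[OF refl])
      fix m assume "m \<in> {..<q}"
      then have "int n - int (q - Suc m) = (int m + (int n + 1)) + int q * (-1)"
        by (simp add: of_nat_diff)
      then show "f (int n - int (q - Suc m)) = f (int m + (int n + 1))"
        by (simp only: periodic_add_mult[OF f])
    qed
    also have "\<dots> = 0"
      using sum_periodic_shift[OF f q] zero by simp
    finally show ?thesis .
  qed
  have "(\<Sum>m<N. \<Sum>n<N. f (int n - int m)) = (\<Sum>m<N. \<Sum>n<?R. f (int n - int m))"
    using sum_zero_mean_remainder[OF f q zero, where c = "- int _"] by simp
  also have "\<dots> = (\<Sum>n<?R. \<Sum>m<N. f (int n - int m))"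
    by (rule sum.swap)
  also have "\<dots> = (\<Sum>n<?R. \<Sum>m<?R. f (int n - int m))"
    using sum_zero_mean_remainder[OF per_m q zero_m, where c = 0] by simp
  also have "\<dots> = (\<Sum>m<?R. \<Sum>n<?R. f (int n - int m))"
    by (rule sum.swap)
  finally have "\<bar>\<Sum>m<N. \<Sum>n<N. f (int n - int m)\<bar> \<le> (\<Sum>m<?R. \<Sum>n<?R. \<bar>f (int n - int m)\<bar>)"
    by (simp only:) (intro order_trans[OF sum_abs] sum_mono sum_abs)
  also have "\<dots> \<le> (\<Sum>m<?R. \<Sum>n<q. \<bar>f (int n - int m)\<bar>)"
    using q by (intro sum_mono sum_mono2) (auto intro: less_trans[OF _ mod_less_divisor])
  also have "\<dots> = (\<Sum>m<?R. \<Sum>d<q. \<bar>f (int d)\<bar>)"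
    using sum_periodic_shift[OF periodic_compose[OF f, of abs] q, where r = "- int _"] by simp
  also have "\<dots> \<le> real q * (\<Sum>d<q. \<bar>f (int d)\<bar>)"
    using q by (simp add: mult_right_mono sum_nonneg less_imp_le)
  finally show ?thesis .
qed

text \<open>
  For pairwise coprime periods both the sum and the absolute sum over the common period factorise; a
  single factor with zero mean makes the whole product have zero mean.
\<close>

lemma abs_sum_differences_prod_le:
  fixes f :: "'i \<Rightarrow> int \<Rightarrow> real"
  assumes I: "finite I" "\<And>i. i \<in> I \<Longrightarrow> periodic (q i) (f i)" "\<And>i. i \<in> I \<Longrightarrow> q i > 0"
    "\<And>i j. i \<in> I \<Longrightarrow> j \<in> I \<Longrightarrow> i \<noteq> j \<Longrightarrow> coprime (q i) (q j)"
    and k: "k \<in> I" "(\<Sum>d<q k. f k (int d)) = 0"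
    and L: "\<And>i. i \<in> I \<Longrightarrow> real (q i) * (\<Sum>d<q i. \<bar>f i (int d)\<bar>) \<le> L i"
  shows "\<bar>\<Sum>m<N. \<Sum>n<N. \<Prod>i\<in>I. f i (int n - int m)\<bar> \<le> (\<Prod>i\<in>I. L i)"
proof -
  let ?q = "\<Prod>i\<in>I. q i"
  have "(\<Sum>d<?q. \<Prod>i\<in>I. f i (int d)) = 0"
    using sum_prod_coprime_periods[OF I] k I(1) by auto
  then have "\<bar>\<Sum>m<N. \<Sum>n<N. \<Prod>i\<in>I. f i (int n - int m)\<bar>
      \<le> real ?q * (\<Sum>d<?q. \<bar>\<Prod>i\<in>I. f i (int d)\<bar>)"
    using I by (intro abs_sum_differences_le periodic_prod prod_pos) auto
  also have "\<dots> = real ?q * (\<Sum>d<?q. \<Prod>i\<in>I. \<bar>f i (int d)\<bar>)"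
    by (simp add: abs_prod)
  also have "\<dots> = (\<Prod>i\<in>I. real (q i) * (\<Sum>d<q i. \<bar>f i (int d)\<bar>))"
    using sum_prod_coprime_periods[of I q "\<lambda>i d. \<bar>f i d\<bar>"] I
    by (simp add: periodic_compose prod.distrib)
  also have "\<dots> \<le> (\<Prod>i\<in>I. L i)"
    using L by (intro prod_mono) (auto intro!: mult_nonneg_nonneg sum_nonneg)
  finally show ?thesis .
qed

section \<open>The digit reversal map\<close>

text \<open>
  The truncated radical inverse \<open>b\<^sub>0/p + \<dots> + b\<^bsub>G-1\<^esub>/p\<^sup>G\<close>. Integer arguments make it a periodic function to which differences \<open>n - m\<close>
  and translations apply without case distinctions.
\<close>

primrec digit_reversal :: "nat \<Rightarrow> nat \<Rightarrow> int \<Rightarrow> real" where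
  "digit_reversal p 0 b = 0"
| "digit_reversal p (Suc G) b =
    (of_int (b mod int p) + digit_reversal p G (b div int p)) / real p"

lemma digit_reversal_nonneg: "p > 0 \<Longrightarrow> 0 \<le> digit_reversal p G b"
  by (induction G arbitrary: b) simp_all

lemma digit_reversal_le:
  assumes p: "p > 0"
  shows "digit_reversal p G b \<le> 1 - 1 / real p ^ G"
proof (induction G arbitrary: b)
  case (Suc G)
  have "b mod int p \<le> int p - 1"
    using p pos_mod_bound[of "int p" b] by linarith
  then have "of_int (b mod int p) \<le> real p - 1"
    by (metis of_int_1 of_int_diff of_int_le_iff of_int_of_nat_eq)
  then have "digit_reversal p (Suc G) b \<le> ((real p - 1) + (1 - 1 / real p ^ G)) / real p"
    using Suc[of "b div int p"] p unfolding digit_reversal.simps by (intro divide_right_mono) auto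
  then show ?case using p by (simp add: field_simps)
qed simp

lemma digit_reversal_less_1: "p > 0 \<Longrightarrow> digit_reversal p G b < 1"
  using digit_reversal_le[of p G b] by (smt (verit) divide_pos_pos of_nat_0_less_iff zero_less_power)

lemma periodic_digit_reversal: "p > 0 \<Longrightarrow> periodic (p ^ G) (digit_reversal p G)"
proof (induction G)
  case (Suc G)
  have "(d + int (p ^ Suc G)) div int p = d div int p + int (p ^ G)" for d
    using Suc.prems by simp
  moreover have "(d + int (p ^ Suc G)) mod int p = d mod int p" for d
    by simp
  ultimately show ?case
    using Suc by (simp add: periodic_def del: power_Suc of_nat_power)
qed (simp add: periodic_def)

lemma digit_reversal_add:
  "p > 0 \<Longrightarrow> digit_reversal p (G + H) b =
    digit_reversal p G b + digit_reversal p H (b div int p ^ G) / real p ^ G"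
  by (induction G arbitrary: b)
    (simp_all add: zdiv_zmult2_eq[symmetric] field_simps)

text \<open>
  The recursion of \<^const>\<open>digit_reversal\<close> strips the least significant digit; this one adds a most
  significant digit.
\<close>

lemma digit_reversal_Suc_high:
  "p > 0 \<Longrightarrow> digit_reversal p (Suc G) b =
    digit_reversal p G b + of_int (b div int p ^ G mod int p) / real p ^ Suc G"
  using digit_reversal_add[of p G 1 b] by (simp add: field_simps)

lemma digit_reversal_split_int:
  "t < p \<Longrightarrow> digit_reversal p (Suc G) (int t + int p * k) =
    (real t + digit_reversal p G k) / real p"
  by simp

lemma digit_reversal_split:
  "t < p \<Longrightarrow> digit_reversal p (Suc G) (int (t + p * k)) =
    (real t + digit_reversal p G (int k)) / real p"
  using digit_reversal_split_int[of t p G "int k"] by simp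

lemma sum_lessThan_Suc_power:
  fixes f :: "nat \<Rightarrow> 'a::comm_monoid_add"
  shows "(\<Sum>b<p ^ Suc G. f b) = (\<Sum>t<p. \<Sum>k<p ^ G. f (t + p * k))"
  by (simp only: power_Suc sum_lessThan_mult_split sum.swap[of _ "{..<p}"])

lemma sum_lessThan_id: "(\<Sum>t<n. real t) = real n * (real n - 1) / 2"
  by (induction n) (simp_all add: field_simps)

lemma sum_lessThan_squares: "(\<Sum>t<n. (real t)\<^sup>2) = real n * (real n - 1) * (2 * real n - 1) / 6"
  by (induction n) (simp_all add: field_simps power2_eq_square)

text \<open>
  The values are the fractions \<open>i/p\<^sup>G\<close> in permuted order, but the recursion on digits gives the moments
  without exhibiting the permutation.
\<close>

lemma sum_digit_reversal:
  assumes p: "p > 0"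
  shows "(\<Sum>b<p ^ G. digit_reversal p G (int b)) = (real p ^ G - 1) / 2"
proof (induction G)
  case (Suc G)
  have "(\<Sum>b<p ^ Suc G. digit_reversal p (Suc G) (int b))
      = (\<Sum>t<p. \<Sum>k<p ^ G. (real t + digit_reversal p G (int k)) / real p)"
    unfolding sum_lessThan_Suc_power by (intro sum.cong refl) (simp only: digit_reversal_split lessThan_iff)
  also have "\<dots> = (\<Sum>t<p. (real p ^ G * real t + (real p ^ G - 1) / 2) / real p)"
    using Suc by (simp add: sum.distrib sum_divide_distrib[symmetric])
  also have "\<dots> = (real p ^ G * (real p * (real p - 1) / 2) + real p * ((real p ^ G - 1) / 2)) / real p"
    by (simp add: sum.distrib sum_divide_distrib[symmetric] sum_distrib_left[symmetric] sum_lessThan_id)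
  also have "\<dots> = (real p ^ Suc G - 1) / 2"
    using p by (simp add: field_simps)
  finally show ?case .
qed simp

lemma sum_digit_reversal_squares:
  assumes p: "p > 0"
  shows "(\<Sum>b<p ^ G. (digit_reversal p G (int b))\<^sup>2)
    = (real p ^ G - 1) * (2 * real p ^ G - 1) / (6 * real p ^ G)"
proof (induction G)
  case (Suc G)
  define P where "P = real p ^ G"
  have P: "P > 0" using p by (simp add: P_def)
  have "(\<Sum>b<p ^ Suc G. (digit_reversal p (Suc G) (int b))\<^sup>2)
      = (\<Sum>t<p. \<Sum>k<p ^ G. ((real t + digit_reversal p G (int k)) / real p)\<^sup>2)"
    unfolding sum_lessThan_Suc_power by (intro sum.cong refl) (simp only: digit_reversal_split lessThan_iff)
  also have "\<dots> = (\<Sum>t<p. (P * (real t)\<^sup>2 + 2 * real t * ((P - 1) / 2)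
      + (P - 1) * (2 * P - 1) / (6 * P)) / (real p)\<^sup>2)"
  proof (rule sum.cong[OF refl])
    fix t
    have "(\<Sum>k<p ^ G. ((real t + digit_reversal p G (int k)) / real p)\<^sup>2)
      = (\<Sum>k<p ^ G. (real t)\<^sup>2 + 2 * real t * digit_reversal p G (int k)
          + (digit_reversal p G (int k))\<^sup>2) / (real p)\<^sup>2"
      by (simp add: power_divide power2_sum sum_divide_distrib algebra_simps)
    then show "(\<Sum>k<p ^ G. ((real t + digit_reversal p G (int k)) / real p)\<^sup>2)
      = (P * (real t)\<^sup>2 + 2 * real t * ((P - 1) / 2) + (P - 1) * (2 * P - 1) / (6 * P)) / (real p)\<^sup>2"
      using Suc sum_digit_reversal[OF p, of G]
      by (simp add: sum.distrib sum_distrib_left[symmetric] P_def)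
  qed
  also have "\<dots> = (P * (\<Sum>t<p. (real t)\<^sup>2) + (P - 1) * (\<Sum>t<p. real t)
      + real p * ((P - 1) * (2 * P - 1) / (6 * P))) / (real p)\<^sup>2"
    by (simp add: sum.distrib sum_divide_distrib[symmetric] sum_distrib_left sum_distrib_right algebra_simps)
  also have "\<dots> = (P * (real p * (real p - 1) * (2 * real p - 1) / 6) + (P - 1) * (real p * (real p - 1) / 2)
      + real p * ((P - 1) * (2 * P - 1) / (6 * P))) / (real p)\<^sup>2"
    by (simp only: sum_lessThan_id sum_lessThan_squares)
  also have "\<dots> = (real p * P - 1) * (2 * (real p * P) - 1) / (6 * (real p * P))"
    using p P by (simp add: divide_simps power2_eq_square) algebra
  finally show ?case by (simp add: P_def)
qed simp

section \<open>Mean distance of digit reversals\<close>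

text \<open>
  For \<open>d = p\<^sup>v u\<close> with \<open>v < G\<close> and \<open>t = u mod p \<noteq> 0\<close> the value is \<open>t (p - t)/p\<^bsup>v+2\<^esup>\<close>, and it is \<open>0\<close> if \<open>p\<^sup>G\<close> divides \<open>d\<close>. It is half
  the mean distance of the digit reversals of \<open>b\<close> and \<open>b + d\<close>.
\<close>

primrec mean_gap :: "nat \<Rightarrow> nat \<Rightarrow> int \<Rightarrow> real" where
  "mean_gap p 0 d = 0"
| "mean_gap p (Suc G) d =
    (if int p dvd d then mean_gap p G (d div int p) / real p
     else of_int (d mod int p) * (real p - of_int (d mod int p)) / (real p)\<^sup>2)"

lemma digit_product_bounds:
  assumes "p > 0"
  shows "0 \<le> of_int (d mod int p) * (real p - of_int (d mod int p)) / (real p)\<^sup>2"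
    "of_int (d mod int p) * (real p - of_int (d mod int p)) / (real p)\<^sup>2 \<le> 1 / 4"
proof -
  have "0 \<le> d mod int p" "d mod int p \<le> int p"
    using assms pos_mod_bound[of "int p" d] by (simp_all add: less_imp_le)
  then have "0 \<le> real_of_int (d mod int p)" "real_of_int (d mod int p) \<le> real p"
    by linarith+
  then show "0 \<le> of_int (d mod int p) * (real p - of_int (d mod int p)) / (real p)\<^sup>2"
    by simp
  have "0 \<le> (2 * real_of_int (d mod int p) - real p)\<^sup>2" by simp
  then show "of_int (d mod int p) * (real p - of_int (d mod int p)) / (real p)\<^sup>2 \<le> 1 / 4"
    using assms by (simp add: field_simps power2_eq_square)
qed

lemma mean_gap_nonneg: "p > 0 \<Longrightarrow> 0 \<le> mean_gap p G d"
  by (induction G arbitrary: d) (simp_all add: digit_product_bounds)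

text \<open>
  The function \<open>t (p - t)/p\<^sup>2\<close> is at most \<open>1/4\<close>, and deeper levels only divide by further powers of \<open>p\<close>.
\<close>

lemma mean_gap_le: "p > 0 \<Longrightarrow> mean_gap p G d \<le> 1 / 4"
proof (induction G arbitrary: d)
  case (Suc G)
  have "mean_gap p G e / real p \<le> mean_gap p G e" for e
    using Suc.prems mean_gap_nonneg[OF Suc.prems, of G e]
    by (simp add: divide_le_eq mult_left_mono[of 1 "real p" "mean_gap p G e", simplified])
  then have "mean_gap p G (d div int p) / real p \<le> 1 / 4"
    using Suc by (meson order_trans)
  then show ?case
    using digit_product_bounds(2)[OF Suc.prems, of d] by (simp only: mean_gap.simps split: if_split) blast
qed simp

text \<open>
  Raising the level changes the value only where \<open>p\<^sup>G\<close> divides \<open>d\<close>, and there it was \<open>0\<close>.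
\<close>

lemma mean_gap_mono: "p > 0 \<Longrightarrow> mean_gap p G d \<le> mean_gap p (G + H) d"
  by (induction G arbitrary: d) (simp_all add: mean_gap_nonneg divide_right_mono)

text \<open>
  If \<open>p\<close> divides \<open>d\<close>, the lowest digits of \<open>b\<close> and \<open>b + d\<close> agree and the distance is \<open>1/p\<close> times the distance
  for the remaining digits. Otherwise the lowest digits differ, and they alone decide the sign of the
  difference: it is positive if there is no carry and negative if there is one. With the sign
  known the absolute value disappears, and the contribution of the higher digits cancels on average
  because a translation permutes the residues.
\<close>

lemma sum_abs_digit_reversal_diff:
  assumes p: "p > 0"
  shows "(\<Sum>b<p ^ G. \<bar>digit_reversal p G (int b + d) - digit_reversal p G (int b)\<bar>)
    = 2 * real p ^ G * mean_gap p G d"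
proof (induction G arbitrary: d)
  case (Suc G)
  define s where "s = nat (d mod int p)"
  define e where "e = d div int p"
  have s: "s < p" "int s = d mod int p"
    using p by (simp_all add: s_def nat_less_iff)
  have d: "d = int s + int p * e"
    using s by (simp add: e_def)
  have low: "digit_reversal p (Suc G) (int (t + p * k) + d)
      = (real (t + s) + digit_reversal p G (int k + e)) / real p" if "t + s < p" for t k
  proof -
    have "int (t + p * k) + d = int (t + s) + int p * (int k + e)"
      by (simp add: d algebra_simps)
    then show ?thesis using digit_reversal_split_int[OF that, of G "int k + e"] by (simp only:)
  qed
  have high: "digit_reversal p (Suc G) (int (t + p * k) + d)
      = (real t + real s - real p + digit_reversal p G (int k + (e + 1))) / real p"
    if "t < p" "t + s \<ge> p" for t k
  proof -
    have "int (t + p * k) + d = int (t + s - p) + int p * (int k + (e + 1))"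
      using that by (simp add: d algebra_simps of_nat_diff)
    moreover have "t + s - p < p" using that s by simp
    ultimately show ?thesis
      using digit_reversal_split_int[of "t + s - p" p G "int k + (e + 1)"] that
      by (simp only: of_nat_diff of_nat_add)
  qed
  have shift: "(\<Sum>k<p ^ G. digit_reversal p G (int k + c)) = (\<Sum>k<p ^ G. digit_reversal p G (int k))" for c
    using sum_periodic_shift[OF periodic_digit_reversal[OF p, of G]] p by simp
  have split: "(\<Sum>b<p ^ Suc G. \<bar>digit_reversal p (Suc G) (int b + d) - digit_reversal p (Suc G) (int b)\<bar>)
      = (\<Sum>t<p. \<Sum>k<p ^ G. \<bar>digit_reversal p (Suc G) (int (t + p * k) + d)
           - (real t + digit_reversal p G (int k)) / real p\<bar>)"
    unfolding sum_lessThan_Suc_power by (intro sum.cong refl) (simp only: digit_reversal_split lessThan_iff)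
  show ?case
  proof (cases "int p dvd d")
    case True
    then have s0: "s = 0" using s by simp
    have "(\<Sum>k<p ^ G. \<bar>digit_reversal p (Suc G) (int (t + p * k) + d)
           - (real t + digit_reversal p G (int k)) / real p\<bar>)
        = 2 * real p ^ G * mean_gap p G e / real p" if "t < p" for t
    proof -
      have "(\<Sum>k<p ^ G. \<bar>digit_reversal p (Suc G) (int (t + p * k) + d)
           - (real t + digit_reversal p G (int k)) / real p\<bar>)
         = (\<Sum>k<p ^ G. \<bar>digit_reversal p G (int k + e) - digit_reversal p G (int k)\<bar> / real p)"
        using that s0 low[of t]
        by (intro sum.cong refl) (simp del: digit_reversal.simps of_nat_add of_nat_mult
            add: diff_divide_distrib[symmetric] abs_divide)
      then show ?thesis using Suc[of e] by (simp add: sum_divide_distrib[symmetric])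
    qed
    then show ?thesis
      using True p unfolding split by (simp add: e_def)
  next
    case False
    then have s1: "s \<ge> 1" using s by (cases s) auto
    \<comment> \<open>no carry: \<open>b + d\<close> has the larger lowest digit\<close>
    have up: "(\<Sum>k<p ^ G. \<bar>digit_reversal p (Suc G) (int (t + p * k) + d)
           - (real t + digit_reversal p G (int k)) / real p\<bar>)
        = real p ^ G * real s / real p" if t: "t < p - s" for t
    proof -
      have "\<bar>digit_reversal p (Suc G) (int (t + p * k) + d)
           - (real t + digit_reversal p G (int k)) / real p\<bar>
         = (real s + digit_reversal p G (int k + e) - digit_reversal p G (int k)) / real p" for k
      proof -
        have "0 \<le> (real s + digit_reversal p G (int k + e) - digit_reversal p G (int k)) / real p"
          using s1 digit_reversal_nonneg[OF p, of G "int k + e"] digit_reversal_less_1[OF p, of G "int k"]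
          by (intro divide_nonneg_nonneg) linarith+
        moreover have "digit_reversal p (Suc G) (int (t + p * k) + d)
             - (real t + digit_reversal p G (int k)) / real p
           = (real s + digit_reversal p G (int k + e) - digit_reversal p G (int k)) / real p"
          using low[of t k] t by (simp del: digit_reversal.simps add: diff_divide_distrib add_divide_distrib)
        ultimately show ?thesis by (simp only: abs_of_nonneg)
      qed
      then show ?thesis
        by (simp add: sum_divide_distrib[symmetric] sum.distrib sum_subtractf shift del: digit_reversal.simps)
    qed
    \<comment> \<open>carry: the lowest digit drops by \<open>p - s\<close>\<close>
    have down: "(\<Sum>k<p ^ G. \<bar>digit_reversal p (Suc G) (int (t + p * k) + d)
           - (real t + digit_reversal p G (int k)) / real p\<bar>)
        = real p ^ G * (real p - real s) / real p" if t: "t < p" "p - s \<le> t" for t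
    proof -
      have "\<bar>digit_reversal p (Suc G) (int (t + p * k) + d)
           - (real t + digit_reversal p G (int k)) / real p\<bar>
         = (real p - real s + digit_reversal p G (int k) - digit_reversal p G (int k + (e + 1))) / real p" for k
      proof -
        have "real p - real s \<ge> 1" using s(1) by linarith
        then have "0 \<le> (real p - real s + digit_reversal p G (int k) - digit_reversal p G (int k + (e + 1))) / real p"
          using digit_reversal_nonneg[OF p, of G "int k"] digit_reversal_less_1[OF p, of G "int k + (e + 1)"]
          by (intro divide_nonneg_nonneg) linarith+
        moreover have "digit_reversal p (Suc G) (int (t + p * k) + d)
             - (real t + digit_reversal p G (int k)) / real p
           = - ((real p - real s + digit_reversal p G (int k) - digit_reversal p G (int k + (e + 1))) / real p)"
          using high[of t k] t by (simp del: digit_reversal.simps add: diff_divide_distrib add_divide_distrib)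
        ultimately show ?thesis by (simp only: abs_minus_cancel abs_of_nonneg)
      qed
      then show ?thesis
        by (simp add: sum_divide_distrib[symmetric] sum.distrib sum_subtractf shift del: digit_reversal.simps)
    qed
    have "(\<Sum>b<p ^ Suc G. \<bar>digit_reversal p (Suc G) (int b + d) - digit_reversal p (Suc G) (int b)\<bar>)
        = (\<Sum>t<(p - s) + s. if t < p - s then real p ^ G * real s / real p
             else real p ^ G * (real p - real s) / real p)"
      unfolding split using s(1) up down by (intro sum.cong) (auto simp del: digit_reversal.simps)
    also have "\<dots> = 2 * real p ^ Suc G * mean_gap p (Suc G) d"
    proof -
      have "(\<Sum>t<s. if p - s + t < p - s then real p ^ G * real s / real p
             else real p ^ G * (real p - real s) / real p) = (\<Sum>t<s. real p ^ G * (real p - real s) / real p)"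
        by (intro sum.cong) auto
      then show ?thesis
        unfolding sum_lessThan_add by (simp only:) (use False s p
        in \<open>simp add: s(2)[symmetric] of_nat_diff field_simps power2_eq_square\<close>)
    qed
    finally show ?thesis .
  qed
qed simp

text \<open>
  By \<open>min (1 - x) (1 - y) = 1 - (x + y + \<bar>x - y\<bar>)/2\<close>, the mean of the kernel is determined by the mean
  of the points and their mean distance.
\<close>

lemma mean_min_digit_reversal:
  assumes p: "p > 0"
  shows "(\<Sum>b<p ^ G. min (1 - digit_reversal p G (int b + n)) (1 - digit_reversal p G (int b + m)))
    / real p ^ G = 1 / 2 + 1 / (2 * real p ^ G) - mean_gap p G (n - m)"
proof -
  let ?r = "digit_reversal p G"
  note per = periodic_digit_reversal[OF p, of G]
  have P: "p ^ G > 0" using p by simp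
  have "(\<Sum>b<p ^ G. min (1 - ?r (int b + n)) (1 - ?r (int b + m)))
      = (\<Sum>b<p ^ G. 1 - (?r (int b + n) + ?r (int b + m) + \<bar>?r (int b + n) - ?r (int b + m)\<bar>) / 2)"
    by (intro sum.cong refl) (simp add: min_def abs_if field_simps)
  also have "\<dots> = real p ^ G - ((\<Sum>b<p ^ G. ?r (int b + n)) + (\<Sum>b<p ^ G. ?r (int b + m))
      + (\<Sum>b<p ^ G. \<bar>?r (int b + n) - ?r (int b + m)\<bar>)) / 2"
    by (simp add: sum_subtractf sum.distrib sum_divide_distrib[symmetric])
  also have "(\<Sum>b<p ^ G. \<bar>?r (int b + n) - ?r (int b + m)\<bar>)
      = (\<Sum>b<p ^ G. \<bar>?r (int b + (n - m)) - ?r (int b)\<bar>)"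
  proof -
    have "periodic (p ^ G) (\<lambda>b. \<bar>?r (b + (n - m)) - ?r b\<bar>)"
      using per periodic_shift[OF per, of "n - m"] by (simp add: periodic_def del: of_nat_power)
    from sum_periodic_shift[OF this P, of m] show ?thesis by (simp add: algebra_simps)
  qed
  also have "\<dots> = 2 * real p ^ G * mean_gap p G (n - m)"
    by (rule sum_abs_digit_reversal_diff[OF p])
  finally have "(\<Sum>b<p ^ G. min (1 - ?r (int b + n)) (1 - ?r (int b + m)))
      = real p ^ G - ((real p ^ G - 1) / 2 + (real p ^ G - 1) / 2 + 2 * real p ^ G * mean_gap p G (n - m)) / 2"
    by (simp only: sum_periodic_shift[OF per P] sum_digit_reversal[OF p])
  then show ?thesis
    using p by (simp add: field_simps)
qed

section \<open>Martingale differences of the mean distance\<close>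

text \<open>
  The martingale differences of the negative gap: the conditional mean given \<open>d mod p\<^bsup>a+1\<^esup>\<close> minus the one given \<open>d mod p\<^sup>a\<close>, for \<open>d\<close> uniform in
  the \<open>p\<close>-adic integers.
\<close>

primrec gap_fluctuation :: "nat \<Rightarrow> nat \<Rightarrow> int \<Rightarrow> real" where
  "gap_fluctuation p 0 d =
    1 / 6 - of_int (d mod int p) * (real p - of_int (d mod int p)) / (real p)\<^sup>2
    - (if int p dvd d then 1 / (6 * real p) else 0)"
| "gap_fluctuation p (Suc a) d = (if int p dvd d then gap_fluctuation p a (d div int p) / real p else 0)"

lemma periodic_gap_fluctuation: "p > 0 \<Longrightarrow> periodic (p ^ Suc a) (gap_fluctuation p a)"
proof (induction a)
  case 0
  then show ?case by (simp add: periodic_def)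
next
  case (Suc a)
  have "(d + int (p ^ Suc (Suc a))) div int p = d div int p + int (p ^ Suc a)" for d
    using Suc.prems by simp
  moreover have "int p dvd d + int (p ^ Suc (Suc a)) \<longleftrightarrow> int p dvd d" for d
    by (simp add: dvd_add_left_iff)
  ultimately show ?case
    using Suc by (simp add: periodic_def del: power_Suc of_nat_power)
qed

text \<open>
  Restricting to multiples of \<open>p\<close> turns a sum over one more level into a sum over one level fewer.
\<close>

lemma sum_Suc_power_supported:
  fixes f :: "int \<Rightarrow> real"
  assumes "p > 0" "\<And>d. \<not> int p dvd d \<Longrightarrow> f d = 0"
  shows "(\<Sum>d<p ^ Suc G. f (int d)) = (\<Sum>k<p ^ G. f (int p * int k))"
proof -
  have "(\<Sum>k<p ^ G. f (int (t + p * k))) = 0" if "t \<in> {..<p} - {0}" for t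
  proof (rule sum.neutral, rule ballI)
    fix k
    have "(int (t + p * k)) mod int p \<noteq> 0"
      using that by simp
    then show "f (int (t + p * k)) = 0" using assms(2) by (simp add: dvd_eq_mod_eq_0 del: of_nat_add)
  qed
  then have "(\<Sum>t<p. \<Sum>k<p ^ G. f (int (t + p * k))) = (\<Sum>t\<in>{0}. \<Sum>k<p ^ G. f (int (t + p * k)))"
    using assms(1) by (intro sum.mono_neutral_right) auto
  then show ?thesis unfolding sum_lessThan_Suc_power by simp
qed

text \<open>
  At level \<open>0\<close> this is \<open>\<Sum>\<^sub>t t (p - t)/p\<^sup>2 = (p\<^sup>2 - 1)/(6 p)\<close>; the constants \<open>1/6\<close> and \<open>1/(6 p)\<close> in the definition are
  the means of the gap over the \<open>p\<close>-adic integers and over the multiples of \<open>p\<close>.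
\<close>

lemma sum_gap_fluctuation:
  assumes p: "p > 0"
  shows "(\<Sum>d<p ^ Suc a. gap_fluctuation p a (int d)) = 0"
proof (induction a)
  case 0
  have "(\<Sum>d<p. gap_fluctuation p 0 (int d))
      = (\<Sum>d<p. 1 / 6 - (real p * real d - (real d)\<^sup>2) / (real p)\<^sup>2 - (if d = 0 then 1 / (6 * real p) else 0))"
  proof (rule sum.cong[OF refl])
    fix d assume "d \<in> {..<p}"
    then have "int d mod int p = int d" "int p dvd int d \<longleftrightarrow> d = 0"
      by (auto dest: nat_dvd_not_less)
    then show "gap_fluctuation p 0 (int d)
      = 1 / 6 - (real p * real d - (real d)\<^sup>2) / (real p)\<^sup>2 - (if d = 0 then 1 / (6 * real p) else 0)"
      by (simp add: algebra_simps power2_eq_square)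
  qed
  also have "\<dots> = real p / 6 - (real p * (\<Sum>d<p. real d) - (\<Sum>d<p. (real d)\<^sup>2)) / (real p)\<^sup>2 - 1 / (6 * real p)"
    using p by (simp add: sum_subtractf sum_divide_distrib[symmetric] sum_distrib_left)
  also have "\<dots> = 0"
    using p unfolding sum_lessThan_id sum_lessThan_squares by (simp add: field_simps power2_eq_square)
  finally show ?case by simp
next
  case (Suc a)
  have "(\<Sum>d<p ^ Suc (Suc a). gap_fluctuation p (Suc a) (int d))
      = (\<Sum>k<p ^ Suc a. gap_fluctuation p a (int k) / real p)"
    using p by (subst sum_Suc_power_supported) simp_all
  then show ?case using Suc by (simp add: sum_divide_distrib[symmetric])
qed

text \<open>
  The period grows like \<open>p\<^sup>a\<close> while the absolute sum decays like \<open>p\<^sup>-\<^sup>a\<close>: raising the level multiplies the former by \<open>p\<close>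
  and divides the latter by \<open>p\<close>. So every level has the same weight, which is why the final
  bound counts levels.
\<close>

lemma sum_abs_gap_fluctuation:
  assumes p: "p > 0"
  shows "real (p ^ Suc a) * (\<Sum>d<p ^ Suc a. \<bar>gap_fluctuation p a (int d)\<bar>) \<le> (real p)\<^sup>2 / 6"
proof (induction a)
  case 0
  have "\<bar>gap_fluctuation p 0 d\<bar> \<le> 1 / 6" for d
  proof (cases "int p dvd d")
    case True
    have "0 \<le> 1 / (6 * real p)" "1 / (6 * real p) \<le> 1 / 6" using p by (simp_all add: field_simps)
    then show ?thesis using True by simp
  next
    case False
    have "\<bar>1 / 6 - h - 0\<bar> \<le> 1 / 6" if "0 \<le> h" "h \<le> 1 / 4" for h :: real
      using that by linarith
    then show ?thesis
      using False digit_product_bounds[OF p, of d] by (simp only: gap_fluctuation.simps if_False)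
  qed
  then have "(\<Sum>d<p. \<bar>gap_fluctuation p 0 (int d)\<bar>) \<le> (\<Sum>d<p. 1 / 6)"
    by (intro sum_mono)
  then show ?case using p by (simp add: power2_eq_square)
next
  case (Suc a)
  have "(\<Sum>d<p ^ Suc (Suc a). \<bar>gap_fluctuation p (Suc a) (int d)\<bar>)
      = (\<Sum>k<p ^ Suc a. \<bar>gap_fluctuation p a (int k)\<bar> / real p)"
    using p by (subst sum_Suc_power_supported) simp_all
  then have "real (p ^ Suc (Suc a)) * (\<Sum>d<p ^ Suc (Suc a). \<bar>gap_fluctuation p (Suc a) (int d)\<bar>)
      = real (p ^ Suc a) * (\<Sum>k<p ^ Suc a. \<bar>gap_fluctuation p a (int k)\<bar>)"
    using p by (simp only: sum_divide_distrib[symmetric]) simp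
  then show ?case using Suc by (simp only:)
qed

text \<open>
  Up to the constant \<open>1/6\<close>, the fluctuations telescope to the conditional mean of the negative gap given \<open>d mod p\<^sup>G\<close>. This mean is exact unless
  \<open>p\<^sup>G\<close> divides \<open>d\<close>, where the undetermined rest of the gap has mean \<open>1/(6 p\<^sup>G)\<close>.
\<close>

lemma mean_gap_fluctuation_bounds:
  assumes p: "p > 0"
  shows "0 \<le> 1 / 6 - mean_gap p G d - (\<Sum>a<G. gap_fluctuation p a d)
    \<and> 1 / 6 - mean_gap p G d - (\<Sum>a<G. gap_fluctuation p a d) \<le> 1 / (6 * real p ^ G)"
proof (induction G arbitrary: d)
  case (Suc G)
  have split: "(\<Sum>a<Suc G. gap_fluctuation p a d) = gap_fluctuation p 0 d + (\<Sum>a<G. gap_fluctuation p (Suc a) d)"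
    by (rule sum.lessThan_Suc_shift)
  show ?case
  proof (cases "int p dvd d")
    case True
    define y where "y = 1 / 6 - mean_gap p G (d div int p) - (\<Sum>a<G. gap_fluctuation p a (d div int p))"
    have y: "1 / 6 - mean_gap p (Suc G) d - (\<Sum>a<Suc G. gap_fluctuation p a d) = y / real p"
      unfolding split y_def using True p by (simp add: sum_divide_distrib[symmetric] field_simps)
    have "0 \<le> y" "y \<le> 1 / (6 * real p ^ G)"
      using Suc[of "d div int p"] by (simp_all add: y_def)
    then have "0 \<le> y / real p" "y / real p \<le> 1 / (6 * real p ^ G) / real p"
      by (simp, intro divide_right_mono) simp_all
    then show ?thesis unfolding y by (simp add: mult.commute)
  next
    case False
    then show ?thesis unfolding split by simp
  qed
qed simp

section \<open>Digits of the shifted points\<close>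

lemma digit_reversal_Ints: "p > 0 \<Longrightarrow> real p ^ G * digit_reversal p G b \<in> \<int>"
proof (induction G arbitrary: b)
  case (Suc G)
  have "real p ^ Suc G * digit_reversal p (Suc G) b
      = of_int (int (p ^ G) * (b mod int p)) + real p ^ G * digit_reversal p G (b div int p)"
    using Suc.prems by (simp add: field_simps)
  also have "\<dots> \<in> \<int>"
    using Suc by (intro Ints_add Ints_of_int) auto
  finally show ?case .
qed simp

lemma digit_reversal_inject:
  assumes p: "p > 0" and eq: "digit_reversal p G b = digit_reversal p G c"
  shows "b mod int p ^ G = c mod int p ^ G"
  using eq
proof (induction G arbitrary: b c)
  case (Suc G)
  have fl: "\<lfloor>of_int (x mod int p) + digit_reversal p G (x div int p)\<rfloor> = x mod int p" for x
    using digit_reversal_nonneg[OF p] digit_reversal_less_1[OF p] by (intro floor_unique) auto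
  have eq: "of_int (b mod int p) + digit_reversal p G (b div int p)
      = of_int (c mod int p) + digit_reversal p G (c div int p)"
    using Suc.prems p by simp
  then have m: "b mod int p = c mod int p"
    using fl by metis
  with eq have "b div int p mod int p ^ G = c div int p mod int p ^ G"
    by (intro Suc.IH) simp
  with m show ?case
    by (simp add: zmod_zmult2_eq)
qed simp

lemma sum_digits_less:
  assumes "\<And>r. c r < p"
  shows "(\<Sum>r<G. c r * p ^ r) < (p::nat) ^ G"
proof (induction G)
  case (Suc G)
  have "c G + 1 \<le> p" using assms[of G] by simp
  then have "(c G + 1) * p ^ G \<le> p * p ^ G" by (rule mult_le_mono1)
  then show ?case using Suc by simp
qed simp

lemma digit_reversal_sum_digits:
  assumes "\<And>r. c r < p"
  shows "digit_reversal p G (int (\<Sum>r<G. c r * p ^ r)) = (\<Sum>r<G. real (c r) / real p ^ (r + 1))"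
proof (induction G)
  case (Suc G)
  have p: "p > 0" using assms[of 0] by simp
  let ?B = "\<Sum>r<G. c r * p ^ r"
  have B: "?B < p ^ G" by (rule sum_digits_less[OF assms])
  have "int (?B + c G * p ^ G) div int p ^ G = int ((?B + c G * p ^ G) div p ^ G)"
    by (simp only: zdiv_int of_nat_power)
  then have "int (?B + c G * p ^ G) div int p ^ G mod int p = int (c G)"
    using B p assms[of G] by (simp only:) simp
  moreover have "digit_reversal p G (int (?B + c G * p ^ G)) = digit_reversal p G (int ?B)"
    using periodic_add_mult[OF periodic_digit_reversal[OF p], of G "int ?B" "int (c G)"]
    by (simp add: mult.commute)
  ultimately show ?case
    using Suc digit_reversal_Suc_high[OF p, of G "int (?B + c G * p ^ G)"]
    by (simp only: sum.lessThan_Suc) simp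
qed simp

text \<open>
  The residue modulo \<open>p\<^sup>G\<close> of the \<open>p\<close>-adic integer attached to \<open>x\<close>.
\<close>

definition leading_digits :: "nat \<Rightarrow> nat \<Rightarrow> real \<Rightarrow> nat" where
  "leading_digits p G x = (\<Sum>r<G. padic_phi_plus p x r * p ^ r)"

lemma padic_phi_plus_less: "p > 0 \<Longrightarrow> padic_phi_plus p x r < p"
  by (simp add: padic_phi_plus_def)

lemma leading_digits_less: "p > 0 \<Longrightarrow> leading_digits p G x < p ^ G"
  unfolding leading_digits_def by (intro sum_digits_less padic_phi_plus_less)

text \<open>
  The integer \<^const>\<open>leading_digits\<close> lists the digits in reverse, so reversing it truncates \<open>x\<close>. The digits
  satisfy \<open>\<lfloor>x p\<^bsup>G+1\<^esup>\<rfloor> = p \<lfloor>x p\<^sup>G\<rfloor> + x\<^sub>G\<close>.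
\<close>

lemma digit_reversal_leading_digits:
  assumes p: "p > 0" and x: "0 \<le> x" "x < 1"
  shows "digit_reversal p G (int (leading_digits p G x)) = \<lfloor>x * real p ^ G\<rfloor> / real p ^ G"
proof -
  have "digit_reversal p G (int (leading_digits p G x)) = (\<Sum>r<G. real (padic_phi_plus p x r) / real p ^ (r + 1))"
    unfolding leading_digits_def using p by (intro digit_reversal_sum_digits padic_phi_plus_less)
  also have "\<dots> = \<lfloor>x * real p ^ G\<rfloor> / real p ^ G"
  proof (induction G)
    case 0
    have "\<lfloor>x\<rfloor> = 0" using x by (intro floor_unique) auto
    then show ?case by simp
  next
    case (Suc G)
    let ?k = "\<lfloor>x * real p ^ Suc G\<rfloor>"
    have "?k div int p = \<lfloor>x * real p ^ G\<rfloor>"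
      using p floor_divide_real_eq_div[of "int p" "x * real p ^ Suc G"] by simp
    then have "?k = int p * \<lfloor>x * real p ^ G\<rfloor> + ?k mod int p"
      by (metis mult_div_mod_eq)
    moreover have "int (padic_phi_plus p x G) = ?k mod int p"
      using x by (simp add: padic_phi_plus_def zmod_int)
    ultimately have "?k = int p * \<lfloor>x * real p ^ G\<rfloor> + int (padic_phi_plus p x G)"
      by simp
    then have "real_of_int ?k = real p * \<lfloor>x * real p ^ G\<rfloor> + real (padic_phi_plus p x G)"
      by (metis of_int_add of_int_mult of_int_of_nat_eq)
    then show ?case
      using Suc p by (simp only: sum.lessThan_Suc) (simp add: field_simps)
  qed
  finally show ?thesis .
qed

lemma digit_reversal_leading_digits_bounds:
  assumes p: "p > 0" and x: "0 \<le> x" "x < 1"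
  shows "digit_reversal p G (int (leading_digits p G x)) \<le> x"
    "x < digit_reversal p G (int (leading_digits p G x)) + 1 / real p ^ G"
proof -
  have floor: "\<lfloor>x * P\<rfloor> / P \<le> x \<and> x < \<lfloor>x * P\<rfloor> / P + 1 / P" if "P > 0" for P :: real
  proof -
    have "\<lfloor>x * P\<rfloor> \<le> x * P" "x * P < \<lfloor>x * P\<rfloor> + 1"
      by linarith+
    then show ?thesis using that by (simp add: field_simps)
  qed
  show "digit_reversal p G (int (leading_digits p G x)) \<le> x"
    "x < digit_reversal p G (int (leading_digits p G x)) + 1 / real p ^ G"
    using floor[of "real p ^ G"] p unfolding digit_reversal_leading_digits[OF assms] by simp_all
qed

text \<open>
  Reals with the same first \<open>G\<close> digits form a half-open interval of length \<open>p\<^sup>-\<^sup>G\<close>; hence \<^const>\<open>leading_digits\<close> is uniformly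
  distributed for uniform \<open>x\<close>.
\<close>

lemma leading_digits_eq_iff:
  assumes p: "p > 0" and b: "b < p ^ G"
  shows "0 \<le> x \<and> x < 1 \<and> leading_digits p G x = b \<longleftrightarrow>
    x \<in> {digit_reversal p G (int b) ..< digit_reversal p G (int b) + 1 / real p ^ G}"
proof
  assume "0 \<le> x \<and> x < 1 \<and> leading_digits p G x = b"
  then show "x \<in> {digit_reversal p G (int b) ..< digit_reversal p G (int b) + 1 / real p ^ G}"
    using digit_reversal_leading_digits_bounds[OF p, of x G] by auto
next
  assume x: "x \<in> {digit_reversal p G (int b) ..< digit_reversal p G (int b) + 1 / real p ^ G}"
  have P: "real p ^ G > 0" using p by simp
  have x01: "0 \<le> x" "x < 1"
    using x digit_reversal_nonneg[OF p, of G "int b"] digit_reversal_le[OF p, of G "int b"] by auto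
  obtain k where k: "real p ^ G * digit_reversal p G (int b) = of_int k"
    using digit_reversal_Ints[OF p] Ints_cases by metis
  then have rev_b: "digit_reversal p G (int b) = k / real p ^ G"
    using P by (simp add: field_simps)
  have "\<lfloor>x * P\<rfloor> = k" if "k / P \<le> x" "x < k / P + 1 / P" "P > 0" for P
    using that by (intro floor_unique) (simp_all add: field_simps)
  then have "\<lfloor>x * real p ^ G\<rfloor> = k"
    using x P unfolding rev_b by simp
  then have "digit_reversal p G (int (leading_digits p G x)) = digit_reversal p G (int b)"
    unfolding digit_reversal_leading_digits[OF p x01] rev_b by simp
  then have "int (leading_digits p G x) mod int p ^ G = int b mod int p ^ G"
    by (rule digit_reversal_inject[OF p])
  then have "leading_digits p G x mod p ^ G = b mod p ^ G"
    by (metis of_nat_power of_nat_eq_iff zmod_int)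
  then show "0 \<le> x \<and> x < 1 \<and> leading_digits p G x = b"
    using x01 b leading_digits_less[OF p, of G x] by simp
qed

lemma sum_nat_digits: "(\<Sum>r<G. (n div p ^ r mod p) * p ^ r) = (n::nat) mod p ^ G"
proof (induction G)
  case (Suc G)
  have "n mod p ^ Suc G = p ^ G * (n div p ^ G mod p) + n mod p ^ G"
    by (metis mod_mult2_eq power_Suc2)
  then show ?case using Suc by (simp add: mult.commute)
qed simp

lemma nat_less_power: "p > 1 \<Longrightarrow> n \<le> G \<Longrightarrow> n < (p::nat) ^ G"
  using power_gt_expt[of p G] by linarith

lemma digit_reversal_nat:
  assumes p: "p > 0"
  shows "digit_reversal p G (int n) = (\<Sum>r<G. real (n div p ^ r mod p) / real p ^ (r + 1))"
proof -
  have "int n mod int (p ^ G) = int (\<Sum>r<G. (n div p ^ r mod p) * p ^ r) mod int (p ^ G)"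
    unfolding sum_nat_digits by (simp add: zmod_int)
  then have "digit_reversal p G (int n) = digit_reversal p G (int (\<Sum>r<G. (n div p ^ r mod p) * p ^ r))"
    by (rule periodic_cong[OF periodic_digit_reversal[OF p]])
  moreover have "digit_reversal p G (int (\<Sum>r<G. (n div p ^ r mod p) * p ^ r))
      = (\<Sum>r<G. real (n div p ^ r mod p) / real p ^ (r + 1))"
    using p by (intro digit_reversal_sum_digits) simp
  ultimately show ?thesis by (simp only:)
qed

lemma radical_inverse_eq_digit_reversal:
  assumes p: "p > 1" and G: "n \<le> G"
  shows "radical_inverse p n = digit_reversal p G (int n)"
proof -
  have "n div p ^ r mod p = 0" if "r \<notin> {..<G}" for r
  proof -
    have "n < p ^ r" using that G by (intro nat_less_power[OF p]) auto
    then show ?thesis by simp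
  qed
  then show ?thesis
    unfolding radical_inverse_def digit_reversal_nat[OF less_trans[OF zero_less_one p]]
    by (intro suminf_finite) auto
qed

text \<open>
  The part of the radical inverse after \<open>G\<close> digits is smaller than \<open>p\<^sup>-\<^sup>G\<close> because the expansion is finite, so the floor formula for the digits
  of the radical inverse returns the digits of \<open>n\<close>.
\<close>

lemma leading_digits_radical_inverse:
  assumes p: "p > 1"
  shows "leading_digits p G (radical_inverse p n) = n mod p ^ G"
proof -
  have p0: "p > 0" using p by simp
  have "radical_inverse p n = digit_reversal p (G + n) (int n)"
    using radical_inverse_eq_digit_reversal[OF p] by simp
  also have "\<dots> = digit_reversal p G (int n) + digit_reversal p n (int n div int p ^ G) / real p ^ G"
    by (rule digit_reversal_add[OF p0])
  also have "digit_reversal p G (int n) = digit_reversal p G (int (n mod p ^ G))"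
    using periodic_mod[OF periodic_digit_reversal[OF p0], of G "int n"] by (simp add: zmod_int)
  finally have "radical_inverse p n \<in> {digit_reversal p G (int (n mod p ^ G))..<
      digit_reversal p G (int (n mod p ^ G)) + 1 / real p ^ G}"
    using p0 digit_reversal_nonneg[OF p0, of n] digit_reversal_less_1[OF p0, of n]
    by (simp add: divide_strict_right_mono)
  moreover have "n mod p ^ G < p ^ G" using p0 by simp
  ultimately show ?thesis
    using leading_digits_eq_iff[OF p0, of "n mod p ^ G" G] by blast
qed

text \<open>
  Carries move weight from one digit to the next, so the digits balance up to the carry out of the first \<open>G\<close> places.
\<close>

lemma padic_add_sum:
  "(\<Sum>r<G. padic_add p z w r * p ^ r) + p ^ G * padic_carry p z w G
    = (\<Sum>r<G. z r * p ^ r) + (\<Sum>r<G. w r * p ^ r)"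
proof (induction G)
  case (Suc G)
  let ?t = "z G + w G + padic_carry p z w G"
  have "padic_add p z w G * p ^ G + p ^ Suc G * padic_carry p z w (Suc G)
      = p ^ G * (?t mod p + p * (?t div p))"
    by (simp only: padic_add_def padic_carry.simps power_Suc algebra_simps)
  also have "\<dots> = p ^ G * ?t" by (simp only: mod_mult_div_eq)
  finally show ?case using Suc by (simp add: algebra_simps)
qed simp

abbreviation halton_shift :: "nat \<Rightarrow> nat \<Rightarrow> real \<Rightarrow> real" where
  "halton_shift p n \<sigma> \<equiv> padic_shift p (radical_inverse p n) \<sigma>"

text \<open>
  Modulo \<open>p\<^sup>G\<close>, shifting is the translation \<open>b \<mapsto> n + b\<close> of the first \<open>G\<close> digits of \<open>\<sigma>\<close>.
\<close>

lemma shifted_digits_partial_sum: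
  assumes p: "p > 1"
  shows "(\<Sum>r<G. real (padic_add p (padic_phi_plus p (radical_inverse p n)) (padic_phi_plus p \<sigma>) r) / real p ^ (r + 1))
    = digit_reversal p G (int n + int (leading_digits p G \<sigma>))"
proof -
  let ?z = "padic_add p (padic_phi_plus p (radical_inverse p n)) (padic_phi_plus p \<sigma>)"
  let ?c = "padic_carry p (padic_phi_plus p (radical_inverse p n)) (padic_phi_plus p \<sigma>) G"
  have p0: "p > 0" using p by simp
  have "(\<Sum>r<G. ?z r * p ^ r) + p ^ G * ?c = n mod p ^ G + leading_digits p G \<sigma>"
    unfolding padic_add_sum leading_digits_radical_inverse[OF p, symmetric]
    by (simp add: leading_digits_def)
  then have "((\<Sum>r<G. ?z r * p ^ r) + p ^ G * ?c) mod p ^ G = (n + leading_digits p G \<sigma>) mod p ^ G"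
    by (simp add: mod_simps)
  then have "(\<Sum>r<G. ?z r * p ^ r) mod p ^ G = (n + leading_digits p G \<sigma>) mod p ^ G"
    by simp
  then have "digit_reversal p G (int (\<Sum>r<G. ?z r * p ^ r)) = digit_reversal p G (int (n + leading_digits p G \<sigma>))"
    by (intro periodic_cong[OF periodic_digit_reversal[OF p0]]) (metis zmod_int)
  moreover have "digit_reversal p G (int (\<Sum>r<G. ?z r * p ^ r)) = (\<Sum>r<G. real (?z r) / real p ^ (r + 1))"
    using p0 by (intro digit_reversal_sum_digits) (simp add: padic_add_def)
  ultimately show ?thesis
    by (simp only: of_nat_add)
qed

lemma digit_reversal_minus_one: "p > 0 \<Longrightarrow> digit_reversal p G (- 1) = 1 - 1 / real p ^ G"
proof (induction G)
  case (Suc G)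
  have "digit_reversal p (Suc G) (- 1) = (real p - 1 + (1 - 1 / real p ^ G)) / real p"
    using Suc by (simp add: zmod_minus1 div_eq_minus1)
  then show ?case using Suc.prems by (simp only:) (simp add: field_simps)
qed simp

text \<open>
  The \<open>p\<close>-adic integer attached to \<open>\<sigma> \<in> [0,1)\<close> is never \<open>- n - 1\<close>: the digits of a negative integer are eventually
  all equal to \<open>p - 1\<close>, and the floor formula does not produce such expansions.
\<close>

lemma leading_digits_never_cancel:
  assumes p: "p > 1" and \<sigma>: "0 \<le> \<sigma>" "\<sigma> < 1"
  shows "\<exists>G. \<not> int p ^ G dvd int n + int (leading_digits p G \<sigma>) + 1"
proof (rule ccontr)
  assume "\<not> ?thesis"
  then have dvd: "int p ^ G dvd int n + int (leading_digits p G \<sigma>) + 1" for G by blast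
  have p0: "p > 0" using p by simp
  let ?G0 = "n + 1"
  have eq: "leading_digits p G \<sigma> = p ^ G - n - 1" "n + 1 < p ^ G" if "G \<ge> ?G0" for G
  proof -
    show n: "n + 1 < p ^ G" using that by (intro nat_less_power[OF p]) auto
    have "p ^ G dvd n + leading_digits p G \<sigma> + 1"
      using dvd[of G] by (metis of_nat_1 of_nat_add of_nat_dvd_iff of_nat_power)
    then obtain k where k: "n + leading_digits p G \<sigma> + 1 = p ^ G * k" by blast
    have "p ^ G * k < p ^ G * 2" "p ^ G * k > 0"
      using k n leading_digits_less[OF p0, of G \<sigma>] by linarith+
    then have "k = 1" by simp
    then show "leading_digits p G \<sigma> = p ^ G - n - 1" using k by simp
  qed
  have digit: "padic_phi_plus p \<sigma> G = p - 1" if "G \<ge> ?G0" for G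
  proof -
    have "leading_digits p (Suc G) \<sigma> = leading_digits p G \<sigma> + padic_phi_plus p \<sigma> G * p ^ G"
      by (simp add: leading_digits_def)
    then have "p ^ Suc G - n - 1 = (p ^ G - n - 1) + padic_phi_plus p \<sigma> G * p ^ G"
      using eq(1)[of G] eq(1)[of "Suc G"] that by simp
    moreover have "n + 1 < p ^ G" "n + 1 < p ^ Suc G" using eq(2)[of G] eq(2)[of "Suc G"] that by auto
    ultimately have "p * p ^ G = (padic_phi_plus p \<sigma> G + 1) * p ^ G"
      by simp
    then have "p = padic_phi_plus p \<sigma> G + 1"
      using p0 by (simp del: mult_Suc)
    then show ?thesis by simp
  qed
  \<comment> \<open>With all later digits equal to \<open>p - 1\<close>, the right ends of the digit intervals of \<open>\<sigma>\<close> no longer move, and \<open>\<sigma>\<close> would have to be this common right end.\<close>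
  define c where "c = digit_reversal p ?G0 (int (leading_digits p ?G0 \<sigma>)) + 1 / real p ^ ?G0"
  have c: "digit_reversal p (?G0 + H) (int (leading_digits p (?G0 + H) \<sigma>)) + 1 / real p ^ (?G0 + H) = c" for H
  proof (induction H)
    case (Suc H)
    have "digit_reversal p (Suc (?G0 + H)) (int (leading_digits p (Suc (?G0 + H)) \<sigma>))
        = digit_reversal p (?G0 + H) (int (leading_digits p (?G0 + H) \<sigma>))
          + real (padic_phi_plus p \<sigma> (?G0 + H)) / real p ^ Suc (?G0 + H)"
      unfolding leading_digits_def using padic_phi_plus_less[OF p0]
      by (subst (1 2) digit_reversal_sum_digits) auto
    also have "real (padic_phi_plus p \<sigma> (?G0 + H)) = real p - 1"
      using digit[of "?G0 + H"] p by simp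
    finally have "digit_reversal p (Suc (?G0 + H)) (int (leading_digits p (Suc (?G0 + H)) \<sigma>))
        + 1 / real p ^ Suc (?G0 + H)
        = digit_reversal p (?G0 + H) (int (leading_digits p (?G0 + H) \<sigma>))
          + ((real p - 1) / real p ^ Suc (?G0 + H) + 1 / real p ^ Suc (?G0 + H))"
      by (simp only: add.assoc)
    also have "(real p - 1) / real p ^ Suc (?G0 + H) + 1 / real p ^ Suc (?G0 + H) = 1 / real p ^ (?G0 + H)"
      using p0 by (simp add: field_simps)
    finally show ?case using Suc by (simp only: add_Suc_right)
  qed (simp only: c_def add_0_right)
  have "\<sigma> < c"
    unfolding c_def by (rule digit_reversal_leading_digits_bounds(2)[OF p0 \<sigma>])
  moreover have "c \<le> \<sigma>"
  proof (rule ccontr)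
    assume "\<not> c \<le> \<sigma>"
    then obtain k where k: "(1 / real p) ^ k < c - \<sigma>"
      using real_arch_pow_inv[of "c - \<sigma>" "1 / real p"] p by auto
    have "(1 / real p) ^ (?G0 + k) \<le> (1 / real p) ^ k"
      using p by (intro power_decreasing) auto
    then have "1 / real p ^ (?G0 + k) < c - \<sigma>"
      using k by (simp add: power_one_over)
    then show False
      using c[of k] digit_reversal_leading_digits_bounds(1)[OF p0 \<sigma>, of "?G0 + k"] by linarith
  qed
  ultimately show False by simp
qed

text \<open>
  The value \<open>1\<close> of the digit series, which \<^const>\<open>frac\<close> would send to \<open>0\<close>, occurs only if all digits of the sum are \<open>p - 1\<close>, that is,
  if \<open>\<sigma>\<close> represents \<open>- n - 1\<close>. Excluding this makes the shift a limit of digit reversals for every \<open>\<sigma>\<close>.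
\<close>

lemma halton_shift_limit:
  assumes p: "p > 1" and \<sigma>: "0 \<le> \<sigma>" "\<sigma> < 1"
  shows "(\<lambda>G. digit_reversal p G (int n + int (leading_digits p G \<sigma>))) \<longlonglongrightarrow> halton_shift p n \<sigma>"
proof -
  have p0: "p > 0" using p by simp
  let ?z = "padic_add p (padic_phi_plus p (radical_inverse p n)) (padic_phi_plus p \<sigma>)"
  let ?f = "\<lambda>r. real (?z r) / real p ^ (r + 1)"
  let ?s = "\<lambda>G. digit_reversal p G (int n + int (leading_digits p G \<sigma>))"
  note partial = shifted_digits_partial_sum[OF p, of n \<sigma>]
  have summ: "summable ?f"
  proof (rule summableI_nonneg_bounded)
    show "sum ?f {..<G} \<le> 1" for G
      unfolding partial using digit_reversal_less_1[OF p0] by (simp add: less_imp_le)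
  qed simp
  have lim: "?s \<longlonglongrightarrow> suminf ?f"
    using summable_LIMSEQ[OF summ] unfolding partial .
  have "0 \<le> suminf ?f" by (rule suminf_nonneg[OF summ]) simp
  moreover have "suminf ?f < 1"
  proof -
    obtain G where G: "\<not> int p ^ G dvd int n + int (leading_digits p G \<sigma>) + 1"
      using leading_digits_never_cancel[OF assms] by blast
    have P: "real p ^ G > 0" using p0 by simp
    have step: "?s (G + H) \<le> ?s G + (1 / real p ^ G)" for H
    proof -
      have "?s (G + H) = (\<Sum>r<G. ?f r) + (\<Sum>r<H. ?f (G + r))"
        unfolding partial[symmetric] by (rule sum_lessThan_add)
      also have "(\<Sum>r<H. ?f (G + r)) = (\<Sum>r<H. real (?z (G + r)) / real p ^ (r + 1)) / real p ^ G"
        by (simp add: sum_divide_distrib power_add field_simps)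
      also have "(\<Sum>r<H. real (?z (G + r)) / real p ^ (r + 1))
          = digit_reversal p H (int (\<Sum>r<H. ?z (G + r) * p ^ r))"
        using p0 by (intro digit_reversal_sum_digits[symmetric]) (simp add: padic_add_def)
      also have "\<dots> / real p ^ G \<le> 1 / real p ^ G"
        using P digit_reversal_less_1[OF p0] by (intro divide_right_mono) (simp_all add: less_imp_le)
      finally show ?thesis unfolding partial by simp
    qed
    have le: "suminf ?f \<le> ?s G + 1 / real p ^ G"
    proof (rule LIMSEQ_le_const2[OF lim])
      show "\<exists>N. \<forall>n'\<ge>N. ?s n' \<le> ?s G + 1 / real p ^ G"
        using step by (metis le_iff_add)
    qed
    have "?s G \<noteq> 1 - 1 / real p ^ G"
    proof
      assume "?s G = 1 - 1 / real p ^ G"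
      then have "(int n + int (leading_digits p G \<sigma>)) mod int p ^ G = (- 1) mod int p ^ G"
        by (intro digit_reversal_inject[OF p0]) (simp add: digit_reversal_minus_one[OF p0])
      then show False
        using G by (simp add: mod_eq_dvd_iff)
    qed
    then have "?s G < 1 - 1 / real p ^ G"
      using digit_reversal_le[OF p0, of G "int n + int (leading_digits p G \<sigma>)"] by simp
    then show ?thesis using le by simp
  qed
  ultimately have "frac (suminf ?f) = suminf ?f"
    by (simp add: frac_eq)
  then show ?thesis
    using lim by (simp add: padic_shift_def padic_phi_def)
qed

lemma padic_shift_bounds: "0 \<le> padic_shift p x \<sigma>" "padic_shift p x \<sigma> < 1"
  by (simp_all add: padic_shift_def padic_phi_def frac_ge_0 frac_lt_1)

section \<open>Integrals over a random shift\<close>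

lemma integral_digit_cells:
  fixes F :: "nat \<Rightarrow> real"
  assumes p: "p > 0"
  shows "integrable lborel (\<lambda>\<sigma>. indicator {0..<1::real} \<sigma> * F (leading_digits p G \<sigma>))" (is ?I)
    and "(LINT \<sigma>|lborel. indicator {0..<1::real} \<sigma> * F (leading_digits p G \<sigma>))
      = (\<Sum>b<p ^ G. F b) / real p ^ G" (is ?E)
proof -
  let ?J = "\<lambda>b. {digit_reversal p G (int b) ..< digit_reversal p G (int b) + 1 / real p ^ G}"
  have cells: "indicator {0..<1::real} \<sigma> * F (leading_digits p G \<sigma>) = (\<Sum>b<p ^ G. indicator (?J b) \<sigma> * F b)" for \<sigma>
  proof -
    have "indicator (?J b) \<sigma> * F b = (if b = leading_digits p G \<sigma> then indicator {0..<1} \<sigma> * F b else 0)"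
      if "b < p ^ G" for b
      using leading_digits_eq_iff[OF p that, of \<sigma>] by (auto simp: indicator_def split: if_splits)
    then have "(\<Sum>b<p ^ G. indicator (?J b) \<sigma> * F b)
        = (\<Sum>b<p ^ G. if b = leading_digits p G \<sigma> then indicator {0..<1} \<sigma> * F b else 0)"
      by (intro sum.cong) auto
    then show ?thesis using leading_digits_less[OF p, of G \<sigma>] by simp
  qed
  have int: "has_bochner_integral lborel (indicator (?J b)) (1 / real p ^ G)" for b
  proof -
    have "measure lborel (?J b) = 1 / real p ^ G" "emeasure lborel (?J b) < \<infinity>"
      using p by (simp_all add: ennreal_less_top)
    then show ?thesis
      using has_bochner_integral_real_indicator[of "?J b" lborel] by simp
  qed
  have "has_bochner_integral lborel (\<lambda>\<sigma>. \<Sum>b<p ^ G. indicator (?J b) \<sigma> * F b) (\<Sum>b<p ^ G. 1 / real p ^ G * F b)"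
    using int by (intro has_bochner_integral_sum has_bochner_integral_mult_left) auto
  then have "has_bochner_integral lborel (\<lambda>\<sigma>. indicator {0..<1::real} \<sigma> * F (leading_digits p G \<sigma>))
      ((\<Sum>b<p ^ G. F b) / real p ^ G)"
    unfolding cells by (simp add: sum_divide_distrib)
  then show ?I ?E by (auto simp: has_bochner_integral_iff)
qed

text \<open>
  Dominated convergence along the digit approximations, which are simple functions; measurability of the shifted points
  comes with the limit.
\<close>

lemma integral_halton_shift_limit:
  fixes F :: "real \<Rightarrow> real \<Rightarrow> real" and n m :: nat
  assumes p: "p > 1" and cont: "continuous_on ({0..1} \<times> {0..1}) (\<lambda>z. F (fst z) (snd z))"
  defines "f \<equiv> \<lambda>\<sigma>. indicator {0..<1} \<sigma> * F (halton_shift p n \<sigma>) (halton_shift p m \<sigma>)"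
  shows "integrable lborel f"
    and "(\<lambda>G. (\<Sum>b<p ^ G. F (digit_reversal p G (int b + int n)) (digit_reversal p G (int b + int m))) / real p ^ G)
      \<longlonglongrightarrow> integral\<^sup>L lborel f"
proof -
  have p0: "p > 0" using p by simp
  let ?F = "\<lambda>G b. F (digit_reversal p G (int b + int n)) (digit_reversal p G (int b + int m))"
  define g where "g = (\<lambda>G \<sigma>. indicator {0..<1} \<sigma> * ?F G (leading_digits p G \<sigma>))"
  have mem: "(digit_reversal p G b, digit_reversal p G c) \<in> {0..1} \<times> {0..1}" for G b c
    using digit_reversal_nonneg[OF p0] digit_reversal_less_1[OF p0] by (auto simp: less_imp_le)
  obtain B where B: "\<And>x y. (x, y) \<in> {0..1} \<times> {0..1} \<Longrightarrow> \<bar>F x y\<bar> \<le> B"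
  proof -
    have "compact ((\<lambda>z. F (fst z) (snd z)) ` ({0..1} \<times> {0..1}))"
      by (intro compact_continuous_image cont compact_Times compact_Icc)
    then obtain B where "\<forall>y\<in>(\<lambda>z. F (fst z) (snd z)) ` ({0..1} \<times> {0..1}). norm y \<le> B"
      using compact_imp_bounded bounded_iff by blast
    then show ?thesis using that by force
  qed
  have lim: "(\<lambda>G. g G \<sigma>) \<longlonglongrightarrow> f \<sigma>" for \<sigma>
  proof (cases "\<sigma> \<in> {0..<1}")
    case True
    let ?z = "\<lambda>G. (digit_reversal p G (int (leading_digits p G \<sigma>) + int n),
                   digit_reversal p G (int (leading_digits p G \<sigma>) + int m))"
    have z: "?z \<longlonglongrightarrow> (halton_shift p n \<sigma>, halton_shift p m \<sigma>)"
      using True halton_shift_limit[OF p, of \<sigma>] by (intro tendsto_Pair) (simp_all add: add.commute)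
    have "(halton_shift p n \<sigma>, halton_shift p m \<sigma>) \<in> {0..1} \<times> {0..1}"
      using padic_shift_bounds by (simp add: less_imp_le)
    from continuous_on_tendsto_compose[OF cont z this]
    have "(\<lambda>G. F (fst (?z G)) (snd (?z G))) \<longlonglongrightarrow> F (halton_shift p n \<sigma>) (halton_shift p m \<sigma>)"
      using mem by (simp only: fst_conv snd_conv eventually_True simp_thms)
    then show ?thesis using True by (simp add: f_def g_def)
  qed (simp add: f_def g_def)
  have bound: "norm (g G \<sigma>) \<le> indicator {0..<1} \<sigma> * B" for G \<sigma>
    using B[OF mem] by (simp add: g_def abs_mult indicator_def)
  have g_int: "integrable lborel (g G)" for G
    unfolding g_def by (rule integral_digit_cells(1)[OF p0])
  have B_int: "integrable lborel (\<lambda>\<sigma>. indicator {0..<1::real} \<sigma> * B)"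
    using integral_digit_cells(1)[OF p0, of "\<lambda>_. B" 0] .
  have f_meas: "f \<in> borel_measurable lborel"
    using borel_measurable_LIMSEQ_metric[of g lborel f] lim g_int by (auto dest: borel_measurable_integrable)
  show "integrable lborel f"
    using integrable_dominated_convergence[of f lborel g "\<lambda>\<sigma>. indicator {0..<1} \<sigma> * B"]
      f_meas g_int B_int lim bound by (auto dest: borel_measurable_integrable)
  have "(\<lambda>G. integral\<^sup>L lborel (g G)) \<longlonglongrightarrow> integral\<^sup>L lborel f"
    using integral_dominated_convergence[of f lborel g "\<lambda>\<sigma>. indicator {0..<1} \<sigma> * B"]
      f_meas g_int B_int lim bound by (auto dest: borel_measurable_integrable)
  moreover have "integral\<^sup>L lborel (g G) = (\<Sum>b<p ^ G. ?F G b) / real p ^ G" for G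
    unfolding g_def by (rule integral_digit_cells(2)[OF p0, of "?F G"])
  ultimately show "(\<lambda>G. (\<Sum>b<p ^ G. ?F G b) / real p ^ G) \<longlonglongrightarrow> integral\<^sup>L lborel f"
    by simp
qed

lemma inverse_power_tendsto_zero: "p > (1::nat) \<Longrightarrow> (\<lambda>G. 1 / real p ^ G) \<longlonglongrightarrow> 0"
  using LIMSEQ_power_zero[of "1 / real p"] by (simp add: power_one_over)

text \<open>
  The discrete means decrease in the level up to the error \<open>1/(2 p\<^sup>H)\<close>, so any fixed level \<open>G\<close> bounds the limit.
\<close>

lemma integral_min_halton_shift_le:
  fixes n m :: nat and \<gamma> :: real
  assumes p: "p > 1" and \<gamma>: "\<gamma> \<ge> 0"
  defines "f \<equiv> \<lambda>\<sigma>. indicator {0..<1} \<sigma> * (1 + \<gamma> * min (1 - halton_shift p n \<sigma>) (1 - halton_shift p m \<sigma>))"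
  shows "integrable lborel f"
    and "integral\<^sup>L lborel f \<le> 1 + \<gamma> * (1 / 2 - mean_gap p G (int n - int m))"
proof -
  have p0: "p > 0" using p by simp
  let ?F = "\<lambda>x y. 1 + \<gamma> * min (1 - x) (1 - y)"
  have cont: "continuous_on ({0..1} \<times> {0..1}) (\<lambda>z. ?F (fst z) (snd z))"
    by (intro continuous_intros)
  show "integrable lborel f"
    unfolding f_def by (rule integral_halton_shift_limit(1)[OF p cont])
  have mean: "(\<Sum>b<p ^ H. ?F (digit_reversal p H (int b + int n)) (digit_reversal p H (int b + int m))) / real p ^ H
      = 1 + \<gamma> * (1 / 2 + 1 / (2 * real p ^ H) - mean_gap p H (int n - int m))" for H
    using p0 unfolding mean_min_digit_reversal[OF p0, symmetric]
    by (simp add: sum.distrib sum_distrib_left[symmetric] add_divide_distrib)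
  have "(\<lambda>H. 1 + \<gamma> * (1 / 2 + 1 / (2 * real p ^ H) - mean_gap p H (int n - int m))) \<longlonglongrightarrow> integral\<^sup>L lborel f"
    using integral_halton_shift_limit(2)[OF p cont, of n m] unfolding mean f_def .
  moreover have "(\<lambda>H. 1 + \<gamma> * (1 / 2 + (1 / real p ^ H) / 2 - mean_gap p G (int n - int m)))
      \<longlonglongrightarrow> 1 + \<gamma> * (1 / 2 + 0 / 2 - mean_gap p G (int n - int m))"
    by (intro tendsto_intros inverse_power_tendsto_zero[OF p]) auto
  moreover have "1 + \<gamma> * (1 / 2 + 1 / (2 * real p ^ H) - mean_gap p H (int n - int m))
      \<le> 1 + \<gamma> * (1 / 2 + (1 / real p ^ H) / 2 - mean_gap p G (int n - int m))" if "H \<ge> G" for H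
    using mean_gap_mono[OF p0, of G "int n - int m" "H - G"] that \<gamma> by (simp add: mult_left_mono)
  ultimately show "integral\<^sup>L lborel f \<le> 1 + \<gamma> * (1 / 2 - mean_gap p G (int n - int m))"
    using LIMSEQ_le by (smt (verit) div_0)
qed

text \<open>
  A shifted point is uniformly distributed, so its square has mean \<open>1/3\<close>.
\<close>

lemma integral_square_halton_shift:
  fixes n :: nat and \<gamma> :: real
  assumes p: "p > 1"
  defines "f \<equiv> \<lambda>\<sigma>. indicator {0..<1} \<sigma> * (1 + \<gamma> * ((1 - (halton_shift p n \<sigma>)\<^sup>2) / 2))"
  shows "integrable lborel f" and "integral\<^sup>L lborel f = 1 + \<gamma> / 3"
proof -
  have p0: "p > 0" using p by simp
  let ?F = "\<lambda>x y :: real. 1 + \<gamma> * ((1 - x\<^sup>2) / 2)"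
  have cont: "continuous_on ({0..1} \<times> {0..1}) (\<lambda>z. ?F (fst z) (snd z))"
    by (intro continuous_intros) auto
  show "integrable lborel f"
    unfolding f_def by (rule integral_halton_shift_limit(1)[OF p cont])
  have mean: "(\<Sum>b<p ^ G. ?F (digit_reversal p G (int b + int n)) (digit_reversal p G (int b + int n))) / real p ^ G
      = 1 + \<gamma> * ((1 - (1 - 1 / real p ^ G) * (2 - 1 / real p ^ G) / 6) / 2 - 0)" for G
  proof -
    have per: "periodic (p ^ G) (\<lambda>b. (digit_reversal p G b)\<^sup>2)"
      by (rule periodic_compose[OF periodic_digit_reversal[OF p0]])
    have "p ^ G > 0" using p0 by simp
    note shift = sum_periodic_shift[OF per this, of "int n"]
    have "(\<Sum>b<p ^ G. ?F (digit_reversal p G (int b + int n)) (digit_reversal p G (int b + int n)))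
       = real p ^ G + \<gamma> * (real p ^ G - (\<Sum>b<p ^ G. (digit_reversal p G (int b + int n))\<^sup>2)) / 2"
      by (simp add: sum.distrib sum_distrib_left[symmetric] sum_divide_distrib[symmetric] sum_subtractf)
    also have "\<dots> = real p ^ G + \<gamma> * (real p ^ G - (real p ^ G - 1) * (2 * real p ^ G - 1) / (6 * real p ^ G)) / 2"
      by (simp only: shift sum_digit_reversal_squares[OF p0])
    finally have eq: "(\<Sum>b<p ^ G. ?F (digit_reversal p G (int b + int n)) (digit_reversal p G (int b + int n)))
      = real p ^ G + \<gamma> * (real p ^ G - (real p ^ G - 1) * (2 * real p ^ G - 1) / (6 * real p ^ G)) / 2" .
    have "(P + \<gamma> * (P - (P - 1) * (2 * P - 1) / (6 * P)) / 2) / P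
        = 1 + \<gamma> * ((1 - (1 - 1 / P) * (2 - 1 / P) / 6) / 2 - 0)" if "P > 0" for P :: real
      using that by (simp add: field_simps)
    then show ?thesis unfolding eq using p0 by simp
  qed
  have "(\<lambda>G. 1 + \<gamma> * ((1 - (1 - 1 / real p ^ G) * (2 - 1 / real p ^ G) / 6) / 2 - 0)) \<longlonglongrightarrow> integral\<^sup>L lborel f"
    using integral_halton_shift_limit(2)[OF p cont, of n] unfolding mean f_def .
  moreover have "(\<lambda>G. 1 + \<gamma> * ((1 - (1 - 1 / real p ^ G) * (2 - 1 / real p ^ G) / 6) / 2 - 0))
      \<longlonglongrightarrow> 1 + \<gamma> * ((1 - (1 - 0) * (2 - 0) / 6) / 2 - 0)"
    by (intro tendsto_intros inverse_power_tendsto_zero[OF p]) auto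
  ultimately have "integral\<^sup>L lborel f = 1 + \<gamma> * ((1 - (1 - 0) * (2 - 0) / 6) / 2 - 0)"
    by (rule LIMSEQ_unique)
  then show "integral\<^sup>L lborel f = 1 + \<gamma> / 3" by simp
qed

section \<open>Products of functions of one coordinate\<close>

interpretation lborel_product: product_sigma_finite "\<lambda>_ :: nat. lborel :: real measure"
  by unfold_locales

lemma indicator_PiE_prod:
  assumes "finite I" "x \<in> extensional I"
  shows "(indicator (PiE I A) x :: real) = (\<Prod>i\<in>I. indicator (A i) (x i))"
  using assms by (auto simp: indicator_def PiE_iff prod_zero_iff)

lemma space_lborel_dim: "space (lborel_dim s) = extensional {1..s}"
  by (auto simp: lborel_dim_def space_PiM PiE_def)

lemma half_open_cube_sets: "half_open_cube s \<in> sets (lborel_dim s)"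
  unfolding half_open_cube_def lborel_dim_def by (intro sets_PiM_I_finite) auto

lemma emeasure_half_open_cube: "emeasure (lborel_dim s) (half_open_cube s) = 1"
  unfolding half_open_cube_def lborel_dim_def
  by (subst lborel_product.emeasure_PiM) auto

lemma uniform_half_open_cube:
  "uniform_measure (lborel_dim s) (half_open_cube s)
    = density (lborel_dim s) (\<lambda>\<sigma>. ennreal (indicator (half_open_cube s) \<sigma>))"
  unfolding uniform_measure_def emeasure_half_open_cube
  by (rule arg_cong[where f = "density _"]) (auto simp: indicator_def divide_ennreal_def)

lemma expectation_half_open_cube:
  fixes f :: "(nat \<Rightarrow> real) \<Rightarrow> real" and s :: nat
  defines "g \<equiv> \<lambda>\<sigma>. indicator (half_open_cube s) \<sigma> * f \<sigma>"
  assumes int: "integrable (lborel_dim s) g"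
  shows "integrable (uniform_measure (lborel_dim s) (half_open_cube s)) g"
    and "integral\<^sup>L (uniform_measure (lborel_dim s) (half_open_cube s)) g = integral\<^sup>L (lborel_dim s) g"
proof -
  have g: "(\<lambda>\<sigma>. indicator (half_open_cube s) \<sigma> *\<^sub>R g \<sigma>) = g"
    by (auto simp: g_def indicator_def)
  have meas: "g \<in> borel_measurable (lborel_dim s)"
    "(indicator (half_open_cube s) :: _ \<Rightarrow> real) \<in> borel_measurable (lborel_dim s)"
    using int half_open_cube_sets by auto
  show "integrable (uniform_measure (lborel_dim s) (half_open_cube s)) g"
    unfolding uniform_half_open_cube using meas int by (subst integrable_density) (simp_all only: g, simp)
  show "integral\<^sup>L (uniform_measure (lborel_dim s) (half_open_cube s)) g = integral\<^sup>L (lborel_dim s) g"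
    unfolding uniform_half_open_cube using meas by (subst integral_density) (simp_all only: g, simp)
qed

text \<open>
  If \<open>g\<close> is not integrable, its integral is \<open>0\<close> by convention, and the bound holds because \<open>f\<close> is nonnegative on the cube.
  The indicator turns the expectation of \<open>f\<close> into an integral for the product measure.
\<close>

lemma expectation_half_open_cube_le:
  fixes f g :: "(nat \<Rightarrow> real) \<Rightarrow> real"
  assumes int: "integrable (lborel_dim s) (\<lambda>\<sigma>. indicator (half_open_cube s) \<sigma> * f \<sigma>)"
    and le: "\<And>\<sigma>. \<sigma> \<in> half_open_cube s \<Longrightarrow> 0 \<le> g \<sigma> \<and> g \<sigma> \<le> f \<sigma>"
  shows "integral\<^sup>L (uniform_measure (lborel_dim s) (half_open_cube s)) g
    \<le> (LINT \<sigma>|lborel_dim s. indicator (half_open_cube s) \<sigma> * f \<sigma>)"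
proof -
  have nonneg: "0 \<le> f \<sigma>" if "\<sigma> \<in> half_open_cube s" for \<sigma>
    using le[OF that] by linarith
  have "AE \<sigma> in uniform_measure (lborel_dim s) (half_open_cube s). \<sigma> \<in> half_open_cube s"
    by (rule AE_uniform_measureI[OF half_open_cube_sets]) simp
  then have "AE \<sigma> in uniform_measure (lborel_dim s) (half_open_cube s).
      g \<sigma> \<le> indicator (half_open_cube s) \<sigma> * f \<sigma>"
    "AE \<sigma> in uniform_measure (lborel_dim s) (half_open_cube s).
      0 \<le> indicator (half_open_cube s) \<sigma> * f \<sigma>"
    using le nonneg by (auto elim!: eventually_mono simp: indicator_def)
  then show ?thesis
    using integral_mono_AE'[OF expectation_half_open_cube(1)[OF int]]
    unfolding expectation_half_open_cube(2)[OF int] by blast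
qed

lemma integrable_prod_half_open_cube:
  fixes h :: "nat \<Rightarrow> real \<Rightarrow> real"
  assumes "\<And>j. j \<in> {1..s} \<Longrightarrow> integrable lborel (\<lambda>t. indicator {0..<1} t * h j t)"
  shows "integrable (lborel_dim s) (\<lambda>\<sigma>. indicator (half_open_cube s) \<sigma> * (\<Prod>j=1..s. h j (\<sigma> j)))" (is ?I)
    and "(LINT \<sigma>|lborel_dim s. indicator (half_open_cube s) \<sigma> * (\<Prod>j=1..s. h j (\<sigma> j)))
      = (\<Prod>j=1..s. LINT t|lborel. indicator {0..<1} t * h j t)" (is ?E)
proof -
  have eq: "indicator (half_open_cube s) \<sigma> * (\<Prod>j=1..s. h j (\<sigma> j)) = (\<Prod>j=1..s. indicator {0..<1} (\<sigma> j) * h j (\<sigma> j))"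
    if "\<sigma> \<in> space (lborel_dim s)" for \<sigma>
    using that unfolding half_open_cube_def space_lborel_dim
    by (simp add: indicator_PiE_prod prod.distrib)
  have "integrable (lborel_dim s) (\<lambda>\<sigma>. \<Prod>j=1..s. indicator {0..<1} (\<sigma> j) * h j (\<sigma> j))"
    unfolding lborel_dim_def using assms by (intro lborel_product.product_integrable_prod) auto
  then show ?I using eq by (subst Bochner_Integration.integrable_cong[OF refl]) auto
  have "(LINT \<sigma>|lborel_dim s. (\<Prod>j=1..s. indicator {0..<1} (\<sigma> j) * h j (\<sigma> j)))
      = (\<Prod>j=1..s. LINT t|lborel. indicator {0..<1} t * h j t)"
    unfolding lborel_dim_def using assms by (intro lborel_product.product_integral_prod) auto
  then show ?E using eq by (subst Bochner_Integration.integral_cong[OF refl]) auto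
qed

section \<open>Kernel bounds for functionals on the unit ball\<close>

context rkhs
begin

lemma ip_add_right:
  assumes f: "f \<in> H" and g: "g \<in> H" and h: "h \<in> H"
  shows "ip h (\<lambda>x\<in>X. f x + g x) = ip h f + ip h g"
  unfolding ip_sym[OF h add_mem[OF f g]] ip_add[OF f g h] ip_sym[OF h f] ip_sym[OF h g] ..

lemma ip_scale_right:
  assumes f: "f \<in> H" and g: "g \<in> H"
  shows "ip g (\<lambda>x\<in>X. c * f x) = c * ip g f"
  unfolding ip_sym[OF g scale_mem[OF f]] ip_scale[OF f g] ip_sym[OF g f] ..

lemma ip_zero_right: "f \<in> H \<Longrightarrow> ip f (\<lambda>x\<in>X. 0) = 0"
  using ip_scale_right[OF zero_mem, of f 0] by simp

lemma ip_Cauchy_Schwarz: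
  assumes f: "f \<in> H" and g: "g \<in> H"
  shows "(ip f g)\<^sup>2 \<le> ip f f * ip g g"
proof (cases "ip g g = 0")
  case True
  then show ?thesis
    using ip_definite[OF g] ip_zero_right[OF f] by simp
next
  case False
  then have pos: "ip g g > 0" using ip_nonneg[OF g] by simp
  define t where "t = - ip f g / ip g g"
  let ?h = "\<lambda>x\<in>X. f x + (\<lambda>x\<in>X. t * g x) x"
  have tg: "(\<lambda>x\<in>X. t * g x) \<in> H" by (rule scale_mem[OF g])
  have h: "?h \<in> H" by (rule add_mem[OF f tg])
  have "ip ?h ?h = ip f f + 2 * t * ip f g + t\<^sup>2 * ip g g"
    unfolding ip_add[OF f tg h] ip_add_right[OF f tg f] ip_add_right[OF f tg tg]
      ip_scale[OF g f] ip_scale[OF g tg] ip_scale_right[OF g f] ip_scale_right[OF g g] ip_sym[OF g f]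
    by (simp only: power2_eq_square algebra_simps)
  also have "\<dots> = ip f f - (ip f g)\<^sup>2 / ip g g"
    using pos by (simp add: t_def field_simps power2_eq_square)
  finally have "(ip f g)\<^sup>2 / ip g g \<le> ip f f"
    using ip_nonneg[OF h] by linarith
  then show ?thesis
    using pos by (simp add: divide_le_eq)
qed

lemma combination_exists:
  assumes "finite I" "\<And>i. i \<in> I \<Longrightarrow> z i \<in> X"
  shows "\<exists>v\<in>H. (\<forall>x\<in>X. v x = (\<Sum>i\<in>I. c i * K x (z i))) \<and> (\<forall>f\<in>H. ip f v = (\<Sum>i\<in>I. c i * f (z i)))"
  using assms
proof (induction I rule: finite_induct)
  case empty
  show ?case
    by (intro bexI[OF _ zero_mem] conjI ballI) (simp_all only: ip_zero_right sum.empty restrict_apply' if_True)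
next
  case (insert i I)
  then obtain v where v: "v \<in> H" "\<And>x. x \<in> X \<Longrightarrow> v x = (\<Sum>i\<in>I. c i * K x (z i))"
    "\<And>f. f \<in> H \<Longrightarrow> ip f v = (\<Sum>i\<in>I. c i * f (z i))"
    by auto
  let ?k = "\<lambda>x\<in>X. K x (z i)"
  let ?w = "\<lambda>x\<in>X. (\<lambda>x\<in>X. c i * ?k x) x + v x"
  have z: "z i \<in> X" using insert.prems by simp
  have k: "?k \<in> H" by (rule kernel_mem[OF z])
  have ck: "(\<lambda>x\<in>X. c i * ?k x) \<in> H" by (rule scale_mem[OF k])
  have w: "?w \<in> H" by (rule add_mem[OF ck v(1)])
  have "ip f ?w = (\<Sum>i\<in>insert i I. c i * f (z i))" if f: "f \<in> H" for f
    unfolding ip_add_right[OF ck v(1) f] ip_scale_right[OF k f] reproducing[OF f z] v(3)[OF f]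
    using insert.hyps by simp
  moreover have "?w x = (\<Sum>i\<in>insert i I. c i * K x (z i))" if "x \<in> X" for x
    using that insert.hyps v(2) by simp
  ultimately show ?case using w by blast
qed

text \<open>
  The combination of point evaluations is represented by the same combination of kernel sections; Cauchy--Schwarz
  bounds its value at \<open>f\<close> by its norm, which the reproducing property expresses through the kernel.
\<close>

lemma unit_ball_combination_le:
  assumes f: "f \<in> H" "ip f f \<le> 1" and I: "finite I" "\<And>i. i \<in> I \<Longrightarrow> z i \<in> X"
  shows "(\<Sum>i\<in>I. c i * f (z i))\<^sup>2 \<le> (\<Sum>i\<in>I. \<Sum>k\<in>I. c i * c k * K (z i) (z k))"
proof -
  obtain v where v: "v \<in> H" "\<And>x. x \<in> X \<Longrightarrow> v x = (\<Sum>i\<in>I. c i * K x (z i))"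
    "\<And>f. f \<in> H \<Longrightarrow> ip f v = (\<Sum>i\<in>I. c i * f (z i))"
    using combination_exists[of I z c, OF I] by auto
  have "(\<Sum>i\<in>I. c i * f (z i))\<^sup>2 = (ip f v)\<^sup>2"
    using v(3)[OF f(1)] by simp
  also have "\<dots> \<le> ip f f * ip v v" by (rule ip_Cauchy_Schwarz[OF f(1) v(1)])
  also have "\<dots> \<le> ip v v"
    using f(2) ip_nonneg[OF v(1)] mult_right_mono[of "ip f f" 1 "ip v v"] by simp
  also have "\<dots> = (\<Sum>i\<in>I. \<Sum>k\<in>I. c i * c k * K (z i) (z k))"
    unfolding v(3)[OF v(1)] using v(2) I(2) by (simp add: sum_distrib_left mult.assoc)
  finally show ?thesis .
qed

lemma unit_ball_bound:
  assumes f: "f \<in> H" "ip f f \<le> 1" and x: "x \<in> X"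
  shows "(f x)\<^sup>2 \<le> K x x"
  using unit_ball_combination_le[OF f, of "{()}" "\<lambda>_. x" "\<lambda>_. 1"] x by simp

text \<open>
  Continuity of \<open>f\<close> is inherited from the kernel.
\<close>

lemma unit_ball_difference_le:
  assumes f: "f \<in> H" "ip f f \<le> 1" and x: "x \<in> X" "y \<in> X"
  shows "(f x - f y)\<^sup>2 \<le> K x x - K x y - K y x + K y y"
  using unit_ball_combination_le[OF f, of "{True, False}" "\<lambda>b. if b then x else y" "\<lambda>b. if b then 1 else - 1"] x
  by (simp add: algebra_simps)

lemma unit_ball_tendsto:
  assumes f: "f \<in> H" "ip f f \<le> 1" and X: "\<And>M. y M \<in> X" "x \<in> X"
    and lim: "(\<lambda>M. K (y M) (y M)) \<longlonglongrightarrow> K x x" "(\<lambda>M. K (y M) x) \<longlonglongrightarrow> K x x" "(\<lambda>M. K x (y M)) \<longlonglongrightarrow> K x x"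
  shows "(\<lambda>M. f (y M)) \<longlonglongrightarrow> f x"
proof -
  have "(\<lambda>M. K (y M) (y M) - K (y M) x - K x (y M) + K x x) \<longlonglongrightarrow> K x x - K x x - K x x + K x x"
    by (intro tendsto_intros lim)
  then have upper: "(\<lambda>M. K (y M) (y M) - K (y M) x - K x (y M) + K x x) \<longlonglongrightarrow> 0" by simp
  have "(\<lambda>M. (f (y M) - f x)\<^sup>2) \<longlonglongrightarrow> 0"
    by (rule tendsto_sandwich[OF _ _ tendsto_const upper])
      (use unit_ball_difference_le[OF f X] in auto)
  then have "(\<lambda>M. f (y M) - f x) \<longlonglongrightarrow> 0"
    using tendsto_real_sqrt[of "\<lambda>M. (f (y M) - f x)\<^sup>2" 0 sequentially]
    by (simp add: real_sqrt_abs tendsto_rabs_zero_iff)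
  then show ?thesis by (simp add: LIM_zero_iff)
qed

end

section \<open>Grid sums on the unit cube\<close>

text \<open>
  The minimum puts \<open>t = 1\<close> into the last cell, so that the cells partition the closed interval.
\<close>

definition grid_index :: "nat \<Rightarrow> real \<Rightarrow> nat" where
  "grid_index M t = min (M - 1) (nat \<lfloor>real M * t\<rfloor>)"

definition grid_point :: "nat \<Rightarrow> nat \<Rightarrow> (nat \<Rightarrow> nat) \<Rightarrow> nat \<Rightarrow> real" where
  "grid_point s M i = (\<lambda>j\<in>{1..s}. real (i j) / real M)"

definition grid :: "nat \<Rightarrow> nat \<Rightarrow> (nat \<Rightarrow> nat) set" where
  "grid s M = {1..s} \<rightarrow>\<^sub>E {..<M}"

lemma finite_grid: "finite (grid s M)"
  by (simp add: grid_def finite_PiE)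

lemma grid_point_mem: "i \<in> grid s M \<Longrightarrow> grid_point s M i \<in> unit_cube s"
  by (force simp: grid_point_def grid_def unit_cube_def PiE_iff divide_le_eq_1)

lemma grid_index_eq_iff:
  assumes M: "M > 0" and a: "a < M" and t: "0 \<le> t" "t \<le> 1"
  shows "grid_index M t = a \<longleftrightarrow> real a / real M \<le> t \<and> (t < real (a + 1) / real M \<or> a + 1 = M)"
proof -
  have "0 \<le> \<lfloor>real M * t\<rfloor>" using t by simp
  then obtain k where k: "\<lfloor>real M * t\<rfloor> = int k" by (rule nonneg_int_cases)
  have "grid_index M t = a \<longleftrightarrow> int a \<le> \<lfloor>real M * t\<rfloor> \<and> (\<lfloor>real M * t\<rfloor> < int a + 1 \<or> a + 1 = M)"
    unfolding grid_index_def k using M a by (auto simp: min_def)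
  also have "\<dots> \<longleftrightarrow> real a \<le> real M * t \<and> (real M * t < real a + 1 \<or> a + 1 = M)"
    by (simp only: le_floor_iff floor_less_iff) simp
  also have "\<dots> \<longleftrightarrow> real a / real M \<le> t \<and> (t < real (a + 1) / real M \<or> a + 1 = M)"
    using M by (simp add: field_simps)
  finally show ?thesis .
qed

lemma grid_index_less: "M > 0 \<Longrightarrow> grid_index M t < M"
  by (simp add: grid_index_def min_def) linarith

lemma grid_index_limit:
  assumes t: "0 \<le> t" "t \<le> 1"
  shows "(\<lambda>M. real (grid_index (Suc M) t) / real (Suc M)) \<longlonglongrightarrow> t"
proof (rule tendsto_sandwich)
  have b: "real (grid_index (Suc M) t) / real (Suc M) \<le> t"
    "t \<le> real (grid_index (Suc M) t + 1) / real (Suc M)" for M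
  proof -
    have *: "real (grid_index (Suc M) t) / real (Suc M) \<le> t \<and>
      (t < real (grid_index (Suc M) t + 1) / real (Suc M) \<or> grid_index (Suc M) t + 1 = Suc M)"
      using grid_index_eq_iff[of "Suc M" "grid_index (Suc M) t" t] grid_index_less[of "Suc M" t] t by blast
    then show "real (grid_index (Suc M) t) / real (Suc M) \<le> t" by blast
    show "t \<le> real (grid_index (Suc M) t + 1) / real (Suc M)"
    proof (cases "grid_index (Suc M) t + 1 = Suc M")
      case True
      then show ?thesis using t by simp
    next
      case False
      then show ?thesis using * by simp
    qed
  qed
  show "\<forall>\<^sub>F M in sequentially. t - 1 / real (Suc M) \<le> real (grid_index (Suc M) t) / real (Suc M)"
    using b(2) by (intro always_eventually allI) (simp only: of_nat_add of_nat_1 add_divide_distrib diff_le_eq)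
  show "\<forall>\<^sub>F M in sequentially. real (grid_index (Suc M) t) / real (Suc M) \<le> t"
    using b(1) by (intro always_eventually allI)
  show "(\<lambda>M. t - 1 / real (Suc M)) \<longlonglongrightarrow> t"
    using tendsto_diff[OF tendsto_const lim_inverse_n'[THEN LIMSEQ_Suc], of t] by simp
qed simp

lemma grid_cell:
  assumes "M > 0" "a < M"
  shows "{t \<in> {0..1}. grid_index M t = a} \<in> sets lborel"
    and "emeasure lborel {t \<in> {0..1}. grid_index M t = a} = ennreal (1 / real M)"
proof -
  have eq: "{t \<in> {0..1}. grid_index M t = a} =
    (if a + 1 = M then {real a / real M..1} else {real a / real M..<real (a + 1) / real M})"
  proof (intro set_eqI iffI)
    fix t assume "t \<in> {t \<in> {0..1}. grid_index M t = a}"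
    then show "t \<in> (if a + 1 = M then {real a / real M..1} else {real a / real M..<real (a + 1) / real M})"
      using grid_index_eq_iff[OF assms, of t] by auto
  next
    fix t assume t: "t \<in> (if a + 1 = M then {real a / real M..1} else {real a / real M..<real (a + 1) / real M})"
    have "real (a + 1) / real M \<le> 1" "0 \<le> real a / real M"
      using assms by (simp_all add: divide_le_eq_1)
    then have "0 \<le> t" "t \<le> 1"
      using t order_trans[of 0 "real a / real M" t] by (auto split: if_splits)
    then show "t \<in> {t \<in> {0..1}. grid_index M t = a}"
      using t grid_index_eq_iff[OF assms, of t] by (auto split: if_splits)
  qed
  show "{t \<in> {0..1}. grid_index M t = a} \<in> sets lborel"
    unfolding eq by simp
  have "real (a + 1) / real M - real a / real M = 1 / real M"
    by (simp add: diff_divide_distrib[symmetric])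
  moreover have "1 - real a / real M = 1 / real M" if "a + 1 = M"
    using that[symmetric] by (simp add: field_simps)
  moreover have "real a / real M \<le> real (a + 1) / real M" "real a / real M \<le> 1"
    using assms by (simp_all add: divide_right_mono divide_le_eq_1)
  ultimately show "emeasure lborel {t \<in> {0..1}. grid_index M t = a} = ennreal (1 / real M)"
    unfolding eq by simp
qed

text \<open>
  Composing with the rounding to a grid point gives a simple function whose level sets are boxes of volume \<open>M\<^sup>-\<^sup>s\<close>.
\<close>

lemma grid_integral:
  fixes f :: "(nat \<Rightarrow> real) \<Rightarrow> real"
  assumes M: "M > 0"
  shows "has_bochner_integral (lborel_dim s)
    (\<lambda>y. indicator (unit_cube s) y * f (grid_point s M (\<lambda>j\<in>{1..s}. grid_index M (y j))))
    ((1 / real M) ^ s * (\<Sum>i\<in>grid s M. f (grid_point s M i)))"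
proof -
  let ?cell = "\<lambda>i. PiE {1..s} (\<lambda>j. {t \<in> {0..1}. grid_index M t = i j})"
  let ?i = "\<lambda>y. \<lambda>j\<in>{1..s}. grid_index M (y j)"
  have cell_int: "has_bochner_integral (lborel_dim s) (\<lambda>y. indicator (?cell i) y * f (grid_point s M i))
      ((1 / real M) ^ s * f (grid_point s M i))" if i: "i \<in> grid s M" for i
  proof -
    have iM: "i j < M" if "j \<in> {1..s}" for j
      using i that by (auto simp: grid_def PiE_iff)
    have sets: "?cell i \<in> sets (lborel_dim s)"
      unfolding lborel_dim_def using grid_cell(1)[OF M iM] by (intro sets_PiM_I_finite) auto
    have "emeasure (lborel_dim s) (?cell i) = (\<Prod>j=1..s. ennreal (1 / real M))"
      unfolding lborel_dim_def using grid_cell[OF M iM]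
      by (subst lborel_product.emeasure_PiM) (auto intro!: prod.cong)
    also have "\<dots> = ennreal ((1 / real M) ^ s)"
      by (simp add: ennreal_power)
    finally have em: "emeasure (lborel_dim s) (?cell i) = ennreal ((1 / real M) ^ s)" .
    then have "measure (lborel_dim s) (?cell i) = (1 / real M) ^ s"
      by (simp add: measure_def)
    then have "has_bochner_integral (lborel_dim s) (indicator (?cell i)) ((1 / real M) ^ s)"
      using has_bochner_integral_real_indicator[OF sets] em by (simp add: ennreal_less_top)
    then show ?thesis by (rule has_bochner_integral_mult_left)
  qed
  have decomp: "(\<Sum>i\<in>grid s M. indicator (?cell i) y * f (grid_point s M i))
      = indicator (unit_cube s) y * f (grid_point s M (?i y))" if y: "y \<in> space (lborel_dim s)" for y
  proof -
    have i: "?i y \<in> grid s M" using grid_index_less[OF M] by (simp add: grid_def)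
    have "indicator (?cell i) y * f (grid_point s M i)
        = (if i = ?i y then indicator (unit_cube s) y * f (grid_point s M i) else 0)"
      if ig: "i \<in> grid s M" for i
    proof -
      have "y \<in> ?cell i \<longleftrightarrow> y \<in> unit_cube s \<and> i = ?i y"
      proof
        assume c: "y \<in> ?cell i"
        have "i = ?i y"
        proof (rule extensionalityI[of _ "{1..s}"])
          show "i \<in> extensional {1..s}" using ig by (simp add: grid_def PiE_iff)
          show "i j = ?i y j" if "j \<in> {1..s}" for j using c that by (auto simp: PiE_iff)
        qed simp
        then show "y \<in> unit_cube s \<and> i = ?i y"
          using c by (auto simp: unit_cube_def PiE_iff)
      next
        assume c: "y \<in> unit_cube s \<and> i = ?i y"
        then show "y \<in> ?cell i" by (auto simp: unit_cube_def PiE_iff)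
      qed
      then show ?thesis by (auto simp: indicator_def)
    qed
    then have "(\<Sum>i\<in>grid s M. indicator (?cell i) y * f (grid_point s M i))
        = (\<Sum>i\<in>grid s M. if i = ?i y then indicator (unit_cube s) y * f (grid_point s M i) else 0)"
      by (intro sum.cong) auto
    then show ?thesis using i by (simp add: finite_grid)
  qed
  have "has_bochner_integral (lborel_dim s) (\<lambda>y. \<Sum>i\<in>grid s M. indicator (?cell i) y * f (grid_point s M i))
      (\<Sum>i\<in>grid s M. (1 / real M) ^ s * f (grid_point s M i))"
    using cell_int by (intro has_bochner_integral_sum) auto
  then have "has_bochner_integral (lborel_dim s)
      (\<lambda>y. indicator (unit_cube s) y * f (grid_point s M (?i y)))
      (\<Sum>i\<in>grid s M. (1 / real M) ^ s * f (grid_point s M i))"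
    using decomp by (subst has_bochner_integral_cong[OF refl _ refl]) auto
  then show ?thesis by (simp add: sum_distrib_left)
qed

lemma grid_sum_prod:
  fixes F :: "nat \<Rightarrow> nat \<Rightarrow> real"
  shows "(1 / real M) ^ s * (\<Sum>i\<in>grid s M. \<Prod>j=1..s. F j (i j)) = (\<Prod>j=1..s. (\<Sum>a<M. F j a) / real M)"
proof -
  have "(\<Sum>i\<in>grid s M. \<Prod>j=1..s. F j (i j)) = (\<Prod>j=1..s. \<Sum>a<M. F j a)"
    unfolding grid_def by (rule prod_sum_PiE[symmetric]) auto
  then show ?thesis by (simp add: prod_dividef power_divide)
qed

section \<open>The worst-case error\<close>

lemma sobolev_kernel_commute: "sobolev_kernel s \<gamma> x y = sobolev_kernel s \<gamma> y x"
  by (simp add: sobolev_kernel_def min.commute)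

lemma tendsto_sobolev_kernel:
  assumes "\<And>j. j \<in> {1..s} \<Longrightarrow> ((\<lambda>M. x M j) \<longlongrightarrow> a j) F" "\<And>j. j \<in> {1..s} \<Longrightarrow> ((\<lambda>M. y M j) \<longlongrightarrow> b j) F"
  shows "((\<lambda>M. sobolev_kernel s \<gamma> (x M) (y M)) \<longlongrightarrow> sobolev_kernel s \<gamma> a b) F"
  unfolding sobolev_kernel_def using assms by (intro tendsto_intros tendsto_min) auto

lemma sobolev_kernel_diag_le:
  assumes "\<And>j. j \<in> {1..s} \<Longrightarrow> 0 \<le> \<gamma> j" "x \<in> unit_cube s"
  shows "sobolev_kernel s \<gamma> x x \<le> (\<Prod>j=1..s. 1 + \<gamma> j)"
  unfolding sobolev_kernel_def
proof (intro prod_mono conjI)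
  fix j assume j: "j \<in> {1..s}"
  then have x: "0 \<le> x j" "x j \<le> 1" using assms(2) by (auto simp: unit_cube_def PiE_iff)
  show "0 \<le> 1 + \<gamma> j * min (1 - x j) (1 - x j)"
    using assms(1)[OF j] x by simp
  show "1 + \<gamma> j * min (1 - x j) (1 - x j) \<le> 1 + \<gamma> j"
    using assms(1)[OF j] x by (simp add: mult_left_le)
qed

text \<open>
  With \<open>min (1 - a/M) (1 - b/M) = (M - max a b)/M\<close> the sum is \<open>\<Sum>\<^sub>k k\<^sup>2\<close>, built up by bordering the square.
\<close>

lemma double_grid_sum_min:
  assumes M: "M > 0"
  shows "(\<Sum>a<M. \<Sum>b<M. min (1 - real a / real M) (1 - real b / real M))
    = (real M + 1) * (2 * real M + 1) / 6"
proof -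
  have int: "(\<Sum>a<n. \<Sum>b<n. real n - real (max a b)) = real n * (real n + 1) * (2 * real n + 1) / 6" for n
  proof (induction n)
    case (Suc n)
    have max_row: "(\<Sum>a<n. real (Suc n) - real (max a n)) = (\<Sum>a<n. 1)"
      by (intro sum.cong) (auto simp: max_def)
    have max_col: "(\<Sum>b<n. real (Suc n) - real (max n b)) = (\<Sum>b<n. 1)"
      by (intro sum.cong) (auto simp: max_def)
    have "(\<Sum>a<Suc n. \<Sum>b<Suc n. real (Suc n) - real (max a b))
      = (\<Sum>a<n. (\<Sum>b<n. real (Suc n) - real (max a b)) + (real (Suc n) - real (max a n)))
        + ((\<Sum>b<n. real (Suc n) - real (max n b)) + 1)"
      by (simp only: sum.lessThan_Suc max.idem of_nat_Suc add_diff_cancel_left')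
    also have "\<dots> = (\<Sum>a<n. \<Sum>b<n. (real n - real (max a b)) + 1) + (\<Sum>a<n. 1) + ((\<Sum>b<n. 1) + 1)"
    proof -
      have "(\<Sum>b<n. real (Suc n) - real (max a b)) = (\<Sum>b<n. (real n - real (max a b)) + 1)" for a
        by (intro sum.cong) auto
      then show ?thesis
        unfolding max_col by (simp only: max_row sum.distrib[of "\<lambda>a. \<Sum>b<n. real n - real (max a b) + 1"])
    qed
    also have "\<dots> = (\<Sum>a<n. \<Sum>b<n. real n - real (max a b)) + (real n + 1)\<^sup>2"
      by (simp only: sum.distrib) (simp add: power2_eq_square algebra_simps)
    finally show ?case using Suc by (simp add: power2_eq_square field_simps)
  qed simp
  have "(\<Sum>a<M. \<Sum>b<M. min (1 - real a / real M) (1 - real b / real M))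
      = (\<Sum>a<M. \<Sum>b<M. (real M - real (max a b)) / real M)"
    using M by (intro sum.cong refl) (auto simp: min_def max_def field_simps)
  also have "\<dots> = (\<Sum>a<M. \<Sum>b<M. real M - real (max a b)) / real M"
    by (simp add: sum_divide_distrib)
  finally show ?thesis using M unfolding int by simp
qed

text \<open>
  The summand decreases in \<open>a\<close> and the sum uses left endpoints, so it dominates the integral
  of \<open>min (1 - t) (1 - y)\<close> over the unit interval.
\<close>

lemma grid_sum_min_ge:
  assumes M: "M > 0" and y: "0 \<le> y" "y \<le> 1"
  shows "(1 - y\<^sup>2) / 2 \<le> (\<Sum>a<M. min (1 - real a / real M) (1 - y)) / real M"
proof -
  \<comment> \<open>the antiderivative of \<open>min (1 - t) (1 - y)\<close> that vanishes at \<open>0\<close>\<close>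
  define \<Psi> where "\<Psi> = (\<lambda>t. if t \<le> y then t * (1 - y) else t - t\<^sup>2 / 2 - y\<^sup>2 / 2)"
  have step: "\<Psi> (t + h) - \<Psi> t \<le> h * min (1 - t) (1 - y)" if h: "0 \<le> h" for t h
  proof -
    consider "t + h \<le> y" | "y < t" | "t \<le> y" "y < t + h" by linarith
    then show ?thesis
    proof cases
      case 1
      then have "min (1 - t) (1 - y) = 1 - y" using h by simp
      then show ?thesis using 1 h by (simp add: \<Psi>_def algebra_simps)
    next
      case 2
      then have "min (1 - t) (1 - y) = 1 - t" by simp
      moreover have "0 \<le> h\<^sup>2" by simp
      ultimately show ?thesis using 2 h by (simp add: \<Psi>_def power2_eq_square field_simps)
    next
      case 3
      then have "min (1 - t) (1 - y) = 1 - y" by simp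
      moreover have "0 \<le> (t + h - y)\<^sup>2" by simp
      ultimately show ?thesis using 3 h by (simp add: \<Psi>_def power2_eq_square field_simps)
    qed
  qed
  have "(1 - y\<^sup>2) / 2 = \<Psi> (real M / real M) - \<Psi> (real 0 / real M)"
    using y M by (auto simp: \<Psi>_def power2_eq_square field_simps)
  also have "\<dots> = (\<Sum>a<M. \<Psi> (real (Suc a) / real M) - \<Psi> (real a / real M))"
    by (rule sum_lessThan_telescope[symmetric])
  also have "\<dots> \<le> (\<Sum>a<M. 1 / real M * min (1 - real a / real M) (1 - y))"
  proof (rule sum_mono)
    fix a
    have "real (Suc a) / real M = real a / real M + 1 / real M"
      by (simp add: add_divide_distrib)
    then show "\<Psi> (real (Suc a) / real M) - \<Psi> (real a / real M)
        \<le> 1 / real M * min (1 - real a / real M) (1 - y)"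
      using step[of "1 / real M" "real a / real M"] by (simp only:) simp
  qed
  finally show ?thesis by (simp add: sum_divide_distrib)
qed

lemma grid_sum_kernel:
  shows "(1 / real M) ^ s * (\<Sum>i\<in>grid s M. sobolev_kernel s \<gamma> y (grid_point s M i))
    = (\<Prod>j=1..s. (\<Sum>a<M. 1 + \<gamma> j * min (1 - y j) (1 - real a / real M)) / real M)"
proof -
  have "(\<Sum>i\<in>grid s M. sobolev_kernel s \<gamma> y (grid_point s M i))
      = (\<Sum>i\<in>grid s M. \<Prod>j=1..s. 1 + \<gamma> j * min (1 - y j) (1 - real (i j) / real M))"
    unfolding sobolev_kernel_def by (intro sum.cong prod.cong refl) (simp add: grid_point_def)
  then show ?thesis
    by (simp only: grid_sum_prod[of M s "\<lambda>j a. 1 + \<gamma> j * min (1 - y j) (1 - real a / real M)"])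
qed

lemma double_grid_sum_kernel:
  assumes M: "M > 0"
  shows "(1 / real M) ^ s * (\<Sum>i\<in>grid s M. (1 / real M) ^ s *
      (\<Sum>k\<in>grid s M. sobolev_kernel s \<gamma> (grid_point s M i) (grid_point s M k)))
    = (\<Prod>j=1..s. 1 + \<gamma> j * ((1 + 1 / real M) * (2 + 1 / real M) / 6))"
proof -
  have "(1 / real M) ^ s * (\<Sum>i\<in>grid s M. (1 / real M) ^ s *
      (\<Sum>k\<in>grid s M. sobolev_kernel s \<gamma> (grid_point s M i) (grid_point s M k)))
    = (1 / real M) ^ s * (\<Sum>i\<in>grid s M. \<Prod>j=1..s.
        (\<Sum>a<M. 1 + \<gamma> j * min (1 - real (i j) / real M) (1 - real a / real M)) / real M)"
    unfolding grid_sum_kernel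
    by (intro arg_cong2[where f = "(*)"] sum.cong prod.cong refl) (simp add: grid_point_def)
  also have "\<dots> = (\<Prod>j=1..s. (\<Sum>b<M. (\<Sum>a<M. 1 + \<gamma> j * min (1 - real b / real M) (1 - real a / real M)) / real M) / real M)"
    by (rule grid_sum_prod)
  also have "\<dots> = (\<Prod>j=1..s. 1 + \<gamma> j * ((1 + 1 / real M) * (2 + 1 / real M) / 6))"
  proof (intro prod.cong refl)
    fix j
    have "(\<Sum>b<M. (\<Sum>a<M. 1 + \<gamma> j * min (1 - real b / real M) (1 - real a / real M)) / real M) / real M
      = (real M * real M + \<gamma> j * (\<Sum>b<M. \<Sum>a<M. min (1 - real b / real M) (1 - real a / real M))) / real M / real M"
      by (simp add: sum.distrib sum_distrib_left[symmetric] sum_divide_distrib[symmetric])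
    then show "(\<Sum>b<M. (\<Sum>a<M. 1 + \<gamma> j * min (1 - real b / real M) (1 - real a / real M)) / real M) / real M
      = 1 + \<gamma> j * ((1 + 1 / real M) * (2 + 1 / real M) / 6)"
      unfolding double_grid_sum_min[OF M] using M by (simp add: field_simps)
  qed
  finally show ?thesis .
qed

text \<open>
  The squared norm of the integration error as a functional, in which
  \<open>\<integral>\<integral> K = \<Prod>\<^sub>j (1 + \<gamma>\<^sub>j/3)\<close> and \<open>\<integral> K(x, \<cdot>) = \<Prod>\<^sub>j (1 + \<gamma>\<^sub>j (1 - x\<^sub>j\<^sup>2)/2)\<close>.
\<close>

definition sobolev_discrepancy :: "nat \<Rightarrow> (nat \<Rightarrow> real) \<Rightarrow> nat \<Rightarrow> (nat \<Rightarrow> nat \<Rightarrow> real) \<Rightarrow> real" where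
  "sobolev_discrepancy s \<gamma> N x = (\<Prod>j=1..s. 1 + \<gamma> j / 3)
    - 2 / real N * (\<Sum>n<N. \<Prod>j=1..s. 1 + \<gamma> j * ((1 - (x n j)\<^sup>2) / 2))
    + 1 / (real N)\<^sup>2 * (\<Sum>n<N. \<Sum>m<N. sobolev_kernel s \<gamma> (x n) (x m))"

context
  fixes s N :: nat and \<gamma> :: "nat \<Rightarrow> real" and H ip and x :: "nat \<Rightarrow> nat \<Rightarrow> real"
  assumes rkhs: "rkhs (unit_cube s) (sobolev_kernel s \<gamma>) H ip"
    and \<gamma>: "\<And>j. j \<in> {1..s} \<Longrightarrow> 0 \<le> \<gamma> j"
    and x: "\<And>n. x n \<in> unit_cube s"
begin

interpretation rkhs "unit_cube s" "sobolev_kernel s \<gamma>" H ip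
  by (rule rkhs)

text \<open>
  The signed measure is the grid average minus the average over the points; its quadratic form in the kernel splits into
  grid-grid, mixed and point-point parts, and the first two factorise over the coordinates.
\<close>

lemma grid_error_le:
  assumes f: "f \<in> H" "ip f f \<le> 1" and M: "M > 0"
  shows "((1 / real M) ^ s * (\<Sum>i\<in>grid s M. f (grid_point s M i)) - 1 / real N * (\<Sum>n<N. f (x n)))\<^sup>2
    \<le> (\<Prod>j=1..s. 1 + \<gamma> j * ((1 + 1 / real M) * (2 + 1 / real M) / 6))
      - 2 / real N * (\<Sum>n<N. \<Prod>j=1..s. 1 + \<gamma> j * ((1 - (x n j)\<^sup>2) / 2))
      + 1 / (real N)\<^sup>2 * (\<Sum>n<N. \<Sum>m<N. sobolev_kernel s \<gamma> (x n) (x m))"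
proof -
  let ?K = "sobolev_kernel s \<gamma>"
  define w where "w = (1 / real M) ^ s"
  define v where "v = 1 / real N"
  let ?g = "grid_point s M"
  \<comment> \<open>The disjoint sum keeps grid points and sample points apart even where they coincide.\<close>
  let ?I = "grid s M <+> {..<N}"
  define z where "z = case_sum ?g x"
  define c where "c = case_sum (\<lambda>_::nat \<Rightarrow> nat. w) (\<lambda>_::nat. - v)"
  have z: "z i \<in> unit_cube s" if "i \<in> ?I" for i
    using that x grid_point_mem by (auto simp: z_def)
  have fin: "finite ?I" by (simp add: finite_grid)
  have plus: "(\<Sum>i\<in>?I. h i) = (\<Sum>i\<in>grid s M. h (Inl i)) + (\<Sum>n<N. h (Inr n))" for h :: "_ \<Rightarrow> real"
    by (simp add: sum.Plus finite_grid)
  have cross: "(\<Sum>i\<in>grid s M. \<Sum>n<N. w * v * ?K (?g i) (x n)) = v * (\<Sum>n<N. w * (\<Sum>i\<in>grid s M. ?K (x n) (?g i)))"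
    by (subst sum.swap) (simp add: sum_distrib_left sobolev_kernel_commute[of s \<gamma> "?g _"] mult_ac)
  have "(w * (\<Sum>i\<in>grid s M. f (?g i)) - v * (\<Sum>n<N. f (x n)))\<^sup>2 = (\<Sum>i\<in>?I. c i * f (z i))\<^sup>2"
    unfolding plus by (simp add: c_def z_def sum_distrib_left sum_negf)
  also have "\<dots> \<le> (\<Sum>i\<in>?I. \<Sum>k\<in>?I. c i * c k * ?K (z i) (z k))"
    using f fin z by (rule unit_ball_combination_le)
  also have "\<dots> = w * (\<Sum>i\<in>grid s M. w * (\<Sum>k\<in>grid s M. ?K (?g i) (?g k)))
      - (\<Sum>i\<in>grid s M. \<Sum>n<N. w * v * ?K (?g i) (x n))
      - v * (\<Sum>n<N. w * (\<Sum>i\<in>grid s M. ?K (x n) (?g i)))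
      + v\<^sup>2 * (\<Sum>n<N. \<Sum>m<N. ?K (x n) (x m))"
    unfolding plus
    by (simp add: c_def z_def sum.distrib sum_negf sum_subtractf sum_distrib_left power2_eq_square mult_ac)
  also have "\<dots> = (\<Prod>j=1..s. 1 + \<gamma> j * ((1 + 1 / real M) * (2 + 1 / real M) / 6))
      - 2 * v * (\<Sum>n<N. w * (\<Sum>i\<in>grid s M. ?K (x n) (?g i)))
      + v\<^sup>2 * (\<Sum>n<N. \<Sum>m<N. ?K (x n) (x m))"
    unfolding cross double_grid_sum_kernel[OF M, of s \<gamma>, folded w_def] by simp
  also have "\<dots> \<le> (\<Prod>j=1..s. 1 + \<gamma> j * ((1 + 1 / real M) * (2 + 1 / real M) / 6))
      - 2 * v * (\<Sum>n<N. \<Prod>j=1..s. 1 + \<gamma> j * ((1 - (x n j)\<^sup>2) / 2))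
      + v\<^sup>2 * (\<Sum>n<N. \<Sum>m<N. ?K (x n) (x m))"
  proof -
    have "(\<Prod>j=1..s. 1 + \<gamma> j * ((1 - (x n j)\<^sup>2) / 2)) \<le> w * (\<Sum>i\<in>grid s M. ?K (x n) (?g i))" for n
      unfolding w_def grid_sum_kernel
    proof (intro prod_mono conjI)
      fix j assume j: "j \<in> {1..s}"
      then have xj: "0 \<le> x n j" "x n j \<le> 1" using x[of n] by (auto simp: unit_cube_def PiE_iff)
      have "(x n j)\<^sup>2 \<le> 1" using xj by (simp add: power_le_one)
      then show "0 \<le> 1 + \<gamma> j * ((1 - (x n j)\<^sup>2) / 2)" using \<gamma>[OF j] by simp
      have "1 + \<gamma> j * ((1 - (x n j)\<^sup>2) / 2) \<le> 1 + \<gamma> j * ((\<Sum>a<M. min (1 - real a / real M) (1 - x n j)) / real M)"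
        using grid_sum_min_ge[OF M xj] \<gamma>[OF j] by (intro add_left_mono mult_left_mono)
      also have "\<dots> = (\<Sum>a<M. 1 + \<gamma> j * min (1 - x n j) (1 - real a / real M)) / real M"
        using M by (simp add: sum.distrib sum_distrib_left[symmetric] add_divide_distrib min.commute)
      finally show "1 + \<gamma> j * ((1 - (x n j)\<^sup>2) / 2) \<le> (\<Sum>a<M. 1 + \<gamma> j * min (1 - x n j) (1 - real a / real M)) / real M" .
    qed
    then have "2 * v * (\<Sum>n<N. \<Prod>j=1..s. 1 + \<gamma> j * ((1 - (x n j)\<^sup>2) / 2))
        \<le> 2 * v * (\<Sum>n<N. w * (\<Sum>i\<in>grid s M. ?K (x n) (?g i)))"
      by (intro mult_left_mono sum_mono) (auto simp: v_def)
    then show ?thesis by simp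
  qed
  finally show ?thesis by (simp add: w_def v_def power_divide)
qed

text \<open>
  By continuity of \<open>f\<close> the step functions converge pointwise, and \<open>f\<close> is bounded by the kernel diagonal. The
  argument also gives measurability of \<open>f\<close> for the product measure.
\<close>

lemma grid_sum_tendsto_integral:
  assumes f: "f \<in> H" "ip f f \<le> 1"
  shows "(\<lambda>M. (1 / real (Suc M)) ^ s * (\<Sum>i\<in>grid s (Suc M). f (grid_point s (Suc M) i)))
    \<longlonglongrightarrow> (LINT y:unit_cube s|lborel_dim s. f y)"
proof -
  let ?G = "\<lambda>M y. grid_point s (Suc M) (\<lambda>j\<in>{1..s}. grid_index (Suc M) (y j))"
  define g where "g = (\<lambda>M y. indicator (unit_cube s) y * f (?G M y))"
  define B where "B = (\<Prod>j=1..s. 1 + \<gamma> j) + 1"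
  have G_mem: "?G M y \<in> unit_cube s" for M y
    by (rule grid_point_mem) (simp add: grid_def grid_index_less)
  have bnd: "\<bar>f y\<bar> \<le> B" if "y \<in> unit_cube s" for y
  proof -
    have "\<bar>f y\<bar>\<^sup>2 \<le> (\<Prod>j=1..s. 1 + \<gamma> j)"
      using unit_ball_bound[OF f that] sobolev_kernel_diag_le[of s \<gamma> y, OF \<gamma> that] by simp
    moreover have "\<bar>f y\<bar> \<le> \<bar>f y\<bar>\<^sup>2 + 1"
      using zero_le_power2[of "\<bar>f y\<bar> - 1"] zero_le_power2[of "f y"] by (simp add: power2_diff)
    ultimately show ?thesis by (simp add: B_def)
  qed
  have lim: "(\<lambda>M. g M y) \<longlonglongrightarrow> indicator (unit_cube s) y *\<^sub>R f y" for y
  proof (cases "y \<in> unit_cube s")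
    case True
    have G_lim: "(\<lambda>M. ?G M y j) \<longlonglongrightarrow> y j" if "j \<in> {1..s}" for j
      using that True grid_index_limit[of "y j"] by (simp add: grid_point_def unit_cube_def PiE_iff)
    have "(\<lambda>M. f (?G M y)) \<longlonglongrightarrow> f y"
      by (rule unit_ball_tendsto[OF f G_mem True]) (intro tendsto_sobolev_kernel G_lim tendsto_const; assumption)+
    then show ?thesis using True by (simp add: g_def)
  qed (simp add: g_def)
  have g_int: "has_bochner_integral (lborel_dim s) (g M)
      ((1 / real (Suc M)) ^ s * (\<Sum>i\<in>grid s (Suc M). f (grid_point s (Suc M) i)))" for M
    unfolding g_def by (rule grid_integral) simp
  have B_int: "integrable (lborel_dim s) (\<lambda>y. indicator (unit_cube s) y * B)"
    using grid_integral[of 1 s "\<lambda>_. B"] by (simp add: has_bochner_integral_iff)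
  have bound: "norm (g M y) \<le> indicator (unit_cube s) y * B" for M y
    using bnd[OF G_mem] by (simp add: g_def abs_mult indicator_def)
  have meas: "g M \<in> borel_measurable (lborel_dim s)" for M
    using g_int by (auto simp: has_bochner_integral_iff dest: borel_measurable_integrable)
  have "(\<lambda>M. integral\<^sup>L (lborel_dim s) (g M)) \<longlonglongrightarrow> (LINT y|lborel_dim s. indicator (unit_cube s) y *\<^sub>R f y)"
  proof (rule integral_dominated_convergence[OF _ meas B_int])
    show "(\<lambda>y. indicator (unit_cube s) y *\<^sub>R f y) \<in> borel_measurable (lborel_dim s)"
      by (rule borel_measurable_LIMSEQ_metric[OF meas lim])
  qed (use lim bound in auto)
  then show ?thesis
    using g_int by (simp add: has_bochner_integral_iff set_lebesgue_integral_def)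
qed

lemma integration_error_le:
  assumes f: "f \<in> H" "ip f f \<le> 1"
  shows "((LINT y:unit_cube s|lborel_dim s. f y) - 1 / real N * (\<Sum>n<N. f (x n)))\<^sup>2
    \<le> sobolev_discrepancy s \<gamma> N x"
proof (rule LIMSEQ_le)
  let ?Q = "1 / real N * (\<Sum>n<N. f (x n))"
  show "(\<lambda>M. ((1 / real (Suc M)) ^ s * (\<Sum>i\<in>grid s (Suc M). f (grid_point s (Suc M) i)) - ?Q)\<^sup>2)
    \<longlonglongrightarrow> ((LINT y:unit_cube s|lborel_dim s. f y) - ?Q)\<^sup>2"
    by (intro tendsto_power tendsto_diff grid_sum_tendsto_integral f tendsto_const)
  let ?E = "\<lambda>t. (\<Prod>j=1..s. 1 + \<gamma> j * ((1 + t) * (2 + t) / 6))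
      - 2 / real N * (\<Sum>n<N. \<Prod>j=1..s. 1 + \<gamma> j * ((1 - (x n j)\<^sup>2) / 2))
      + 1 / (real N)\<^sup>2 * (\<Sum>n<N. \<Sum>m<N. sobolev_kernel s \<gamma> (x n) (x m))"
  have "(\<lambda>M. ?E (1 / real (Suc M))) \<longlonglongrightarrow> ?E 0"
    using lim_inverse_n'[THEN LIMSEQ_Suc]
    by (intro tendsto_add tendsto_diff tendsto_const tendsto_prod tendsto_mult tendsto_divide) auto
  then show "(\<lambda>M. ?E (1 / real (Suc M))) \<longlonglongrightarrow> sobolev_discrepancy s \<gamma> N x"
    by (simp add: sobolev_discrepancy_def)
  show "\<exists>M0. \<forall>M\<ge>M0. ((1 / real (Suc M)) ^ s * (\<Sum>i\<in>grid s (Suc M). f (grid_point s (Suc M) i)) - ?Q)\<^sup>2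
    \<le> ?E (1 / real (Suc M))"
    by (intro exI[of _ 0] allI impI grid_error_le f) simp
qed

text \<open>
  Passing to the limit in the grid bound gives the discrepancy for each function of the unit ball, hence for the
  supremum. The zero function shows that the supremum is nonnegative, so that it may be squared.
\<close>

lemma worst_case_error_square_le:
  "(worst_case_error H ip s N x)\<^sup>2 \<le> sobolev_discrepancy s \<gamma> N x"
proof -
  let ?e = "\<lambda>f. \<bar>(LINT y:unit_cube s|lborel_dim s. f y) - 1 / real N * (\<Sum>n<N. f (x n))\<bar>"
  let ?B = "{f \<in> H. sqrt (ip f f) \<le> 1}"
  let ?E = "sobolev_discrepancy s \<gamma> N x"
  have e_le: "?e f \<le> sqrt ?E" if "f \<in> ?B" for f
    using integration_error_le[of f] that by (simp add: real_le_rsqrt)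
  have zero: "(\<lambda>y\<in>unit_cube s. 0) \<in> ?B"
    using zero_mem ip_zero_right[OF zero_mem] by simp
  have "worst_case_error H ip s N x \<le> sqrt ?E"
    unfolding worst_case_error_def using zero e_le by (intro cSUP_least) auto
  moreover have "0 \<le> worst_case_error H ip s N x"
  proof -
    have "bdd_above (?e ` ?B)" using e_le by (intro bdd_aboveI2)
    then have "?e (\<lambda>y\<in>unit_cube s. 0) \<le> worst_case_error H ip s N x"
      unfolding worst_case_error_def using zero by (rule cSUP_upper[rotated])
    then show ?thesis by linarith
  qed
  ultimately have "(worst_case_error H ip s N x)\<^sup>2 \<le> (sqrt ?E)\<^sup>2"
    by (intro power_mono)
  also have "\<dots> = ?E"
    using e_le[OF zero] by (intro real_sqrt_pow2) (meson abs_ge_zero order_trans real_sqrt_ge_0_iff)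
  finally show ?thesis .
qed

end

section \<open>The mean square error over random shifts\<close>

text \<open>
  The middle term of the discrepancy averages to \<open>- 2 \<Prod>\<^sub>j (1 + \<gamma>\<^sub>j/3)\<close> because the points are uniformly distributed. The
  levels \<open>G\<close> at which the gaps are truncated can be chosen freely in each coordinate.
\<close>

lemma rms_worst_case_error_square_le:
  fixes p :: "nat \<Rightarrow> nat" and \<gamma> :: "nat \<Rightarrow> real" and G :: "nat \<Rightarrow> nat"
  assumes rkhs: "rkhs (unit_cube s) (sobolev_kernel s \<gamma>) H ip"
    and \<gamma>: "\<And>j. j \<in> {1..s} \<Longrightarrow> 0 \<le> \<gamma> j" and p: "\<And>j. j \<in> {1..s} \<Longrightarrow> p j > 1" and N: "N > 0"
  shows "(rms_worst_case_error H ip s N p)\<^sup>2 \<le>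
    1 / (real N)\<^sup>2 * (\<Sum>n<N. \<Sum>m<N. \<Prod>j=1..s. 1 + \<gamma> j * (1 / 2 - mean_gap (p j) (G j) (int n - int m)))
    - (\<Prod>j=1..s. 1 + \<gamma> j / 3)"
proof -
  let ?x = "shifted_halton s p"
  let ?U = "uniform_measure (lborel_dim s) (half_open_cube s)"
  let ?C = "\<lambda>\<sigma>. indicator (half_open_cube s) \<sigma> :: real"
  have x: "?x \<sigma> n \<in> unit_cube s" for \<sigma> n
    using padic_shift_bounds by (auto simp: shifted_halton_def unit_cube_def less_imp_le)
  have xj: "?x \<sigma> n j = halton_shift (p j) n (\<sigma> j)" if "j \<in> {1..s}" for \<sigma> n j
    using that by (simp add: shifted_halton_def halton_def)
  let ?c = "\<Prod>j=1..s. 1 + \<gamma> j / 3"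
  let ?S = "\<lambda>n \<sigma>. \<Prod>j=1..s. 1 + \<gamma> j * ((1 - (?x \<sigma> n j)\<^sup>2) / 2)"
  let ?T = "\<lambda>n m \<sigma>. sobolev_kernel s \<gamma> (?x \<sigma> n) (?x \<sigma> m)"
  have const: "integrable (lborel_dim s) ?C" "integral\<^sup>L (lborel_dim s) ?C = 1"
    using half_open_cube_sets emeasure_half_open_cube by (simp_all add: measure_def)
  have S_eq: "?S n \<sigma> = (\<Prod>j=1..s. 1 + \<gamma> j * ((1 - (halton_shift (p j) n (\<sigma> j))\<^sup>2) / 2))" for n \<sigma>
    by (intro prod.cong refl) (simp add: xj)
  have S: "integrable (lborel_dim s) (\<lambda>\<sigma>. ?C \<sigma> * ?S n \<sigma>)"
    "(LINT \<sigma>|lborel_dim s. ?C \<sigma> * ?S n \<sigma>) = ?c" for n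
  proof -
    let ?h = "\<lambda>j t. 1 + \<gamma> j * ((1 - (halton_shift (p j) n t)\<^sup>2) / 2)"
    have int: "integrable lborel (\<lambda>t. indicator {0..<1} t * ?h j t)" if "j \<in> {1..s}" for j
      by (rule integral_square_halton_shift(1)[OF p[OF that]])
    show "integrable (lborel_dim s) (\<lambda>\<sigma>. ?C \<sigma> * ?S n \<sigma>)"
      unfolding S_eq by (rule integrable_prod_half_open_cube(1)[of s ?h, OF int])
    have "(LINT \<sigma>|lborel_dim s. ?C \<sigma> * ?S n \<sigma>) = (\<Prod>j=1..s. LINT t|lborel. indicator {0..<1} t * ?h j t)"
      unfolding S_eq by (rule integrable_prod_half_open_cube(2)[of s ?h, OF int])
    then show "(LINT \<sigma>|lborel_dim s. ?C \<sigma> * ?S n \<sigma>) = ?c"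
      using integral_square_halton_shift(2)[OF p] by simp
  qed
  have T_eq: "?T n m \<sigma> = (\<Prod>j=1..s. 1 + \<gamma> j * min (1 - halton_shift (p j) n (\<sigma> j)) (1 - halton_shift (p j) m (\<sigma> j)))"
    for n m \<sigma>
    unfolding sobolev_kernel_def by (intro prod.cong refl) (simp add: xj)
  have T: "integrable (lborel_dim s) (\<lambda>\<sigma>. ?C \<sigma> * ?T n m \<sigma>)"
    "(LINT \<sigma>|lborel_dim s. ?C \<sigma> * ?T n m \<sigma>)
      \<le> (\<Prod>j=1..s. 1 + \<gamma> j * (1 / 2 - mean_gap (p j) (G j) (int n - int m)))" for n m
  proof -
    let ?h = "\<lambda>j t. 1 + \<gamma> j * min (1 - halton_shift (p j) n t) (1 - halton_shift (p j) m t)"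
    have int: "integrable lborel (\<lambda>t. indicator {0..<1} t * ?h j t)" if "j \<in> {1..s}" for j
      by (rule integral_min_halton_shift_le(1)[OF p[OF that] \<gamma>[OF that]])
    show "integrable (lborel_dim s) (\<lambda>\<sigma>. ?C \<sigma> * ?T n m \<sigma>)"
      unfolding T_eq by (rule integrable_prod_half_open_cube(1)[of s ?h, OF int])
    have "(LINT \<sigma>|lborel_dim s. ?C \<sigma> * ?T n m \<sigma>) = (\<Prod>j=1..s. LINT t|lborel. indicator {0..<1} t * ?h j t)"
      unfolding T_eq by (rule integrable_prod_half_open_cube(2)[of s ?h, OF int])
    also have "\<dots> \<le> (\<Prod>j=1..s. 1 + \<gamma> j * (1 / 2 - mean_gap (p j) (G j) (int n - int m)))"
    proof (intro prod_mono conjI integral_nonneg_AE AE_I2)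
      fix j t assume j: "j \<in> {1..s}"
      show "0 \<le> indicator {0..<1} t * ?h j t"
        using \<gamma>[OF j] padic_shift_bounds(2)[of "p j" _ t] by (auto simp: indicator_def less_imp_le intro!: add_nonneg_nonneg mult_nonneg_nonneg)
    next
      fix j assume j: "j \<in> {1..s}"
      show "(LINT t|lborel. indicator {0..<1} t * ?h j t) \<le> 1 + \<gamma> j * (1 / 2 - mean_gap (p j) (G j) (int n - int m))"
        by (rule integral_min_halton_shift_le(2)[OF p[OF j] \<gamma>[OF j]])
    qed
    finally show "(LINT \<sigma>|lborel_dim s. ?C \<sigma> * ?T n m \<sigma>)
      \<le> (\<Prod>j=1..s. 1 + \<gamma> j * (1 / 2 - mean_gap (p j) (G j) (int n - int m)))" .
  qed
  let ?E = "\<lambda>\<sigma>. sobolev_discrepancy s \<gamma> N (?x \<sigma>)"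
  have CE: "?C \<sigma> * ?E \<sigma> = ?c * ?C \<sigma> - 2 / real N * (\<Sum>n<N. ?C \<sigma> * ?S n \<sigma>)
      + 1 / (real N)\<^sup>2 * (\<Sum>n<N. \<Sum>m<N. ?C \<sigma> * ?T n m \<sigma>)" for \<sigma>
    unfolding sobolev_discrepancy_def by (simp add: sum_distrib_left[symmetric] algebra_simps)
  have int_E: "integrable (lborel_dim s) (\<lambda>\<sigma>. ?C \<sigma> * ?E \<sigma>)"
    unfolding CE using const S T
    by (intro Bochner_Integration.integrable_add Bochner_Integration.integrable_diff
        integrable_mult_right Bochner_Integration.integrable_sum) auto
  have "(rms_worst_case_error H ip s N p)\<^sup>2 = (LINT \<sigma>|?U. (worst_case_error H ip s N (?x \<sigma>))\<^sup>2)"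
    unfolding rms_worst_case_error_def by (intro real_sqrt_pow2 integral_nonneg_AE) simp
  also have "\<dots> \<le> (LINT \<sigma>|lborel_dim s. ?C \<sigma> * ?E \<sigma>)"
    using worst_case_error_square_le[OF rkhs \<gamma> x] by (intro expectation_half_open_cube_le int_E) simp
  also have "\<dots> = ?c * 1 - 2 / real N * (\<Sum>n<N. ?c)
      + 1 / (real N)\<^sup>2 * (\<Sum>n<N. \<Sum>m<N. LINT \<sigma>|lborel_dim s. ?C \<sigma> * ?T n m \<sigma>)"
  proof -
    have linear: "(LINT \<sigma>|lborel_dim s. a * f \<sigma> - b * (\<Sum>n<N. g n \<sigma>) + d * (\<Sum>n<N. \<Sum>m<N. h n m \<sigma>))
      = a * integral\<^sup>L (lborel_dim s) f - b * (\<Sum>n<N. integral\<^sup>L (lborel_dim s) (g n))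
        + d * (\<Sum>n<N. \<Sum>m<N. integral\<^sup>L (lborel_dim s) (h n m))"
      if "integrable (lborel_dim s) f" "\<And>n. integrable (lborel_dim s) (g n)"
        "\<And>n m. integrable (lborel_dim s) (h n m)" for f g h and a b d :: real
      using that by simp
    show ?thesis
      unfolding CE linear[OF const(1) S(1) T(1)] const(2) S(2) ..
  qed
  also have "\<dots> \<le> ?c * 1 - 2 / real N * (\<Sum>n<N. ?c)
      + 1 / (real N)\<^sup>2 * (\<Sum>n<N. \<Sum>m<N. \<Prod>j=1..s. 1 + \<gamma> j * (1 / 2 - mean_gap (p j) (G j) (int n - int m)))"
    using T(2) by (intro add_left_mono mult_left_mono sum_mono) auto
  finally show ?thesis using N by simp
qed

section \<open>The error bound for a fixed number of points\<close>

text \<open>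
  Expanding the product gives one term for each choice of a level, or of the constant \<open>1 + \<gamma>\<^sub>j/3\<close>, in every coordinate. The term
  with constants only is the true mean. In any other term some factor has zero mean, so that the sum
  over \<open>n\<close> and \<open>m\<close> is at most a product with factors \<open>1 + \<gamma>\<^sub>j/3\<close> for the constants and \<open>\<gamma>\<^sub>j p\<^sub>j\<^sup>2/6\<close> for the levels,
  whatever the levels are. There are \<open>G\<^sub>j\<close> levels in coordinate \<open>j\<close>.
\<close>

lemma main_term_le:
  fixes p G :: "nat \<Rightarrow> nat" and \<gamma> :: "nat \<Rightarrow> real"
  assumes p: "\<And>j. j \<in> {1..s} \<Longrightarrow> p j > 0"
    and cop: "\<And>i j. i \<in> {1..s} \<Longrightarrow> j \<in> {1..s} \<Longrightarrow> i \<noteq> j \<Longrightarrow> coprime (p i) (p j)"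
    and \<gamma>: "\<And>j. j \<in> {1..s} \<Longrightarrow> 0 \<le> \<gamma> j"
  shows "(\<Sum>n<N. \<Sum>m<N. \<Prod>j=1..s. 1 + \<gamma> j * (1 / 3 + (\<Sum>a<G j. gap_fluctuation (p j) a (int n - int m))))
    \<le> (real N)\<^sup>2 * (\<Prod>j=1..s. 1 + \<gamma> j / 3)
      + (\<Prod>j=1..s. 1 + \<gamma> j / 3 + real (G j) * (\<gamma> j * (real (p j))\<^sup>2 / 6)) - (\<Prod>j=1..s. 1 + \<gamma> j / 3)"
proof -
  \<comment> \<open>Index \<open>0\<close> stands for the constant part and index \<open>Suc a\<close> for level \<open>a\<close>, so that \<open>p j ^ a j\<close> is a period in either case.\<close>
  define W where "W = (\<lambda>j a d. case a of 0 \<Rightarrow> 1 + \<gamma> j / 3 | Suc a \<Rightarrow> \<gamma> j * gap_fluctuation (p j) a d)"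
  define L where "L = (\<lambda>j a. case a of 0 \<Rightarrow> 1 + \<gamma> j / 3 | Suc (a::nat) \<Rightarrow> \<gamma> j * (real (p j))\<^sup>2 / 6)"
  define A where "A = PiE {1..s} (\<lambda>j. {..<Suc (G j)})"
  define z where "z = (\<lambda>j\<in>{1..s}. 0 :: nat)"
  define T where "T = (\<lambda>a. \<Sum>m<N. \<Sum>n<N. \<Prod>j=1..s. W j (a j) (int n - int m))"
  have A: "finite A" "z \<in> A" by (auto simp: A_def z_def intro!: finite_PiE)
  have W_sum: "(\<Sum>a<Suc (G j). W j a d) = 1 + \<gamma> j * (1 / 3 + (\<Sum>a<G j. gap_fluctuation (p j) a d))" for j d
    by (simp only: sum.lessThan_Suc_shift) (simp add: W_def sum_distrib_left distrib_left)
  have L_sum: "(\<Sum>a<Suc (G j). L j a) = 1 + \<gamma> j / 3 + real (G j) * (\<gamma> j * (real (p j))\<^sup>2 / 6)" for j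
    by (simp only: sum.lessThan_Suc_shift) (simp add: L_def)
  have "(\<Sum>n<N. \<Sum>m<N. \<Prod>j=1..s. 1 + \<gamma> j * (1 / 3 + (\<Sum>a<G j. gap_fluctuation (p j) a (int n - int m))))
      = (\<Sum>n<N. \<Sum>m<N. \<Sum>a\<in>A. \<Prod>j=1..s. W j (a j) (int n - int m))"
    unfolding W_sum[symmetric] A_def by (intro sum.cong refl prod_sum_PiE) auto
  also have "\<dots> = (\<Sum>m<N. \<Sum>n<N. \<Sum>a\<in>A. \<Prod>j=1..s. W j (a j) (int n - int m))"
    by (rule sum.swap)
  also have "\<dots> = (\<Sum>m<N. \<Sum>a\<in>A. \<Sum>n<N. \<Prod>j=1..s. W j (a j) (int n - int m))"
    by (intro sum.cong refl sum.swap)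
  also have "\<dots> = (\<Sum>a\<in>A. T a)"
    unfolding T_def by (rule sum.swap)
  also have "\<dots> = T z + (\<Sum>a\<in>A - {z}. T a)"
    by (rule sum.remove[OF A])
  also have "\<dots> \<le> T z + (\<Sum>a\<in>A - {z}. \<Prod>j=1..s. L j (a j))"
  proof (intro add_left_mono sum_mono)
    fix a assume a: "a \<in> A - {z}"
    have "\<exists>k\<in>{1..s}. a k \<noteq> 0"
    proof (rule ccontr)
      assume "\<not> ?thesis"
      then have "a = z"
        using a by (intro extensionalityI[of _ "{1..s}"]) (auto simp: A_def z_def PiE_iff)
      then show False using a by simp
    qed
    then obtain k b where k: "k \<in> {1..s}" "a k = Suc b" by (metis not0_implies_Suc)
    have "\<bar>T a\<bar> \<le> (\<Prod>j=1..s. L j (a j))"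
      unfolding T_def
    proof (rule abs_sum_differences_prod_le[where q = "\<lambda>j. p j ^ a j" and k = k])
      fix j assume j: "j \<in> {1..s}"
      show "periodic (p j ^ a j) (W j (a j))"
      proof (cases "a j")
        case 0
        then show ?thesis by (simp add: W_def periodic_def)
      next
        case (Suc b)
        have "W j (a j) = (\<lambda>d. \<gamma> j * gap_fluctuation (p j) b d)" by (simp add: W_def Suc)
        then show ?thesis
          using periodic_compose[OF periodic_gap_fluctuation[OF p[OF j], of b], of "\<lambda>t. \<gamma> j * t"]
          by (simp only: Suc)
      qed
      show "p j ^ a j > 0" using p[OF j] by simp
      show "real (p j ^ a j) * (\<Sum>d<p j ^ a j. \<bar>W j (a j) (int d)\<bar>) \<le> L j (a j)"
      proof (cases "a j")
        case 0
        then show ?thesis using \<gamma>[OF j] by (simp add: W_def L_def)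
      next
        case (Suc b)
        have "real (p j ^ Suc b) * (\<Sum>d<p j ^ Suc b. \<bar>W j (Suc b) (int d)\<bar>)
            = \<gamma> j * (real (p j ^ Suc b) * (\<Sum>d<p j ^ Suc b. \<bar>gap_fluctuation (p j) b (int d)\<bar>))"
          using \<gamma>[OF j] by (simp add: W_def abs_mult sum_distrib_left[symmetric])
        also have "\<dots> \<le> \<gamma> j * ((real (p j))\<^sup>2 / 6)"
          by (intro mult_left_mono sum_abs_gap_fluctuation p \<gamma> j)
        finally show ?thesis by (simp only: Suc) (simp add: L_def)
      qed
      show "coprime (p j ^ a j) (p i ^ a i)" if "i \<in> {1..s}" "j \<noteq> i" for i
        using cop[OF j that] by simp
    next
      have "(\<Sum>d<p k ^ Suc b. W k (Suc b) (int d)) = \<gamma> k * (\<Sum>d<p k ^ Suc b. gap_fluctuation (p k) b (int d))"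
        by (simp add: W_def sum_distrib_left)
      then show "(\<Sum>d<p k ^ a k. W k (a k) (int d)) = 0"
        using k sum_gap_fluctuation[OF p[OF k(1)], of b] by (simp only: k(2))
    qed (use k in auto)
    then show "T a \<le> (\<Prod>j=1..s. L j (a j))" by linarith
  qed
  also have "(\<Sum>a\<in>A - {z}. \<Prod>j=1..s. L j (a j)) = (\<Sum>a\<in>A. \<Prod>j=1..s. L j (a j)) - (\<Prod>j=1..s. L j (z j))"
    using sum.remove[OF A, of "\<lambda>a. \<Prod>j=1..s. L j (a j)"] by simp
  also have "(\<Sum>a\<in>A. \<Prod>j=1..s. L j (a j)) = (\<Prod>j=1..s. \<Sum>a<Suc (G j). L j a)"
    unfolding A_def by (rule prod_sum_PiE[symmetric]) auto
  also have "(\<Prod>j=1..s. L j (z j)) = (\<Prod>j=1..s. 1 + \<gamma> j / 3)"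
    by (intro prod.cong) (simp_all add: L_def z_def)
  also have "T z = (real N)\<^sup>2 * (\<Prod>j=1..s. 1 + \<gamma> j / 3)"
  proof -
    have "(\<Prod>j=1..s. W j (z j) d) = (\<Prod>j=1..s. 1 + \<gamma> j / 3)" for d
      by (intro prod.cong) (simp_all add: W_def z_def)
    then show ?thesis unfolding T_def by (simp add: power2_eq_square mult.assoc)
  qed
  finally show ?thesis unfolding L_sum by simp
qed

lemma prod_diff_le:
  fixes a b B e :: "'i \<Rightarrow> real"
  assumes "finite I" "\<And>i. i \<in> I \<Longrightarrow> 0 \<le> b i" "\<And>i. i \<in> I \<Longrightarrow> b i \<le> a i" "\<And>i. i \<in> I \<Longrightarrow> a i \<le> B i"
    "\<And>i. i \<in> I \<Longrightarrow> 1 \<le> B i" "\<And>i. i \<in> I \<Longrightarrow> a i - b i \<le> e i"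
  shows "(\<Prod>i\<in>I. a i) - (\<Prod>i\<in>I. b i) \<le> (\<Prod>i\<in>I. B i) * (\<Sum>i\<in>I. e i)"
  using assms
proof (induction I rule: finite_induct)
  case (insert i I)
  let ?a = "\<Prod>i\<in>I. a i" and ?b = "\<Prod>i\<in>I. b i" and ?B = "\<Prod>i\<in>I. B i" and ?e = "\<Sum>i\<in>I. e i"
  have bB: "b k \<le> B k" if "k \<in> insert i I" for k
    using insert.prems(2,3)[OF that] by linarith
  have b: "0 \<le> ?b" using insert.prems by (intro prod_nonneg) auto
  have bB': "?b \<le> ?B" using insert.prems bB by (intro prod_mono) auto
  have ba: "?b \<le> ?a" using insert.prems by (intro prod_mono) auto
  have ab: "?a - ?b \<le> ?B * ?e" using insert by simp
  have 1: "0 \<le> b i" "b i \<le> a i" "a i \<le> B i" "1 \<le> B i" "a i - b i \<le> e i"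
    using insert.prems by simp_all
  have "a i * ?a - b i * ?b = a i * (?a - ?b) + (a i - b i) * ?b"
    by (simp add: algebra_simps)
  also have "\<dots> \<le> B i * (?B * ?e) + e i * ?B"
    using 1 b bB' ba ab by (intro add_mono mult_mono) auto
  also have "\<dots> \<le> B i * (?B * ?e) + B i * (e i * ?B)"
    using 1 b bB' mult_right_mono[of 1 "B i" "e i * ?B"] by auto
  also have "\<dots> = B i * ?B * (e i + ?e)"
    by (simp add: algebra_simps)
  finally show ?case using insert.hyps by simp
qed simp

lemma one_plus_sum_le_prod:
  fixes x :: "'i \<Rightarrow> real"
  assumes "finite I" "\<And>i. i \<in> I \<Longrightarrow> 0 \<le> x i"
  shows "1 + (\<Sum>i\<in>I. x i) \<le> (\<Prod>i\<in>I. 1 + x i)"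
  using assms
proof (induction I rule: finite_induct)
  case (insert i I)
  have "0 \<le> x i" "0 \<le> (\<Sum>i\<in>I. x i)" using insert.prems by (auto intro: sum_nonneg)
  then have "1 + (x i + (\<Sum>i\<in>I. x i)) \<le> (1 + x i) * (1 + (\<Sum>i\<in>I. x i))"
    by (simp add: algebra_simps)
  also have "\<dots> \<le> (1 + x i) * (\<Prod>i\<in>I. 1 + x i)"
    using insert by (intro mult_left_mono) auto
  finally show ?case using insert.hyps by simp
qed simp

lemma kernel_mean_le_truncated:
  fixes p G :: "nat \<Rightarrow> nat" and \<gamma> :: "nat \<Rightarrow> real"
  assumes p: "\<And>j. j \<in> {1..s} \<Longrightarrow> p j > 0" and \<gamma>: "\<And>j. j \<in> {1..s} \<Longrightarrow> 0 \<le> \<gamma> j"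
  shows "(\<Prod>j=1..s. 1 + \<gamma> j * (1 / 2 - mean_gap (p j) (G j) d))
    \<le> (\<Prod>j=1..s. 1 + \<gamma> j * (1 / 3 + (\<Sum>a<G j. gap_fluctuation (p j) a d)))
      + (\<Prod>j=1..s. 1 + \<gamma> j / 2) * (\<Sum>j=1..s. \<gamma> j / (6 * real (p j) ^ G j))"
proof -
  let ?a = "\<lambda>j. 1 + \<gamma> j * (1 / 2 - mean_gap (p j) (G j) d)"
  let ?b = "\<lambda>j. 1 + \<gamma> j * (1 / 3 + (\<Sum>a<G j. gap_fluctuation (p j) a d))"
  have "(\<Prod>j=1..s. ?a j) - (\<Prod>j=1..s. ?b j)
    \<le> (\<Prod>j=1..s. 1 + \<gamma> j / 2) * (\<Sum>j=1..s. \<gamma> j / (6 * real (p j) ^ G j))"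
  proof (rule prod_diff_le)
    fix j assume j: "j \<in> {1..s}"
    define g where "g = mean_gap (p j) (G j) d"
    define f where "f = (\<Sum>a<G j. gap_fluctuation (p j) a d)"
    define e where "e = 1 / (6 * real (p j) ^ G j)"
    have g: "0 \<le> g" "g \<le> 1 / 4"
      unfolding g_def by (rule mean_gap_nonneg[OF p[OF j]], rule mean_gap_le[OF p[OF j]])
    have f: "0 \<le> 1 / 6 - g - f" "1 / 6 - g - f \<le> e"
      using mean_gap_fluctuation_bounds[OF p[OF j], where d = d and G = "G j"] by (simp_all add: g_def f_def e_def)
    have "real (p j) ^ G j \<ge> 1" using p[OF j] by simp
    then have "1 / real (p j) ^ G j \<le> 1" by (intro divide_le_eq_1[THEN iffD2]) auto
    then have e: "e \<le> 1 / 6" by (simp add: e_def)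
    have "0 \<le> 1 / 3 + f" using f g e by linarith
    then show "0 \<le> ?b j"
      using \<gamma>[OF j] unfolding f_def[symmetric] by simp
    show "?b j \<le> ?a j"
      using f \<gamma>[OF j] unfolding f_def[symmetric] g_def[symmetric] by (intro add_left_mono mult_left_mono) linarith+
    show "?a j \<le> 1 + \<gamma> j / 2"
      using g \<gamma>[OF j] mult_left_mono[of "1 / 2 - g" "1 / 2" "\<gamma> j"] unfolding g_def[symmetric] by simp
    show "1 \<le> 1 + \<gamma> j / 2" using \<gamma>[OF j] by simp
    have "?a j - ?b j = \<gamma> j * (1 / 6 - g - f)"
      unfolding f_def[symmetric] g_def[symmetric] by (simp add: algebra_simps)
    also have "\<dots> \<le> \<gamma> j * e" using f \<gamma>[OF j] by (intro mult_left_mono) auto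
    finally show "?a j - ?b j \<le> \<gamma> j / (6 * real (p j) ^ G j)" by (simp add: e_def)
  qed simp
  then show ?thesis by linarith
qed

lemma square_over_ln_ge: "p \<ge> 2 \<Longrightarrow> real p \<le> (real p)\<^sup>2 / ln (real p)"
proof -
  assume p: "p \<ge> 2"
  then have "0 < ln (real p)" "ln (real p) \<le> real p"
    using ln_le_minus_one[of "real p"] by simp_all
  then show "real p \<le> (real p)\<^sup>2 / ln (real p)"
    using p by (simp add: power2_eq_square le_divide_eq)
qed

text \<open>
  The levels satisfy \<open>p\<^sub>j ^ G\<^sub>j \<le> N\<^sup>2 < p\<^sub>j ^ (G\<^sub>j + 1)\<close>. The second inequality turns the truncation error, which is summed over \<open>N\<^sup>2\<close>
  pairs, into \<open>\<gamma>\<^sub>j p\<^sub>j/6\<close>. The first one gives \<open>G\<^sub>j \<le> 2 ln N/ln p\<^sub>j\<close>.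
\<close>

lemma rms_worst_case_error_bound:
  fixes p :: "nat \<Rightarrow> nat" and \<gamma> :: "nat \<Rightarrow> real"
  assumes rkhs: "rkhs (unit_cube s) (sobolev_kernel s \<gamma>) H ip"
    and prime: "\<And>j. j \<in> {1..s} \<Longrightarrow> prime (p j)" and inj: "inj_on p {1..s}"
    and \<gamma>: "\<And>j. j \<in> {1..s} \<Longrightarrow> 0 \<le> \<gamma> j" and N: "N \<ge> 1"
  shows "(rms_worst_case_error H ip s N p)\<^sup>2 \<le> 1 / (real N)\<^sup>2 *
    ((\<Prod>j=1..s. 1 + \<gamma> j * ln (real N) * ((real (p j))\<^sup>2 / ln (real (p j)))) +
     (\<Prod>j=1..s. 1 + \<gamma> j / 2) * (\<Prod>j=1..s. 1 + \<gamma> j * real (p j) / 6))"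
proof -
  have p2: "p j \<ge> 2" if "j \<in> {1..s}" for j using prime[OF that] by (rule prime_ge_2_nat)
  then have p0: "p j > 0" and p1: "p j > 1" if "j \<in> {1..s}" for j using p2[OF that] by simp_all
  have cop: "coprime (p i) (p j)" if "i \<in> {1..s}" "j \<in> {1..s}" "i \<noteq> j" for i j
    using that inj prime by (auto intro!: primes_coprime dest: inj_onD)
  have "\<exists>g. p j ^ g \<le> N\<^sup>2 \<and> N\<^sup>2 < p j ^ (g + 1)" if "j \<in> {1..s}" for j
    using ex_power_ivl1[of "p j" "N\<^sup>2"] p2[OF that] N by auto
  then obtain G where G: "\<And>j. j \<in> {1..s} \<Longrightarrow> p j ^ G j \<le> N\<^sup>2" "\<And>j. j \<in> {1..s} \<Longrightarrow> N\<^sup>2 < p j ^ (G j + 1)"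
    by metis
  let ?c = "\<Prod>j=1..s. 1 + \<gamma> j / 3" and ?A = "\<Prod>j=1..s. 1 + \<gamma> j / 2"
  let ?b = "\<lambda>d. \<Prod>j=1..s. 1 + \<gamma> j * (1 / 3 + (\<Sum>a<G j. gap_fluctuation (p j) a d))"
  let ?e = "\<Sum>j=1..s. \<gamma> j / (6 * real (p j) ^ G j)"
  let ?M = "\<Prod>j=1..s. 1 + \<gamma> j / 3 + real (G j) * (\<gamma> j * (real (p j))\<^sup>2 / 6)"
  let ?P = "\<Prod>j=1..s. 1 + \<gamma> j * ln (real N) * ((real (p j))\<^sup>2 / ln (real (p j)))"
  have A: "0 \<le> ?A" using \<gamma> by (intro prod_nonneg) (simp add: add_nonneg_nonneg)
  have "(rms_worst_case_error H ip s N p)\<^sup>2 \<le>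
      1 / (real N)\<^sup>2 * (\<Sum>n<N. \<Sum>m<N. \<Prod>j=1..s. 1 + \<gamma> j * (1 / 2 - mean_gap (p j) (G j) (int n - int m))) - ?c"
    using rkhs \<gamma> p1 N by (intro rms_worst_case_error_square_le) auto
  also have "\<dots> \<le> 1 / (real N)\<^sup>2 * (\<Sum>n<N. \<Sum>m<N. ?b (int n - int m) + ?A * ?e) - ?c"
    by (intro diff_right_mono mult_left_mono sum_mono kernel_mean_le_truncated p0 \<gamma>) auto
  also have "\<dots> = 1 / (real N)\<^sup>2 * ((\<Sum>n<N. \<Sum>m<N. ?b (int n - int m)) + (real N)\<^sup>2 * (?A * ?e)) - ?c"
    by (simp add: sum.distrib power2_eq_square)
  also have "\<dots> \<le> 1 / (real N)\<^sup>2 * (((real N)\<^sup>2 * ?c + ?M - ?c) + (real N)\<^sup>2 * (?A * ?e)) - ?c"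
    by (intro diff_right_mono mult_left_mono add_right_mono main_term_le p0 \<gamma> cop) auto
  also have "\<dots> = 1 / (real N)\<^sup>2 * ((?M - ?c) + ?A * ((real N)\<^sup>2 * ?e))"
    using N by (simp add: field_simps)
  also have "\<dots> \<le> 1 / (real N)\<^sup>2 * (?P + ?A * (\<Prod>j=1..s. 1 + \<gamma> j * real (p j) / 6))"
  proof (intro mult_left_mono add_mono A)
    have "(real N)\<^sup>2 * ?e \<le> (\<Sum>j=1..s. \<gamma> j * real (p j) / 6)"
      unfolding sum_distrib_left
    proof (rule sum_mono)
      fix j assume j: "j \<in> {1..s}"
      have P: "real (p j) ^ G j > 0" using p0[OF j] by simp
      have "real (N\<^sup>2) \<le> real (p j ^ (G j + 1))" using G(2)[OF j] by linarith
      then have "(real N)\<^sup>2 / real (p j) ^ G j \<le> real (p j)"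
        using P by (simp add: divide_le_eq)
      then have "\<gamma> j / 6 * ((real N)\<^sup>2 / real (p j) ^ G j) \<le> \<gamma> j / 6 * real (p j)"
        using \<gamma>[OF j] by (intro mult_left_mono) auto
      then show "(real N)\<^sup>2 * (\<gamma> j / (6 * real (p j) ^ G j)) \<le> \<gamma> j * real (p j) / 6"
        by (simp add: mult.commute)
    qed
    also have "\<dots> \<le> (\<Prod>j=1..s. 1 + \<gamma> j * real (p j) / 6)"
      using one_plus_sum_le_prod[of "{1..s}" "\<lambda>j. \<gamma> j * real (p j) / 6"] \<gamma> by simp
    finally show "(real N)\<^sup>2 * ?e \<le> (\<Prod>j=1..s. 1 + \<gamma> j * real (p j) / 6)" .
  next
    have c: "0 \<le> ?c" using \<gamma> by (intro prod_nonneg) (simp add: add_nonneg_nonneg)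
    \<comment> \<open>For \<open>N = 1\<close> there are no levels, the logarithm vanishes, and the subtracted \<open>?c\<close> is needed. For \<open>N \<ge> 2\<close> the slack in \<open>G\<^sub>j p\<^sub>j\<^sup>2/6 \<le> ln N p\<^sub>j\<^sup>2/(3 ln p\<^sub>j)\<close> absorbs the summand \<open>\<gamma>\<^sub>j/3\<close>.\<close>
    show "?M - ?c \<le> ?P"
    proof (cases "N = 1")
      case True
      have "G j = 0" if "j \<in> {1..s}" for j
      proof (rule ccontr)
        assume "G j \<noteq> 0"
        then have "1 < p j ^ G j" using p1[OF that] by (intro one_less_power) auto
        then show False using G(1)[OF that] True by simp
      qed
      then have "?M = ?c" by (intro prod.cong) auto
      then show ?thesis using True by simp
    next
      case False
      have "?M \<le> ?P"
      proof (intro prod_mono conjI)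
        fix j assume j: "j \<in> {1..s}"
        show "0 \<le> 1 + \<gamma> j / 3 + real (G j) * (\<gamma> j * (real (p j))\<^sup>2 / 6)"
          using \<gamma>[OF j] by (intro add_nonneg_nonneg mult_nonneg_nonneg) auto
        define R where "R = (real (p j))\<^sup>2 / ln (real (p j))"
        have lnp: "0 < ln (real (p j))" using p1[OF j] by simp
        have "real (p j) ^ G j \<le> (real N)\<^sup>2"
          using G(1)[OF j] by (metis of_nat_le_iff of_nat_power)
        then have "ln (real (p j) ^ G j) \<le> ln ((real N)\<^sup>2)"
          using p0[OF j] N by (subst ln_le_cancel_iff) auto
        then have "real (G j) * ln (real (p j)) \<le> 2 * ln (real N)"
          using p0[OF j] N by (simp add: ln_realpow)
        then have "real (G j) * ln (real (p j)) * R \<le> 2 * ln (real N) * R"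
          using lnp by (intro mult_right_mono) (auto simp: R_def)
        then have G_le: "real (G j) * (real (p j))\<^sup>2 \<le> 2 * (ln (real N) * R)"
          using lnp by (simp add: R_def)
        have "1 / 2 \<le> ln (real N)"
        proof -
          have "1 / 2 \<le> ln (2::real)" using ln2_ge_two_thirds by simp
          also have "\<dots> \<le> ln (real N)" using N False by simp
          finally show ?thesis .
        qed
        moreover have "2 \<le> R"
          using square_over_ln_ge[OF p2[OF j]] p2[OF j] by (simp add: R_def)
        ultimately have "1 / 2 * 2 \<le> ln (real N) * R"
          by (intro mult_mono) auto
        then have "1 / 3 + real (G j) * (real (p j))\<^sup>2 / 6 \<le> ln (real N) * R"
          using G_le by simp
        then have "\<gamma> j * (1 / 3 + real (G j) * (real (p j))\<^sup>2 / 6) \<le> \<gamma> j * (ln (real N) * R)"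
          using \<gamma>[OF j] by (intro mult_left_mono)
        then show "1 + \<gamma> j / 3 + real (G j) * (\<gamma> j * (real (p j))\<^sup>2 / 6)
            \<le> 1 + \<gamma> j * ln (real N) * ((real (p j))\<^sup>2 / ln (real (p j)))"
          by (simp add: R_def algebra_simps)
      qed
      then show ?thesis using c by simp
    qed
  qed simp
  finally show ?thesis .
qed

section \<open>Dimension-independent convergence\<close>

text \<open>
  The exponential bound \<open>1 + x L \<le> exp (x L)\<close> is applied only to a tail with small sum. For the finitely many remaining
  factors \<open>1 + x L \<le> (1 + x/\<eta>) (1 + \<eta> L)\<close> with small \<open>\<eta>\<close> moves the size of \<open>x\<close> into the constant.
\<close>

lemma prod_one_plus_le_exp:
  fixes x :: "nat \<Rightarrow> real"
  assumes x: "\<And>j. 1 \<le> j \<Longrightarrow> 0 \<le> x j" and sum: "summable (\<lambda>j. x (Suc j))" and \<epsilon>: "\<epsilon> > 0"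
  shows "\<exists>C>0. \<forall>s. \<forall>L\<ge>0. (\<Prod>j=1..s. 1 + x j * L) \<le> C * exp (\<epsilon> * L)"
proof -
  define y where "y = (\<lambda>k. x (Suc k))"
  have y: "0 \<le> y k" for k using x by (simp add: y_def)
  have y_sum: "summable y" using sum by (simp add: y_def[abs_def])
  obtain J where J: "norm (\<Sum>i. y (i + J)) < \<epsilon> / 2"
    using suminf_exist_split[OF half_gt_zero[OF \<epsilon>] y_sum] by auto
  define \<eta> where "\<eta> = \<epsilon> / (2 * (real J + 1))"
  have \<eta>: "\<eta> > 0" using \<epsilon> by (simp add: \<eta>_def)
  have J_\<eta>: "real J * \<eta> \<le> \<epsilon> / 2"
    using \<epsilon> by (simp add: \<eta>_def field_simps)
  define c where "c = (\<lambda>k. if k < J then 1 + y k / \<eta> else 1)"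
  define t where "t = (\<lambda>k. if k < J then \<eta> else y k)"
  have c: "1 \<le> c k" for k using y \<eta> by (simp add: c_def)
  have t: "0 \<le> t k" for k using y \<eta> by (simp add: t_def)
  have factor: "1 + y k * L \<le> c k * exp (t k * L)" if L: "0 \<le> L" for k L
  proof (cases "k < J")
    case True
    have "0 \<le> y k / \<eta>" "0 \<le> \<eta> * L" using y[of k] \<eta> L by simp_all
    moreover have "(1 + y k / \<eta>) * (1 + \<eta> * L) = 1 + y k * L + (y k / \<eta> + \<eta> * L)"
      using \<eta> by (simp add: field_simps)
    ultimately have "1 + y k * L \<le> (1 + y k / \<eta>) * (1 + \<eta> * L)"
      by linarith
    also have "\<dots> \<le> (1 + y k / \<eta>) * exp (\<eta> * L)"
      using \<open>0 \<le> y k / \<eta>\<close> by (intro mult_left_mono exp_ge_add_one_self) auto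
    finally show ?thesis using True by (simp add: c_def t_def)
  next
    case False
    then show ?thesis by (simp add: c_def t_def exp_ge_add_one_self)
  qed
  define C where "C = (\<Prod>k<J. c k)"
  have c_prod: "(\<Prod>k<s. c k) \<le> C" for s
  proof -
    have "(\<Prod>k<s. c k) \<le> (\<Prod>k<s. c k) * (\<Prod>k\<in>{s..<J + s}. c k)"
      using c mult_left_mono[of 1 "\<Prod>k\<in>{s..<J + s}. c k" "\<Prod>k<s. c k"]
      by (simp add: prod_ge_1 prod_nonneg order_trans[OF zero_le_one c])
    also have "\<dots> = (\<Prod>k\<in>{..<s} \<union> {s..<J + s}. c k)"
      by (rule prod.union_disjoint[symmetric]) auto
    also have "\<dots> = C"
      unfolding C_def by (rule prod.mono_neutral_right) (auto simp: c_def)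
    finally show ?thesis .
  qed
  have t_sum: "(\<Sum>k<s. t k) \<le> \<epsilon>" for s
  proof -
    have "(\<Sum>k<s. t k) \<le> (\<Sum>k<J + s. t k)"
      using t by (intro sum_mono2) auto
    also have "\<dots> = real J * \<eta> + (\<Sum>i<s. y (i + J))"
      unfolding sum_lessThan_add by (simp add: t_def add.commute)
    also have "(\<Sum>i<s. y (i + J)) \<le> (\<Sum>i. y (i + J))"
      using y_sum y by (intro sum_le_suminf) (auto simp: summable_iff_shift)
    finally show ?thesis using J J_\<eta> by simp
  qed
  have "(\<Prod>j=1..s. 1 + x j * L) \<le> C * exp (\<epsilon> * L)" if L: "0 \<le> L" for s L
  proof -
    have "(\<Prod>j=1..s. 1 + x j * L) = (\<Prod>k<s. 1 + y k * L)"
      by (simp add: y_def prod.atLeast1_atMost_eq)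
    also have "\<dots> \<le> (\<Prod>k<s. c k * exp (t k * L))"
      using factor[OF L] y L by (intro prod_mono) (simp add: add_nonneg_nonneg)
    also have "\<dots> = (\<Prod>k<s. c k) * exp ((\<Sum>k<s. t k) * L)"
      by (simp add: prod.distrib exp_sum sum_distrib_right)
    also have "\<dots> \<le> C * exp (\<epsilon> * L)"
      using c_prod[of s] t_sum[of s] L c c_prod[of 0]
      by (intro mult_mono) (auto intro: mult_right_mono)
    finally show ?thesis .
  qed
  moreover have "C > 0"
    unfolding C_def using c by (intro prod_pos) (auto intro: less_le_trans[OF zero_less_one])
  ultimately show ?thesis by blast
qed

theorem theorem1:
  fixes p :: "nat \<Rightarrow> nat" and \<gamma> :: "nat \<Rightarrow> real"
  assumes "\<And>j. 1 \<le> j \<Longrightarrow> prime (p j)"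
    and "inj_on p {1..}"
    and "\<And>j. 1 \<le> j \<Longrightarrow> 0 < \<gamma> j"
  shows "(\<forall>s\<ge>1. \<forall>N\<ge>1. \<forall>H ip. rkhs (unit_cube s) (sobolev_kernel s \<gamma>) H ip \<longrightarrow>
      (rms_worst_case_error H ip s N p)\<^sup>2 \<le>
        1 / (real N)\<^sup>2 *
          ((\<Prod>j=1..s. 1 + \<gamma> j * ln (real N) * ((real (p j))\<^sup>2 / ln (real (p j)))) +
           (\<Prod>j=1..s. 1 + \<gamma> j / 2) * (\<Prod>j=1..s. 1 + \<gamma> j * real (p j) / 6)))
    \<and> (summable (\<lambda>j. \<gamma> (Suc j) * ((real (p (Suc j)))\<^sup>2 / ln (real (p (Suc j))))) \<longrightarrow>
      (\<forall>\<delta>>0. \<exists>C>0. \<forall>s\<ge>1. \<forall>N\<ge>2. \<forall>H ip.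
        rkhs (unit_cube s) (sobolev_kernel s \<gamma>) H ip \<longrightarrow>
          rms_worst_case_error H ip s N p \<le> C / real N powr (1 - \<delta>)))"
proof -
  have bound: "(rms_worst_case_error H ip s N p)\<^sup>2 \<le> 1 / (real N)\<^sup>2 *
      ((\<Prod>j=1..s. 1 + \<gamma> j * ln (real N) * ((real (p j))\<^sup>2 / ln (real (p j)))) +
       (\<Prod>j=1..s. 1 + \<gamma> j / 2) * (\<Prod>j=1..s. 1 + \<gamma> j * real (p j) / 6))"
    if "rkhs (unit_cube s) (sobolev_kernel s \<gamma>) H ip" "N \<ge> 1" for s N H ip
    using that assms inj_on_subset[OF assms(2), of "{1..s}"]
    by (intro rms_worst_case_error_bound) (auto simp: less_imp_le)
  have "\<exists>C>0. \<forall>s\<ge>1. \<forall>N\<ge>2. \<forall>H ip. rkhs (unit_cube s) (sobolev_kernel s \<gamma>) H ip \<longrightarrow>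
      rms_worst_case_error H ip s N p \<le> C / real N powr (1 - \<delta>)"
    if sum: "summable (\<lambda>j. \<gamma> (Suc j) * ((real (p (Suc j)))\<^sup>2 / ln (real (p (Suc j)))))" and \<delta>: "\<delta> > 0" for \<delta>
  proof -
    define x where "x = (\<lambda>j. \<gamma> j * ((real (p j))\<^sup>2 / ln (real (p j))))"
    have x_ge: "\<gamma> j * real (p j) \<le> x j" if "1 \<le> j" for j
      unfolding x_def using that assms(1,3) square_over_ln_ge[OF prime_ge_2_nat]
      by (intro mult_left_mono) (auto simp: less_imp_le)
    have \<gamma>p: "0 \<le> \<gamma> j" "\<gamma> j \<le> \<gamma> j * real (p j)" if "1 \<le> j" for j
    proof -
      show "0 \<le> \<gamma> j" using assms(3)[OF that] by simp
      moreover have "1 \<le> real (p j)" using prime_ge_1_nat[OF assms(1)[OF that]] by simp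
      ultimately show "\<gamma> j \<le> \<gamma> j * real (p j)" using mult_left_mono[of 1 "real (p j)" "\<gamma> j"] by simp
    qed
    have x0: "0 \<le> x j" if "1 \<le> j" for j using x_ge[OF that] \<gamma>p[OF that] by linarith
    obtain B where B: "B > 0" "\<And>s L. 0 \<le> L \<Longrightarrow> (\<Prod>j=1..s. 1 + x j * L) \<le> B * exp (2 * \<delta> * L)"
      using prod_one_plus_le_exp[of x "2 * \<delta>"] x0 sum \<delta> by (auto simp: x_def)
    \<comment> \<open>By the case \<open>L = 1\<close>, \<open>D\<close> bounds both parts of the second product, whose factors are at most \<open>1 + x j\<close>.\<close>
    define D where "D = B * exp (2 * \<delta>)"
    have D: "D > 0" using B by (simp add: D_def)
    define C where "C = sqrt (B + D * D)"
    have C: "C > 0" using B D by (simp add: C_def add_pos_pos)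
    have "rms_worst_case_error H ip s N p \<le> C / real N powr (1 - \<delta>)"
      if N: "N \<ge> 2" and H: "rkhs (unit_cube s) (sobolev_kernel s \<gamma>) H ip" for s N H ip
    proof -
      let ?A = "\<Prod>j=1..s. 1 + \<gamma> j / 2" and ?E = "\<Prod>j=1..s. 1 + \<gamma> j * real (p j) / 6"
      have L: "0 \<le> ln (real N)" using N by simp
      have "(\<Prod>j=1..s. 1 + \<gamma> j * ln (real N) * ((real (p j))\<^sup>2 / ln (real (p j)))) \<le> B * exp (2 * \<delta> * ln (real N))"
        using B(2)[OF L, of s] by (simp add: x_def mult_ac)
      also have "exp (2 * \<delta> * ln (real N)) = real N powr (2 * \<delta>)"
        using N by (simp add: powr_def mult.commute)
      finally have first: "(\<Prod>j=1..s. 1 + \<gamma> j * ln (real N) * ((real (p j))\<^sup>2 / ln (real (p j)))) \<le> B * real N powr (2 * \<delta>)" .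
      have factor_le: "0 \<le> 1 + \<gamma> j / 2 \<and> 1 + \<gamma> j / 2 \<le> 1 + x j * 1"
        "0 \<le> 1 + \<gamma> j * real (p j) / 6 \<and> 1 + \<gamma> j * real (p j) / 6 \<le> 1 + x j * 1"
        if "j \<in> {1..s}" for j
      proof -
        have j: "1 \<le> j" using that by simp
        show "0 \<le> 1 + \<gamma> j / 2 \<and> 1 + \<gamma> j / 2 \<le> 1 + x j * 1"
          "0 \<le> 1 + \<gamma> j * real (p j) / 6 \<and> 1 + \<gamma> j * real (p j) / 6 \<le> 1 + x j * 1"
          using \<gamma>p[OF j] x_ge[OF j] by linarith+
      qed
      have "?A \<le> (\<Prod>j=1..s. 1 + x j * 1)"
        using factor_le by (intro prod_mono) auto
      also have "\<dots> \<le> D" unfolding D_def using B(2)[of 1 s] by simp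
      finally have A: "?A \<le> D" .
      have "?E \<le> (\<Prod>j=1..s. 1 + x j * 1)"
        using factor_le by (intro prod_mono) auto
      also have "\<dots> \<le> D" unfolding D_def using B(2)[of 1 s] by simp
      finally have E: "?E \<le> D" .
      have A0: "0 \<le> ?A" and E0: "0 \<le> ?E"
        using factor_le by (auto intro!: prod_nonneg)
      have "?A * ?E \<le> D * D" using A E A0 E0 D by (intro mult_mono) auto
      also have "\<dots> \<le> D * D * real N powr (2 * \<delta>)"
        using D N \<delta> ge_one_powr_ge_zero[of "real N" "2 * \<delta>"] by (simp add: mult_left_mono)
      finally have second: "?A * ?E \<le> D * D * real N powr (2 * \<delta>)" .
      have "(rms_worst_case_error H ip s N p)\<^sup>2 \<le> 1 / (real N)\<^sup>2 * (B * real N powr (2 * \<delta>) + D * D * real N powr (2 * \<delta>))"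
        using N first second
        by (intro order_trans[OF bound[OF H]] mult_left_mono add_mono) auto
      also have "\<dots> = (C / real N powr (1 - \<delta>))\<^sup>2"
      proof -
        have "(real N powr (1 - \<delta>))\<^sup>2 = real N powr (2 - 2 * \<delta>)"
          using N by (simp add: powr_power algebra_simps)
        also have "\<dots> = (real N)\<^sup>2 / real N powr (2 * \<delta>)"
          using N by (simp add: powr_diff powr_numeral)
        finally have "(real N powr (1 - \<delta>))\<^sup>2 = (real N)\<^sup>2 / real N powr (2 * \<delta>)" .
        moreover have "C\<^sup>2 = B + D * D" using B D by (simp add: C_def)
        ultimately show ?thesis by (simp add: power_divide distrib_right add_divide_distrib)
      qed
      finally show ?thesis
        by (rule power2_le_imp_le) (use C in simp)
    qed
    then show ?thesis using C by blast
  qed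
  then show ?thesis
    using bound by (intro conjI allI impI) simp_all
qed

end
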